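(* Consider the coupled network $$\tilde x_{t+1}=\left(\tilde A-(L_g(\Xi)\otimes GC)\right)\tilde x_t-\tilde B\tilde\phi(\tilde y_t)+v_t,\qquad \tilde y_t=\tilde C\tilde x_t .$$ It is mean square exponentially synchronizing if there exists a symmetric positive definite matrix $P>0$ such that $\Sigma_1-B^\top PB>0$ and, for each $\lambda_{sup}\in\{\lambda_2,\lambda_N\}$, $$\begin{aligned}P=&(A_0-\lambda_{sup}GC)^\top P(A_0-\lambda_{sup}GC)+(A_0-\lambda_{sup}GC)^\top PB(\Sigma_1-B^\top PB)^{-1}B^\top P(A_0-\lambda_{sup}GC)\\&+2\bar\gamma\tau\lambda_{sup}\left(C^\top G^\top PGC+C^\top G^\top PB(\Sigma_1-B^\top PB)^{-1}B^\top PGC\right)+C^\top\Sigma_1^{-1}C+R\end{aligned}$$ for some $R>0$ (which may depend on $\lambda_{sup}$), where $A_0=A-B\Sigma_1^{-1}C$, $\lambda_N$ is the largest eigenvalue and $\lambda_2$ the second smallest (Fiedler) eigenvalue of the nominal Laplacian, and $\tau:=\frac{\lambda_{N_u}}{\lambda_{N_u}+\lambda_{2_d}}$, with $\lambda_{N_u}$ the largest eigenvalue of the Laplacian $L_u$ of the purely uncertain graph and $\lambda_{2_d}$ the second smallest eigenvalue of the purely deterministic Laplacian $L_d$.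
   Context: There are $N$ identical subsystems with states $x^k_t\in\mathbb{R}^n$ and outputs $y^k_t=Cx^k_t\in\mathbb{R}^m$; $A\in\mathbb{R}^{n\times n}$, $B\in\mathbb{R}^{n\times m}$, $C\in\mathbb{R}^{m\times n}$, $G\in\mathbb{R}^{n\times m}$. Stacked: $\tilde x_t=[(x^1_t)^\top\cdots(x^N_t)^\top]^\top$, $\tilde y_t=[(y^1_t)^\top\cdots(y^N_t)^\top]^\top$, $\tilde\phi(\tilde y_t)=[\phi(y^1_t,t)^\top\cdots\phi(y^N_t,t)^\top]^\top$, $\tilde A=I_N\otimes A$, $\tilde B=I_N\otimes B$, $\tilde C=I_N\otimes C$. $v_t\in\mathbb{R}^{Nn}$ is zero-mean additive noise with covariance $R_v$. Nonlinearity: $\phi(\cdot,t):\mathbb{R}^m\to\mathbb{R}^m$ is globally Lipschitz, $C^1$ and monotonically nondecreasing; for some $D\in\mathbb{R}^{m\times m}$, $\phi(y,t)^\top(y-D\phi(y,t))>0$ for $y\ne0$ (and $\ge0$ at $y=0$); and for some $D_1\in\mathbb{R}^{m\times m}$ with $\Sigma_1=D_1+D_1^\top>0$, $(\phi(y,t)-\phi(y',t))^\top\left((y-y')-D_1(\phi(y,t)-\phi(y',t))\right)>0$ for $y\neq y'$. Network: the weighted graph is undirected, with mean weights $\mu_{ij}=\mu_{ji}>0$ on all edges. $E_U$ (nonempty) is the set of uncertain links $(i,j)$, $i>j$; the weight of $(i,j)\in E_U$ is $\mu_{ij}+\xi_{ij}(t)$, with $\xi_{ij}(t)$ zero-mean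 i.i.d. (in time), mutually independent, of variance $\sigma_{ij}^2$; the other links are deterministic with weight $\mu_{ij}$. $L_g(\Xi)=L+\sum_{(i,j)\in E_U}\xi_{ij}\ell_{ij}\ell_{ij}^\top$, where $\ell_{ij}\in\mathbb{R}^N$ has entry $1$ at $i$, $-1$ at $j$ and $0$ elsewhere, and $L$ is the nominal (mean) Laplacian (off-diagonal entries $-\mu_{ij}$, zero row sums) with eigenvalues $0=\lambda_1<\lambda_2\le\dots\le\lambda_N$. $L=L_d+L_u$, where $L_d$ is the Laplacian built from the deterministic edges and $L_u$ the Laplacian built from the mean weights $\mu_{ij}$ of the uncertain edges. The coefficient of dispersion of a link is $\gamma_{ij}=\sigma_{ij}^2/\mu_{ij}$ and $\bar\gamma=\max_{(i,j)}\gamma_{ij}$. Mean square exponential synchronization of the network: there exist $0<\beta<1$, $\bar K(\tilde e_0)>0$ and $c>0$ such that $E\|x^k_t-x^j_t\|^2\le\bar K(\tilde e_0)\beta^t\|x^k_0-x^j_0\|^2+c\|R_v\|$ for all $k,j\in\{1,\dots,N\}$, where $\tilde e_0$ is a function of the differences $\|x^i_0-x^\ell_0\|^2$, $i,\ell\in\{1,\dots,N\}$, and $\bar K(0)=K$ for some constant $K$. Expectations are over all randomness driving the system.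
   Formalization: For subsystems with equal initial states the factor ‖x_0^k−x_0^j‖² in the synchronization bound is replaced by the largest squared initial difference in the network (the literal bound fails there), and the additive noise v_t is assumed independent of the link noise ξ_ij. *)

theory Defs
  imports "HOL-Analysis.Analysis" "HOL-Probability.Probability"
begin

definition pos_def :: "real^'n^'n \<Rightarrow> bool" where
  "pos_def Q \<longleftrightarrow> transpose Q = Q \<and> (\<forall>x. x \<noteq> 0 \<longrightarrow> x \<bullet> (Q *v x) > 0)"

text \<open>For a symmetric matrix the algebraic and geometric multiplicities agree, so
  \<open>sorted_eigenvalues\<close> lists all eigenvalues with multiplicity in nondecreasing order.
  It is applied to symmetric matrices only. The index of \<open>ordered_eigenvalue\<close>
  starts at 1.\<close>

definition eigenspace :: "real^'n^'n \<Rightarrow> real \<Rightarrow> (real^'n) set" where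
  "eigenspace Q l = {x. Q *v x = l *\<^sub>R x}"

definition sorted_eigenvalues :: "real^'n^'n \<Rightarrow> real list" where
  "sorted_eigenvalues Q =
     concat (map (\<lambda>l. replicate (dim (eigenspace Q l)) l)
       (sorted_list_of_set {l. \<exists>x. x \<noteq> 0 \<and> Q *v x = l *\<^sub>R x}))"

definition ordered_eigenvalue :: "nat \<Rightarrow> real^'n^'n \<Rightarrow> real" where
  "ordered_eigenvalue k Q = sorted_eigenvalues Q ! (k - 1)"

text \<open>The space of stacked states, usually written as the \<open>N * n\<close>-dimensional
  Euclidean space, is indexed by pairs (subsystem, component).\<close>

definition kron :: "real^'b^'a \<Rightarrow> real^'d^'c \<Rightarrow> real^('b \<times> 'd)^('a \<times> 'c)"  (infixl "\<otimes>\<^sub>K" 72) where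
  "P \<otimes>\<^sub>K Q = (\<chi> p q. P $ fst p $ fst q * Q $ snd p $ snd q)"

definition block :: "'v \<Rightarrow> real^('v::finite \<times> 'n::finite) \<Rightarrow> real^'n" where
  "block k x = (\<chi> i. x $ (k, i))"

definition stacked :: "(real^'m \<Rightarrow> real^'m) \<Rightarrow> real^('v::finite \<times> 'm::finite) \<Rightarrow> real^('v \<times> 'm)" where
  "stacked f y = (\<chi> p. f (block (fst p) y) $ snd p)"

text \<open>An undirected link is represented by the single pair \<open>(i, j)\<close> with \<open>i > j\<close>.\<close>

definition laplacian :: "('v \<times> 'v) set \<Rightarrow> ('v \<Rightarrow> 'v \<Rightarrow> real) \<Rightarrow> real^'v^'v::finite" where
  "laplacian E w =
     (let w' = (\<lambda>i j. if (i, j) \<in> E \<or> (j, i) \<in> E then w i j else 0)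
      in \<chi> i j. if i = j then (\<Sum>k\<in>UNIV - {i}. w' i k) else - w' i j)"

definition ell :: "'v \<times> 'v \<Rightarrow> real^'v::finite" where
  "ell e = (\<chi> k. if k = fst e then 1 else if k = snd e then - 1 else 0)"

definition random_laplacian ::
    "('v \<times> 'v) set \<Rightarrow> ('v \<times> 'v) set \<Rightarrow> ('v \<Rightarrow> 'v \<Rightarrow> real) \<Rightarrow> ('v \<times> 'v \<Rightarrow> real) \<Rightarrow> real^'v^'v::finite" where
  "random_laplacian E E_U \<mu> \<xi> =
     laplacian E \<mu> + (\<Sum>e\<in>E_U. \<xi> e *\<^sub>R (\<chi> a b. ell e $ a * ell e $ b))"

definition initial_differences ::
    "real^('v::finite \<times> 'n::finite) \<Rightarrow> 'v \<Rightarrow> 'v \<Rightarrow> real" where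
  "initial_differences x0 i l = (norm (block i x0 - block l x0))\<^sup>2"

text \<open>\<open>X x0 t \<omega>\<close> is the stacked state at time \<open>t\<close> of the solution started at the
  deterministic state \<open>x0\<close>. For a pair with distinct initial states the factor
  \<open>rho\<close> is the squared initial difference of that pair. For a pair of subsystems started
  at the same state a bound with this factor would be violated as soon as the remaining
  subsystems drive the two apart (a finite \<open>Kbar\<close> cannot compensate a factor
  \<open>0\<close>), so there \<open>rho\<close> is the largest squared initial difference in the
  network. \<open>Kbar\<close> is a function of all the differences, and does not depend on the
  pair; it may be unbounded. The norm of \<open>Rv\<close> is the spectral norm.\<close>

definition mean_square_exp_sync ::
    "'w measure \<Rightarrow> (real^('v \<times> 'n) \<Rightarrow> nat \<Rightarrow> 'w \<Rightarrow> real^('v \<times> 'n)) \<Rightarrow>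
     real^('v::finite \<times> 'n::finite)^('v \<times> 'n) \<Rightarrow> bool" where
  "mean_square_exp_sync M X Rv \<longleftrightarrow>
     (\<exists>\<beta> c K Kbar.
        0 < \<beta> \<and> \<beta> < 1 \<and> 0 < c \<and> (\<forall>d. 0 < Kbar d) \<and> Kbar (\<lambda>_ _. 0) = K \<and>
        (\<forall>x0 k j t.
           let d = initial_differences x0;
               rho = (if block k x0 \<noteq> block j x0 then (norm (block k x0 - block j x0))\<^sup>2
                      else Max (range (\<lambda>(i, l). d i l)))
           in integrable M (\<lambda>\<omega>. (norm (block k (X x0 t \<omega>) - block j (X x0 t \<omega>)))\<^sup>2) \<and>
              (\<integral>\<omega>. (norm (block k (X x0 t \<omega>) - block j (X x0 t \<omega>)))\<^sup>2 \<partial>M)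
                \<le> Kbar d * \<beta> ^ t * rho + c * onorm ((*v) Rv)))"

end

theory Submission
  imports Defs
begin

text \<open>
  Let \<open>P\<close> solve the Riccati equations. The Lyapunov function is the form \<open>z \<mapsto> z \<bullet> P z\<close>, summed over the
  components of the stacked state along an orthonormal eigenbasis of the mean Laplacian on the orthogonal
  complement of the consensus direction. By Parseval (\<open>mode_parseval\<close>) this energy is also, up to a factor,
  the sum of \<open>(x\<^sub>k - x\<^sub>j) \<bullet> P (x\<^sub>k - x\<^sub>j)\<close> over all pairs of subsystems.

  The two descriptions serve two different purposes. The linear coupling is diagonal in the modes: mode \<open>u\<close>
  with eigenvalue \<open>l\<close> evolves by \<open>A - l G C\<close>. The nonlinearity is not, it mixes the modes; but its
  incremental sector condition holds for every pair of subsystems, and so, by Parseval, it holds for the sum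
  over all modes (\<open>sector_modes\<close>). As a multiplier needs to be nonnegative only in this sum, every mode may be
  treated on its own with its own part of the multiplier added. The Riccati equation is what makes the
  resulting single-mode expression smaller than \<open>\<rho> < 1\<close> times the old form, by a loop transformation and a
  completion of squares (\<open>riccati_mode_contraction\<close>). The expression is convex in \<open>l\<close>, so the two extreme
  eigenvalues control all those in between.

  The link noise at time \<open>t\<close> is centered and independent of the state at time \<open>t\<close>
  (\<open>innovation_independence\<close>), so it contributes only the variance term
  \<open>2 (\<Sum>e. \<sigma>\<^sub>e\<^sup>2 (G C d\<^sub>e) \<bullet> P (G C d\<^sub>e))\<close>, where \<open>d\<^sub>e\<close> is the state difference across the link \<open>e\<close>. With
  \<open>\<sigma>\<^sub>e\<^sup>2 \<le> \<gamma> \<mu>\<^sub>e\<close> this is at most \<open>2 \<gamma>\<close> times a quadratic form in the uncertain Laplacian, and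
  \<open>L_u \<le> \<tau> L\<close> (\<open>uncertain_laplacian_le\<close>) turns it into the term \<open>2 \<gamma> \<tau> l\<close> of mode \<open>u\<close>.

  The additive noise may be correlated in time, and thereby with the state. Young's inequality separates the
  two at the price of half of the contraction margin, which gives a geometric decay of the expected energy up
  to a multiple of the norm of the covariance.
\<close>

section \<open>Symmetric matrices\<close>

lemma symmetric_inner:
  fixes Q :: "real^'a^'a"
  assumes "transpose Q = Q"
  shows "(Q *v x) \<bullet> y = x \<bullet> (Q *v y)"
  by (metis assms dot_lmul_matrix transpose_matrix_vector)

lemma quadratic_form_le:
  fixes Q :: "real^'a^'a"
  obtains K where "K > 0" "\<And>x. x \<bullet> (Q *v x) \<le> K * (norm x)\<^sup>2"
proof
  have "x \<bullet> (Q *v x) \<le> (onorm ((*v) Q) + 1) * (norm x)\<^sup>2" for x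
  proof -
    have "x \<bullet> (Q *v x) \<le> norm x * norm (Q *v x)"
      by (rule norm_cauchy_schwarz)
    also have "\<dots> \<le> norm x * (onorm ((*v) Q) * norm x)"
      by (intro mult_left_mono onorm matrix_vector_mul_bounded_linear norm_ge_zero)
    also have "\<dots> \<le> (onorm ((*v) Q) + 1) * (norm x)\<^sup>2"
      by (simp add: power2_eq_square algebra_simps)
    finally show ?thesis .
  qed
  then show "\<And>x. x \<bullet> (Q *v x) \<le> (onorm ((*v) Q) + 1) * (norm x)\<^sup>2" .
  show "onorm ((*v) Q) + 1 > 0"
    using onorm_pos_le[OF matrix_vector_mul_bounded_linear[of Q]] by linarith
qed

lemma pos_def_ge:
  fixes Q :: "real^'a^'a"
  assumes "pos_def Q"
  obtains r where "r > 0" "\<And>x. r * (norm x)\<^sup>2 \<le> x \<bullet> (Q *v x)"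
proof -
  have "\<exists>u\<in>sphere 0 1. \<forall>x\<in>sphere 0 1. u \<bullet> (Q *v u) \<le> x \<bullet> (Q *v x)"
    by (rule continuous_attains_inf) (auto intro!: continuous_intros matrix_vector_mult_linear_continuous_on)
  then obtain u where u: "norm u = 1" "\<And>x. norm x = 1 \<Longrightarrow> u \<bullet> (Q *v u) \<le> x \<bullet> (Q *v x)"
    by auto
  have "(u \<bullet> (Q *v u)) * (norm x)\<^sup>2 \<le> x \<bullet> (Q *v x)" for x
  proof (cases "x = 0")
    case False
    then have "u \<bullet> (Q *v u) \<le> (x /\<^sub>R norm x) \<bullet> (Q *v (x /\<^sub>R norm x))"
      by (intro u(2)) simp
    also have "\<dots> = x \<bullet> (Q *v x) / (norm x)\<^sup>2"
      by (simp add: matrix_vector_mult_scaleR power2_eq_square divide_simps)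
    finally show ?thesis
      using False by (simp add: pos_le_divide_eq)
  qed simp
  moreover have "u \<bullet> (Q *v u) > 0"
    using assms u(1) unfolding pos_def_def by (metis norm_zero zero_neq_one)
  ultimately show ?thesis
    using that by blast
qed

text \<open>The residual \<open>y = Q u - l u\<close> is itself an admissible direction; moving from \<open>u\<close> along it would raise
  the quotient to first order at the rate \<open>2 (y \<bullet> y)\<close>.\<close>

lemma rayleigh_maximizer_is_eigenvector:
  fixes Q :: "real^'a^'a"
  assumes sym: "transpose Q = Q" and S: "subspace S" "\<And>x. x \<in> S \<Longrightarrow> Q *v x \<in> S"
    and u: "u \<in> S" "norm u = 1"
    and max: "\<And>y. y \<in> S \<Longrightarrow> y \<bullet> (Q *v y) \<le> (u \<bullet> (Q *v u)) * (norm y)\<^sup>2"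
  shows "Q *v u = (u \<bullet> (Q *v u)) *\<^sub>R u"
proof -
  define l where "l = u \<bullet> (Q *v u)"
  define y where "y = Q *v u - l *\<^sub>R u"
  define c where "c = l * (y \<bullet> y) - y \<bullet> (Q *v y)"
  have y: "y \<in> S"
    unfolding y_def using S u by (auto intro: subspace_diff subspace_scale)
  have uu: "u \<bullet> u = 1"
    using u(2) by (simp add: norm_eq_1)
  have uy: "u \<bullet> y = 0"
    by (simp add: y_def l_def inner_diff_right uu)
  have Qu: "Q *v u = y + l *\<^sub>R u"
    by (simp add: y_def)
  have yQu: "y \<bullet> (Q *v u) = y \<bullet> y"
    using uy by (simp add: Qu inner_add_right inner_commute)
  have uQy: "u \<bullet> (Q *v y) = y \<bullet> y"
    using yQu symmetric_inner[OF sym, of u y] by (simp add: inner_commute)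
  have *: "2 * s * (y \<bullet> y) \<le> s\<^sup>2 * c" for s
  proof -
    have "u + s *\<^sub>R y \<in> S"
      using S u y by (auto intro: subspace_add subspace_scale)
    from max[OF this] show ?thesis
      using uy yQu uQy uu unfolding l_def[symmetric] power2_norm_eq_inner c_def
      by (simp add: matrix_vector_right_distrib matrix_vector_mult_scaleR inner_add_left inner_add_right
          inner_commute[of y u] power2_eq_square algebra_simps l_def[symmetric])
  qed
  have c0: "c \<ge> 0"
    using max[OF y] by (simp add: c_def l_def power2_norm_eq_inner)
  have "y \<bullet> y = 0"
  proof (rule ccontr)
    assume "y \<bullet> y \<noteq> 0"
    then have p: "y \<bullet> y > 0"
      by (simp add: order_less_le)
    \<comment> \<open>a perturbation small enough for the first-order term to dominate\<close>
    from *[of "1 / (c + 1)"] have "2 * (y \<bullet> y) \<le> c / (c + 1)"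
      using c0 by (simp add: divide_simps power2_eq_square)
    then show False
      using * [of "(y \<bullet> y) / (c + 1)"] p c0
      by (simp add: divide_simps power2_eq_square)
  qed
  then show ?thesis
    by (simp add: y_def l_def)
qed

text \<open>The spectral theorem. Restricting it to an invariant subspace makes the induction work (split
  off a maximizer of the Rayleigh quotient), and is also what the disagreement space needs.\<close>

lemma spectral_theorem_on_subspace:
  fixes Q :: "real^'a^'a"
  assumes sym: "transpose Q = Q"
  shows "subspace S \<Longrightarrow> (\<And>x. x \<in> S \<Longrightarrow> Q *v x \<in> S) \<Longrightarrow>
    \<exists>U. finite U \<and> pairwise orthogonal U \<and> (\<forall>u\<in>U. norm u = 1) \<and> span U = S \<and>
        (\<forall>u\<in>U. Q *v u = (u \<bullet> (Q *v u)) *\<^sub>R u)"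
proof (induction "dim S" arbitrary: S rule: less_induct)
  case less
  show ?case
  proof (cases "S = {0}")
    case True
    then show ?thesis by (intro exI[of _ "{}"]) auto
  next
    case False
    have "0 \<in> S" using less.prems(1) by (rule subspace_0)
    with False obtain z where z: "z \<in> S" "z \<noteq> 0" by auto
    have "z /\<^sub>R norm z \<in> S \<inter> sphere 0 1"
      using z less.prems(1) by (auto intro: subspace_scale)
    then have "\<exists>u\<in>S \<inter> sphere 0 1. \<forall>y\<in>S \<inter> sphere 0 1. y \<bullet> (Q *v y) \<le> u \<bullet> (Q *v u)"
      using less.prems(1)
      by (intro continuous_attains_sup closed_Int_compact closed_subspace)
        (auto intro!: continuous_intros matrix_vector_mult_linear_continuous_on)
    then obtain u where u: "u \<in> S" "norm u = 1"
      and u_max: "\<And>y. y \<in> S \<Longrightarrow> norm y = 1 \<Longrightarrow> y \<bullet> (Q *v y) \<le> u \<bullet> (Q *v u)"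
      by auto
    have eig: "Q *v u = (u \<bullet> (Q *v u)) *\<^sub>R u"
    proof (rule rayleigh_maximizer_is_eigenvector[OF sym less.prems u])
      fix y assume y: "y \<in> S"
      show "y \<bullet> (Q *v y) \<le> (u \<bullet> (Q *v u)) * (norm y)\<^sup>2"
      proof (cases "y = 0")
        case False
        then have "(y /\<^sub>R norm y) \<bullet> (Q *v (y /\<^sub>R norm y)) \<le> u \<bullet> (Q *v u)"
          using y less.prems(1) by (intro u_max) (auto intro: subspace_scale)
        then show ?thesis
          using False by (simp add: matrix_vector_mult_scaleR power2_eq_square divide_simps mult.assoc)
      qed simp
    qed
    define T where "T = S \<inter> {y. u \<bullet> y = 0}"
    have T: "subspace T"
      unfolding T_def by (intro subspace_inter less.prems(1) subspace_hyperplane)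
    have T_inv: "Q *v y \<in> T" if "y \<in> T" for y
    proof -
      have "u \<bullet> (Q *v y) = (Q *v u) \<bullet> y"
        by (simp add: symmetric_inner[OF sym])
      also have "\<dots> = 0"
        using that by (subst eig) (simp add: T_def)
      finally show ?thesis
        using that less.prems(2) by (auto simp: T_def)
    qed
    have "u \<notin> T"
      using u(2) by (auto simp: T_def norm_eq_1)
    then have "T \<subset> S"
      using u(1) T_def by blast
    moreover have "span T = T" "span S = S"
      using T less.prems(1) by (simp_all only: span_eq_iff)
    ultimately have "dim T < dim S"
      by (intro dim_psubset) (simp only:)
    from less.hyps[OF this T T_inv] obtain U where U: "finite U" "pairwise orthogonal U" "\<forall>u\<in>U. norm u = 1" "span U = T"
        "\<forall>u\<in>U. Q *v u = (u \<bullet> (Q *v u)) *\<^sub>R u" by blast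
    have orth: "\<And>w. w \<in> U \<Longrightarrow> u \<bullet> w = 0"
      using U(4) span_base[of _ U] by (auto simp: T_def)
    have "span (insert u U) = S"
    proof
      show "span (insert u U) \<subseteq> S"
        using u(1) U(4) span_superset[of U] less.prems(1) by (intro span_minimal) (auto simp: T_def)
      show "S \<subseteq> span (insert u U)"
      proof
        fix y assume y: "y \<in> S"
        have "u \<bullet> (y - (u \<bullet> y) *\<^sub>R u) = 0"
          using u(2) by (simp add: inner_diff_right norm_eq_1)
        then have "y - (u \<bullet> y) *\<^sub>R u \<in> span U"
          unfolding U(4) T_def using y u(1) less.prems(1) by (auto intro!: subspace_diff subspace_scale)
        then show "y \<in> span (insert u U)"
          by (auto simp: span_insert)
      qed
    qed
    then show ?thesis
      using U u eig orth
      by (intro exI[of _ "insert u U"])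
        (auto simp: pairwise_insert orthogonal_def inner_commute)
  qed
qed

lemma inner_orthonormal_expansion:
  fixes U :: "'a::euclidean_space set"
  assumes "finite U" "pairwise orthogonal U" "\<And>u. u \<in> U \<Longrightarrow> norm u = 1" "x \<in> span U"
  shows "x \<bullet> y = (\<Sum>u\<in>U. (u \<bullet> x) * (u \<bullet> y))"
proof -
  have "x \<bullet> y = (\<Sum>u\<in>U. (x \<bullet> u) *\<^sub>R u) \<bullet> y"
    using orthonormal_basis_expand[OF assms(2,3,4,1)] by simp
  also have "\<dots> = (\<Sum>u\<in>U. (u \<bullet> x) * (u \<bullet> y))"
    by (simp add: inner_sum_left inner_commute[of x])
  finally show ?thesis .
qed

lemma quadratic_form_eigenbasis:
  fixes Q :: "real^'a^'a"
  assumes sym: "transpose Q = Q"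
    and U: "finite U" "pairwise orthogonal U" "\<And>u. u \<in> U \<Longrightarrow> norm u = 1"
    and eig: "\<And>u. u \<in> U \<Longrightarrow> Q *v u = (u \<bullet> (Q *v u)) *\<^sub>R u" and x: "x \<in> span U"
  shows "x \<bullet> (Q *v x) = (\<Sum>u\<in>U. (u \<bullet> (Q *v u)) * (u \<bullet> x)\<^sup>2)"
proof -
  have "x \<bullet> (Q *v x) = (\<Sum>u\<in>U. (u \<bullet> x) * (u \<bullet> (Q *v x)))"
    by (rule inner_orthonormal_expansion[OF U x])
  also have "\<dots> = (\<Sum>u\<in>U. (u \<bullet> (Q *v u)) * (u \<bullet> x)\<^sup>2)"
  proof (rule sum.cong[OF refl])
    fix u assume "u \<in> U"
    have "u \<bullet> (Q *v x) = (Q *v u) \<bullet> x"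
      by (simp add: symmetric_inner[OF sym])
    also have "\<dots> = (u \<bullet> (Q *v u)) * (u \<bullet> x)"
      by (subst eig[OF \<open>u \<in> U\<close>]) simp
    finally show "(u \<bullet> x) * (u \<bullet> (Q *v x)) = (u \<bullet> (Q *v u)) * (u \<bullet> x)\<^sup>2"
      by (simp add: power2_eq_square)
  qed
  finally show ?thesis .
qed

section \<open>Ordered eigenvalues\<close>

lemma subspace_eigenspace: "subspace (eigenspace Q l)"
  unfolding eigenspace_def subspace_def
  by (auto simp: matrix_vector_right_distrib matrix_vector_mult_scaleR scaleR_add_right)

text \<open>An orthonormal eigenbasis exhibits every eigenvalue together with its multiplicity, since
  eigenvectors to different eigenvalues of a symmetric matrix are orthogonal.\<close>

lemma eigenvalues_of_eigenbasis:
  fixes Q :: "real^'a^'a"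
  assumes sym: "transpose Q = Q"
    and U: "finite U" "pairwise orthogonal U" "\<And>u. u \<in> U \<Longrightarrow> norm u = 1" "span U = UNIV"
    and eig: "\<And>u. u \<in> U \<Longrightarrow> Q *v u = (u \<bullet> (Q *v u)) *\<^sub>R u"
  shows "{l. \<exists>x. x \<noteq> 0 \<and> Q *v x = l *\<^sub>R x} = (\<lambda>u. u \<bullet> (Q *v u)) ` U"
    and "dim (eigenspace Q l) = card {u\<in>U. u \<bullet> (Q *v u) = l}"
proof -
  have orth: "u \<bullet> x = 0" if "u \<in> U" "u \<bullet> (Q *v u) \<noteq> l" "Q *v x = l *\<^sub>R x" for u x l
  proof -
    have "l * (u \<bullet> x) = (Q *v u) \<bullet> x"
      using that(3) by (simp add: symmetric_inner[OF sym])
    also have "\<dots> = (u \<bullet> (Q *v u)) * (u \<bullet> x)"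
      by (subst eig[OF that(1)]) simp
    finally show ?thesis using that(2) by simp
  qed
  have expand: "x \<in> span {u\<in>U. u \<bullet> (Q *v u) = l}" if "Q *v x = l *\<^sub>R x" for x l
  proof -
    have "x = (\<Sum>u\<in>U. (x \<bullet> u) *\<^sub>R u)"
      using orthonormal_basis_expand[OF U(2,3) _ U(1), of x] U(4) by auto
    also have "\<dots> = (\<Sum>u\<in>{u\<in>U. u \<bullet> (Q *v u) = l}. (x \<bullet> u) *\<^sub>R u)"
      using orth[OF _ _ that] U(1) by (intro sum.mono_neutral_right) (auto simp: inner_commute)
    also have "\<dots> \<in> span {u\<in>U. u \<bullet> (Q *v u) = l}"
      by (intro span_sum span_scale span_base)
    finally show ?thesis .
  qed
  have nz: "u \<noteq> 0" if "u \<in> U" for u using U(3)[OF that] by auto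
  show "{l. \<exists>x. x \<noteq> 0 \<and> Q *v x = l *\<^sub>R x} = (\<lambda>u. u \<bullet> (Q *v u)) ` U"
  proof (intro equalityI subsetI)
    fix l assume "l \<in> {l. \<exists>x. x \<noteq> 0 \<and> Q *v x = l *\<^sub>R x}"
    then obtain x where x: "x \<noteq> 0" "Q *v x = l *\<^sub>R x" by auto
    then have "{u\<in>U. u \<bullet> (Q *v u) = l} \<noteq> {}"
      using expand[OF x(2)] by (metis (lifting) empty_iff singletonD span_empty)
    then show "l \<in> (\<lambda>u. u \<bullet> (Q *v u)) ` U" by auto
  qed (use eig nz in blast)
  have "eigenspace Q l = span {u\<in>U. u \<bullet> (Q *v u) = l}"
  proof
    show "eigenspace Q l \<subseteq> span {u\<in>U. u \<bullet> (Q *v u) = l}"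
      using expand by (auto simp: eigenspace_def)
    show "span {u\<in>U. u \<bullet> (Q *v u) = l} \<subseteq> eigenspace Q l"
      using eig by (intro span_minimal subspace_eigenspace) (auto simp: eigenspace_def)
  qed
  moreover have "independent {u\<in>U. u \<bullet> (Q *v u) = l}"
    using U(2) nz by (intro pairwise_orthogonal_independent) (auto simp: pairwise_def)
  ultimately show "dim (eigenspace Q l) = card {u\<in>U. u \<bullet> (Q *v u) = l}"
    by (metis dim_span_eq_card_independent)
qed

text \<open>Since a symmetric matrix is diagonalizable, the list has exactly as many entries as the matrix has
  rows; only then is the entry with index \<open>CARD('a)\<close> the last one.\<close>

lemma
  fixes Q :: "real^'a^'a"
  assumes sym: "transpose Q = Q"
  shows finite_eigenvalues: "finite {l. \<exists>x. x \<noteq> 0 \<and> Q *v x = l *\<^sub>R x}"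
    and length_sorted_eigenvalues: "length (sorted_eigenvalues Q) = CARD('a)"
proof -
  obtain U where U: "finite U" "pairwise orthogonal U" "\<And>u. u \<in> U \<Longrightarrow> norm u = 1" "span U = UNIV"
    and eig: "\<And>u. u \<in> U \<Longrightarrow> Q *v u = (u \<bullet> (Q *v u)) *\<^sub>R u"
    using spectral_theorem_on_subspace[OF sym subspace_UNIV] by auto
  let ?E = "{l. \<exists>x. x \<noteq> 0 \<and> Q *v x = l *\<^sub>R x}"
  note E = eigenvalues_of_eigenbasis[OF sym U eig]
  show fin: "finite ?E"
    using E(1) U(1) by simp
  have "length (sorted_eigenvalues Q) = sum_list (map (\<lambda>l. dim (eigenspace Q l)) (sorted_list_of_set ?E))"
    unfolding sorted_eigenvalues_def by (simp add: length_concat comp_def)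
  also have "\<dots> = (\<Sum>l\<in>?E. dim (eigenspace Q l))"
    using fin by (subst sum_list_distinct_conv_sum_set) auto
  also have "\<dots> = (\<Sum>l\<in>(\<lambda>u. u \<bullet> (Q *v u)) ` U. card {u\<in>U. u \<bullet> (Q *v u) = l})"
    by (simp only: E)
  also have "\<dots> = card U"
    using sum.image_gen[OF U(1), of "\<lambda>_. 1::nat" "\<lambda>u. u \<bullet> (Q *v u)"] by simp
  also have "\<dots> = dim (span U)"
    using pairwise_orthogonal_independent[OF U(2)] U(3)
    by (metis dim_span_eq_card_independent norm_zero zero_neq_one)
  finally show "length (sorted_eigenvalues Q) = CARD('a)"
    by (simp add: U(4))
qed

lemma sorted_concat_replicate:
  "sorted ls \<Longrightarrow> sorted (concat (map (\<lambda>l. replicate (f l) l) ls))"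
  by (induction ls) (auto simp: sorted_append)

lemma sorted_sorted_eigenvalues: "sorted (sorted_eigenvalues Q)"
  unfolding sorted_eigenvalues_def by (intro sorted_concat_replicate) simp

text \<open>An eigenvalue occurs in the list as a run whose length is the dimension of its eigenspace.\<close>

lemma eigenvalue_run:
  fixes Q :: "real^'a^'a"
  assumes "transpose Q = Q" "x \<noteq> 0" "Q *v x = l *\<^sub>R x"
  obtains p where "p + dim (eigenspace Q l) \<le> length (sorted_eigenvalues Q)"
    "\<And>i. i < dim (eigenspace Q l) \<Longrightarrow> sorted_eigenvalues Q ! (p + i) = l"
proof -
  have "l \<in> set (sorted_list_of_set {l. \<exists>x. x \<noteq> 0 \<and> Q *v x = l *\<^sub>R x})"
    using assms finite_eigenvalues[OF assms(1)] by auto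
  then obtain as bs where "sorted_list_of_set {l. \<exists>x. x \<noteq> 0 \<and> Q *v x = l *\<^sub>R x} = as @ l # bs"
    by (meson split_list)
  then obtain xs ys where "sorted_eigenvalues Q = xs @ replicate (dim (eigenspace Q l)) l @ ys"
    unfolding sorted_eigenvalues_def by simp
  then show ?thesis
    by (intro that[of "length xs"]) (auto simp: nth_append)
qed

lemma eigenspace_dim_pos:
  assumes "x \<noteq> 0" "Q *v x = l *\<^sub>R x"
  shows "dim (eigenspace Q l) > 0"
  using assms by (auto simp: eigenspace_def dim_eq_0 intro!: Nat.gr0I)

lemma eigenvalue_le_largest:
  fixes Q :: "real^'a^'a"
  assumes "transpose Q = Q" "x \<noteq> 0" "Q *v x = l *\<^sub>R x"
  shows "l \<le> ordered_eigenvalue CARD('a) Q"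
proof -
  obtain p where p: "p + dim (eigenspace Q l) \<le> length (sorted_eigenvalues Q)"
    "\<And>i. i < dim (eigenspace Q l) \<Longrightarrow> sorted_eigenvalues Q ! (p + i) = l"
    using eigenvalue_run[OF assms] by blast
  have len: "length (sorted_eigenvalues Q) = CARD('a)"
    using assms(1) by (rule length_sorted_eigenvalues)
  have "sorted_eigenvalues Q ! (p + 0) \<le> sorted_eigenvalues Q ! (CARD('a) - 1)"
    using p(1) eigenspace_dim_pos[OF assms(2,3)]
    by (intro sorted_nth_mono sorted_sorted_eigenvalues) (auto simp: len)
  then show ?thesis
    using p(2)[OF eigenspace_dim_pos[OF assms(2,3)]] by (simp add: ordered_eigenvalue_def)
qed

text \<open>If \<open>k\<close> already spans a part of the kernel of a positive semidefinite \<open>Q\<close>, an eigenvector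
  orthogonal to it cannot belong to the first entry of the list: either its eigenvalue is positive, so
  that it comes after the entry of \<open>k\<close>, or the eigenvalue \<open>0\<close> occurs twice.\<close>

lemma second_eigenvalue_le:
  fixes Q :: "real^'a^'a"
  assumes sym: "transpose Q = Q" and psd: "\<And>x. x \<bullet> (Q *v x) \<ge> 0"
    and k: "Q *v k = 0" "k \<noteq> 0"
    and u: "u \<noteq> 0" "k \<bullet> u = 0" "Q *v u = l *\<^sub>R u"
  shows "ordered_eigenvalue 2 Q \<le> l"
proof -
  let ?xs = "sorted_eigenvalues Q"
  obtain p where p: "p + dim (eigenspace Q l) \<le> length ?xs"
    "\<And>i. i < dim (eigenspace Q l) \<Longrightarrow> ?xs ! (p + i) = l"
    using eigenvalue_run[OF sym u(1,3)] by blast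
  obtain q where q: "q + dim (eigenspace Q 0) \<le> length ?xs"
    "\<And>i. i < dim (eigenspace Q 0) \<Longrightarrow> ?xs ! (q + i) = 0"
    using eigenvalue_run[OF sym k(2), of 0] k(1) by auto
  have l: "l \<ge> 0"
    using psd[of u] u by (simp add: zero_le_mult_iff) (meson inner_gt_zero_iff linorder_not_le)
  have "\<exists>i. 1 \<le> i \<and> i < length ?xs \<and> ?xs ! i = l"
  proof (cases "l = 0")
    case True
    have "independent {k, u}"
      using k(2) u(1,2) by (intro pairwise_orthogonal_independent) (auto simp: pairwise_insert orthogonal_def inner_commute)
    moreover have "{k, u} \<subseteq> eigenspace Q l"
      using True k u by (auto simp: eigenspace_def)
    ultimately have "card {k, u} \<le> dim (eigenspace Q l)"
      using independent_card_le_dim by blast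
    moreover have "k \<noteq> u"
      using u by auto
    ultimately have "2 \<le> dim (eigenspace Q l)"
      by simp
    then show ?thesis
      using p(1) p(2)[of 1] by (intro exI[of _ "p + 1"]) auto
  next
    case False
    have d: "0 < dim (eigenspace Q 0)" "0 < dim (eigenspace Q l)"
      using eigenspace_dim_pos[of k Q 0] k eigenspace_dim_pos[OF u(1,3)] by auto
    have "p \<noteq> 0"
    proof
      assume "p = 0"
      then have "?xs ! 0 = l" "?xs ! q = 0"
        using p(2)[OF d(2)] q(2)[OF d(1)] by auto
      then show False
        using sorted_nth_mono[OF sorted_sorted_eigenvalues, of 0 q Q] q(1) d l False by auto
    qed
    then show ?thesis
      using p(1) p(2)[OF d(2)] d by (intro exI[of _ p]) auto
  qed
  then obtain i where i: "1 \<le> i" "i < length ?xs" "?xs ! i = l" by blast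
  then show ?thesis
    using sorted_nth_mono[OF sorted_sorted_eigenvalues i(1,2)] by (simp add: ordered_eigenvalue_def)
qed

section \<open>Graph Laplacians\<close>

lemma ell_inner: "i \<noteq> j \<Longrightarrow> ell (i, j) \<bullet> x = x $ i - x $ j"
proof -
  assume "i \<noteq> j"
  then have "ell (i, j) \<bullet> x = (\<Sum>k\<in>UNIV. (if k = i then x $ k else 0) - (if k = j then x $ k else 0))"
    unfolding ell_def inner_vec_def by (intro sum.cong) auto
  then show ?thesis
    by (simp add: sum_subtractf)
qed

text \<open>The off-diagonal entries can be compared directly, because the orientation \<open>i > j\<close> lets each pair occur
  once; the diagonals then agree because both sides have vanishing row sums.\<close>

lemma laplacian_eq_sum_ell:
  fixes F :: "('v::{finite,linorder} \<times> 'v) set"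
  assumes F: "\<And>i j. (i, j) \<in> F \<Longrightarrow> i > j" and \<mu>: "\<And>i j. \<mu> i j = \<mu> j i"
  shows "laplacian F \<mu> = (\<Sum>e\<in>F. \<mu> (fst e) (snd e) *\<^sub>R (\<chi> a b. ell e $ a * ell e $ b))"
proof -
  let ?R = "\<lambda>a b. \<Sum>e\<in>F. \<mu> (fst e) (snd e) * (ell e $ a * ell e $ b)"
  let ?w = "\<lambda>i j. if (i, j) \<in> F \<or> (j, i) \<in> F then \<mu> i j else 0"
  have off: "?R a b = - ?w a b" if "a \<noteq> b" for a b
  proof -
    have "?R a b = (\<Sum>e\<in>F. (if e = (a, b) then - \<mu> a b else 0) + (if e = (b, a) then - \<mu> b a else 0))"
      using that F by (intro sum.cong) (auto simp: ell_def)
    also have "\<dots> = - ?w a b"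
      using F[of a b] F[of b a] \<mu>[of a b] by (auto simp: sum.distrib)
    finally show ?thesis .
  qed
  have row: "(\<Sum>b\<in>UNIV. ?R a b) = 0" for a
  proof -
    have "(\<Sum>b\<in>UNIV. ell e $ b) = 0" if "e \<in> F" for e
      using F[of "fst e" "snd e"] that ell_inner[of "fst e" "snd e" "1 :: real^('v::{finite,linorder})"]
      by (auto simp: inner_vec_def)
    then show ?thesis
      by (subst sum.swap) (simp add: sum_distrib_left[symmetric])
  qed
  have diag: "?R a a = (\<Sum>k\<in>UNIV - {a}. ?w a k)" for a
  proof -
    have "?R a a = - (\<Sum>k\<in>UNIV - {a}. ?R a k)"
      using row[of a] by (subst (asm) sum.remove[of _ a]) auto
    also have "\<dots> = (\<Sum>k\<in>UNIV - {a}. ?w a k)"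
      by (subst sum.cong[OF refl off]) (auto simp: sum_negf)
    finally show ?thesis .
  qed
  show ?thesis
    using off diag by (auto simp: laplacian_def Let_def vec_eq_iff)
qed

lemma rank_one_mult:
  fixes a :: "real^'a" and b :: "real^'b"
  shows "(\<chi> i j. a $ i * b $ j) *v x = (b \<bullet> x) *\<^sub>R a"
  by (simp add: vec_eq_iff matrix_vector_mult_def inner_vec_def sum_distrib_left mult_ac)

lemma matrix_vector_mult_sum_left: "(\<Sum>i\<in>I. Q i) *v x = (\<Sum>i\<in>I. Q i *v x)"
  for Q :: "'i \<Rightarrow> real^'b^'a"
  by (induction I rule: infinite_finite_induct) (auto simp: matrix_vector_mult_add_rdistrib)

locale weighted_graph =
  fixes F :: "('v::{finite,linorder} \<times> 'v) set" and \<mu> :: "'v \<Rightarrow> 'v \<Rightarrow> real"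
  assumes oriented: "\<And>i j. (i, j) \<in> F \<Longrightarrow> i > j"
    and weight_sym: "\<And>i j. \<mu> i j = \<mu> j i" and weight_pos: "\<And>i j. (i, j) \<in> F \<Longrightarrow> \<mu> i j > 0"
begin

lemma laplacian_mult:
  "laplacian F \<mu> *v x = (\<Sum>e\<in>F. (\<mu> (fst e) (snd e) * (ell e \<bullet> x)) *\<^sub>R ell e)"
  by (simp add: laplacian_eq_sum_ell[OF oriented weight_sym] matrix_vector_mult_sum_left
      scaleR_matrix_vector_assoc[symmetric] rank_one_mult)

lemma laplacian_form:
  "x \<bullet> (laplacian F \<mu> *v x) = (\<Sum>e\<in>F. \<mu> (fst e) (snd e) * (ell e \<bullet> x)\<^sup>2)"
  by (simp add: laplacian_mult inner_sum_right power2_eq_square inner_commute mult_ac)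

lemma laplacian_sym: "transpose (laplacian F \<mu>) = laplacian F \<mu>"
  by (auto simp: laplacian_def Let_def transpose_def vec_eq_iff weight_sym)

lemma edge_weight_pos: "e \<in> F \<Longrightarrow> \<mu> (fst e) (snd e) > 0"
  using weight_pos[of "fst e" "snd e"] by simp

lemma ell_inner_edge: "e \<in> F \<Longrightarrow> ell e \<bullet> x = x $ fst e - x $ snd e"
  using ell_inner[of "fst e" "snd e"] oriented[of "fst e" "snd e"] by auto

lemma ell_orthogonal_one: "e \<in> F \<Longrightarrow> 1 \<bullet> ell e = 0"
  by (simp add: inner_commute[of 1] ell_inner_edge)

lemma norm_ell: "e \<in> F \<Longrightarrow> ell e \<bullet> ell e = 2"
  using oriented[of "fst e" "snd e"] by (auto simp: ell_inner_edge) (auto simp: ell_def)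

lemma laplacian_nonneg: "x \<bullet> (laplacian F \<mu> *v x) \<ge> 0"
  unfolding laplacian_form using edge_weight_pos by (intro sum_nonneg) (simp add: less_imp_le)

lemma laplacian_one: "laplacian F \<mu> *v 1 = 0"
  unfolding laplacian_mult using ell_orthogonal_one by (intro sum.neutral) (simp add: inner_commute)

text \<open>The Laplacian is symmetric and kills the consensus direction \<open>1\<close>, hence leaves its orthogonal complement
  invariant and can be diagonalized there. This removes exactly one zero from the list of eigenvalues.\<close>

lemma disagreement_eigenbasis:
  obtains U where "finite U" "pairwise orthogonal U" "\<And>u. u \<in> U \<Longrightarrow> norm u = 1"
    "span U = {x. 1 \<bullet> x = 0}"
    "\<And>u. u \<in> U \<Longrightarrow> laplacian F \<mu> *v u = (u \<bullet> (laplacian F \<mu> *v u)) *\<^sub>R u"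
    "\<And>u. u \<in> U \<Longrightarrow> ordered_eigenvalue 2 (laplacian F \<mu>) \<le> u \<bullet> (laplacian F \<mu> *v u)"
    "\<And>u. u \<in> U \<Longrightarrow> u \<bullet> (laplacian F \<mu> *v u) \<le> ordered_eigenvalue CARD('v) (laplacian F \<mu>)"
proof -
  let ?L = "laplacian F \<mu>"
  have "1 \<bullet> (?L *v x) = 0" for x
    using symmetric_inner[OF laplacian_sym, of 1 x] by (simp add: laplacian_one)
  then obtain U where U: "finite U" "pairwise orthogonal U" "\<forall>u\<in>U. norm u = 1"
      "span U = {x. 1 \<bullet> x = 0}" "\<forall>u\<in>U. ?L *v u = (u \<bullet> (?L *v u)) *\<^sub>R u"
    using spectral_theorem_on_subspace[OF laplacian_sym subspace_hyperplane, of 1] by blast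
  have one: "(1 :: real^('v::{finite,linorder})) \<noteq> 0"
    by (simp add: vec_eq_iff)
  have u: "u \<noteq> 0" "1 \<bullet> u = 0" if "u \<in> U" for u
    using U(3,4) that span_base[of u U] by auto
  show ?thesis
    using U u second_eigenvalue_le[OF laplacian_sym laplacian_nonneg laplacian_one one]
      eigenvalue_le_largest[OF laplacian_sym]
    by (intro that[of U]) blast+
qed

lemma laplacian_form_bounds:
  assumes "1 \<bullet> x = 0"
  shows "ordered_eigenvalue 2 (laplacian F \<mu>) * (x \<bullet> x) \<le> x \<bullet> (laplacian F \<mu> *v x)"
    and "x \<bullet> (laplacian F \<mu> *v x) \<le> ordered_eigenvalue CARD('v) (laplacian F \<mu>) * (x \<bullet> x)"
proof -
  obtain U where U: "finite U" "pairwise orthogonal U" "\<And>u. u \<in> U \<Longrightarrow> norm u = 1"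
    "span U = {x. 1 \<bullet> x = 0}"
    "\<And>u. u \<in> U \<Longrightarrow> laplacian F \<mu> *v u = (u \<bullet> (laplacian F \<mu> *v u)) *\<^sub>R u"
    "\<And>u. u \<in> U \<Longrightarrow> ordered_eigenvalue 2 (laplacian F \<mu>) \<le> u \<bullet> (laplacian F \<mu> *v u)"
    "\<And>u. u \<in> U \<Longrightarrow> u \<bullet> (laplacian F \<mu> *v u) \<le> ordered_eigenvalue CARD('v) (laplacian F \<mu>)"
    using disagreement_eigenbasis by blast
  have x: "x \<in> span U"
    using assms U(4) by simp
  have xx: "x \<bullet> x = (\<Sum>u\<in>U. (u \<bullet> x)\<^sup>2)"
    using inner_orthonormal_expansion[OF U(1-3) x, of x] by (simp add: power2_eq_square)
  have xLx: "x \<bullet> (laplacian F \<mu> *v x) = (\<Sum>u\<in>U. (u \<bullet> (laplacian F \<mu> *v u)) * (u \<bullet> x)\<^sup>2)"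
    by (rule quadratic_form_eigenbasis[OF laplacian_sym U(1-3,5) x])
  show "ordered_eigenvalue 2 (laplacian F \<mu>) * (x \<bullet> x) \<le> x \<bullet> (laplacian F \<mu> *v x)"
    unfolding xx sum_distrib_left by (subst xLx) (intro sum_mono mult_right_mono U, auto)
  show "x \<bullet> (laplacian F \<mu> *v x) \<le> ordered_eigenvalue CARD('v) (laplacian F \<mu>) * (x \<bullet> x)"
    unfolding xx sum_distrib_left by (subst xLx) (intro sum_mono mult_right_mono U, auto)
qed

text \<open>Removing the mean changes neither side, so the expansion is valid off the disagreement space too.\<close>

lemma laplacian_form_eigenbasis:
  assumes U: "finite U" "pairwise orthogonal U" "\<And>u. u \<in> U \<Longrightarrow> norm u = 1" "span U = {x. 1 \<bullet> x = 0}"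
    and eig: "\<And>u. u \<in> U \<Longrightarrow> laplacian F \<mu> *v u = (u \<bullet> (laplacian F \<mu> *v u)) *\<^sub>R u"
  shows "x \<bullet> (laplacian F \<mu> *v x) = (\<Sum>u\<in>U. (u \<bullet> (laplacian F \<mu> *v u)) * (u \<bullet> x)\<^sup>2)"
proof -
  define y where "y = x - ((1 \<bullet> x) / real CARD('v)) *\<^sub>R 1"
  have y: "y \<in> span U"
    unfolding U(4) by (simp add: y_def inner_diff_right) (simp add: inner_vec_def)
  have "ell e \<bullet> y = ell e \<bullet> x" if "e \<in> F" for e
    using ell_orthogonal_one[OF that] by (simp add: y_def inner_diff_right inner_commute)
  then have "x \<bullet> (laplacian F \<mu> *v x) = y \<bullet> (laplacian F \<mu> *v y)"
    unfolding laplacian_form by (intro sum.cong) auto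
  also have "\<dots> = (\<Sum>u\<in>U. (u \<bullet> (laplacian F \<mu> *v u)) * (u \<bullet> y)\<^sup>2)"
    by (rule quadratic_form_eigenbasis[OF laplacian_sym U(1-3) eig y])
  also have "\<dots> = (\<Sum>u\<in>U. (u \<bullet> (laplacian F \<mu> *v u)) * (u \<bullet> x)\<^sup>2)"
  proof (rule sum.cong[OF refl])
    fix u assume "u \<in> U"
    then have "1 \<bullet> u = 0"
      using span_base[of u U] U(4) by auto
    then show "(u \<bullet> (laplacian F \<mu> *v u)) * (u \<bullet> y)\<^sup>2 = (u \<bullet> (laplacian F \<mu> *v u)) * (u \<bullet> x)\<^sup>2"
      by (simp add: y_def inner_diff_right inner_commute)
  qed
  finally show ?thesis .
qed

lemma ordered_eigenvalue_nonneg: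
  assumes "1 \<le> k" "k \<le> CARD('v)"
  shows "ordered_eigenvalue k (laplacian F \<mu>) \<ge> 0"
proof -
  let ?L = "laplacian F \<mu>"
  have "sorted_eigenvalues ?L ! (k - 1) \<in> set (sorted_eigenvalues ?L)"
    using assms by (intro nth_mem) (use length_sorted_eigenvalues[OF laplacian_sym] in linarith)
  also have "\<dots> \<subseteq> {l. \<exists>x. x \<noteq> 0 \<and> ?L *v x = l *\<^sub>R x}"
    using finite_eigenvalues[OF laplacian_sym] by (auto simp: sorted_eigenvalues_def)
  finally obtain x where "x \<noteq> 0" "?L *v x = ordered_eigenvalue k ?L *\<^sub>R x"
    by (auto simp: ordered_eigenvalue_def)
  then show ?thesis
    using laplacian_nonneg[of x] by (simp add: zero_le_mult_iff) (meson inner_gt_zero_iff linorder_not_le)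
qed

end

text \<open>Let \<open>L_u\<close> be the Laplacian of \<open>E\<^sub>U\<close> and \<open>L_d\<close> that of the other links.
  On the disagreement space \<open>L_u \<le> \<lambda>\<^sub>N(L_u)\<close> and \<open>\<lambda>\<^sub>2(L_d) \<le> L_d\<close>, so
  \<open>\<lambda>\<^sub>2(L_d) L_u \<le> \<lambda>\<^sub>N(L_u) L_d\<close>; adding \<open>\<lambda>\<^sub>N(L_u) L_u\<close> to both sides bounds
  \<open>L_u\<close> by \<open>\<tau>\<close> times the whole Laplacian.\<close>

lemma uncertain_laplacian_le:
  fixes E E\<^sub>U :: "('v::{finite,linorder} \<times> 'v) set"
  assumes E: "weighted_graph E \<mu>" and U: "E\<^sub>U \<subseteq> E" "E\<^sub>U \<noteq> {}"
  defines "a \<equiv> ordered_eigenvalue CARD('v) (laplacian E\<^sub>U \<mu>)"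
    and "b \<equiv> ordered_eigenvalue 2 (laplacian (E - E\<^sub>U) \<mu>)"
  shows "0 \<le> a / (a + b)"
    and "x \<bullet> (laplacian E\<^sub>U \<mu> *v x) \<le> a / (a + b) * (x \<bullet> (laplacian E \<mu> *v x))"
proof -
  interpret E: weighted_graph E \<mu> by (rule E)
  interpret U: weighted_graph E\<^sub>U \<mu>
    using U E.oriented E.weight_sym E.weight_pos by unfold_locales auto
  interpret D: weighted_graph "E - E\<^sub>U" \<mu>
    using E.oriented E.weight_sym E.weight_pos by unfold_locales auto
  obtain e where e: "e \<in> E\<^sub>U" using U by auto
  have "fst e \<noteq> snd e"
    using E.oriented[of "fst e" "snd e"] e U by auto
  then have card2: "2 \<le> CARD('v)"
    using card_mono[of UNIV "{fst e, snd e}"] by auto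
  then have b: "b \<ge> 0"
    unfolding b_def by (intro D.ordered_eigenvalue_nonneg) auto
  have a: "a > 0"
  proof -
    have "0 < \<mu> (fst e) (snd e) * (ell e \<bullet> ell e)\<^sup>2"
      using U.edge_weight_pos[OF e] U.norm_ell[OF e] by simp
    also have "\<dots> \<le> ell e \<bullet> (laplacian E\<^sub>U \<mu> *v ell e)"
      unfolding U.laplacian_form using U.edge_weight_pos
      by (intro member_le_sum e) (auto simp: less_imp_le)
    also have "\<dots> \<le> a * (ell e \<bullet> ell e)"
      unfolding a_def by (rule U.laplacian_form_bounds(2)[OF U.ell_orthogonal_one[OF e]])
    finally show ?thesis
      by (simp add: U.norm_ell[OF e])
  qed
  show "0 \<le> a / (a + b)"
    using a b by simp
  define y where "y = x - ((1 \<bullet> x) / real CARD('v)) *\<^sub>R 1"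
  have y1: "1 \<bullet> y = 0"
    by (simp add: y_def inner_diff_right) (simp add: inner_vec_def)
  have ell_y: "ell e \<bullet> y = ell e \<bullet> x" if "e \<in> E" for e
    using E.ell_orthogonal_one[OF that] by (simp add: y_def inner_diff_right inner_commute)
  have split: "x \<bullet> (laplacian E \<mu> *v x) = x \<bullet> (laplacian (E - E\<^sub>U) \<mu> *v x) + x \<bullet> (laplacian E\<^sub>U \<mu> *v x)"
    unfolding E.laplacian_form D.laplacian_form U.laplacian_form
    using U(1) by (intro sum.subset_diff) auto
  have "b * (x \<bullet> (laplacian E\<^sub>U \<mu> *v x)) = b * (y \<bullet> (laplacian E\<^sub>U \<mu> *v y))"
    unfolding U.laplacian_form using U(1) ell_y by (auto intro!: sum.cong)
  also have "\<dots> \<le> b * (a * (y \<bullet> y))"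
    unfolding a_def by (intro mult_left_mono U.laplacian_form_bounds(2) y1 b)
  also have "\<dots> = a * (b * (y \<bullet> y))"
    by simp
  also have "\<dots> \<le> a * (y \<bullet> (laplacian (E - E\<^sub>U) \<mu> *v y))"
    unfolding b_def using a by (intro mult_left_mono D.laplacian_form_bounds(1) y1) simp
  also have "y \<bullet> (laplacian (E - E\<^sub>U) \<mu> *v y) = x \<bullet> (laplacian (E - E\<^sub>U) \<mu> *v x)"
    unfolding D.laplacian_form using ell_y by (auto intro!: sum.cong)
  finally show "x \<bullet> (laplacian E\<^sub>U \<mu> *v x) \<le> a / (a + b) * (x \<bullet> (laplacian E \<mu> *v x))"
    unfolding split using a b by (simp add: field_simps)
qed

section \<open>Network modes\<close>

text \<open>For an eigenvector \<open>u\<close> of the Laplacian this is the modal coordinate of the node signal \<open>a\<close>; for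
  \<open>u = ell e\<close> it is the difference of \<open>a\<close> across the link \<open>e\<close>. Both occur in the dynamics.\<close>

definition mode :: "real^'v \<Rightarrow> ('v::finite \<Rightarrow> 'b) \<Rightarrow> 'b::real_vector" where
  "mode u a = (\<Sum>k\<in>UNIV. u $ k *\<^sub>R a k)"

lemma linear_mode: "linear f \<Longrightarrow> f (mode u a) = mode u (\<lambda>k. f (a k))"
  unfolding mode_def by (simp add: linear_sum linear_scale)

lemma mode_add: "mode u (\<lambda>k. a k + b k) = mode u a + mode u b"
  by (simp add: mode_def scaleR_add_right sum.distrib)

lemma mode_diff: "mode u (\<lambda>k. a k - b k) = mode u a - mode u b"
  by (simp add: mode_def scaleR_diff_right sum_subtractf)

lemma mode_sum: "mode u (\<lambda>k. \<Sum>e\<in>I. a e k) = (\<Sum>e\<in>I. mode u (a e))"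
  by (simp add: mode_def scaleR_sum_right) (rule sum.swap)

lemma mode_const: "mode u (\<lambda>k. w $ k *\<^sub>R z) = (w \<bullet> u) *\<^sub>R z"
  by (simp add: mode_def inner_vec_def scaleR_sum_left mult.commute)

lemma mode_scaleR_left: "mode (c *\<^sub>R u) a = c *\<^sub>R mode u a"
  by (simp add: mode_def scaleR_sum_right)

lemma inner_mode: "w \<bullet> mode u a = u \<bullet> (\<chi> k. w \<bullet> a k)"
  by (simp add: mode_def inner_sum_right inner_vec_def)

lemma mode_matrix: "mode u (\<lambda>k. \<Sum>j\<in>UNIV. Q $ k $ j *\<^sub>R a j) = mode (transpose Q *v u) a"
proof -
  have "mode u (\<lambda>k. \<Sum>j\<in>UNIV. Q $ k $ j *\<^sub>R a j) = (\<Sum>k\<in>UNIV. \<Sum>j\<in>UNIV. (Q $ k $ j * u $ k) *\<^sub>R a j)"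
    by (simp add: mode_def scaleR_sum_right mult.commute)
  also have "\<dots> = mode (transpose Q *v u) a"
    by (subst sum.swap) (simp add: mode_def matrix_vector_mult_def transpose_def scaleR_sum_left)
  finally show ?thesis .
qed

lemma disagreement_basis_completeness:
  fixes U :: "(real^'v) set"
  assumes U: "finite U" "pairwise orthogonal U" "\<And>u. u \<in> U \<Longrightarrow> norm u = 1" "span U = {x. 1 \<bullet> x = 0}"
  shows "(\<Sum>u\<in>U. u $ k * u $ j) = (if k = j then 1 else 0) - 1 / real CARD('v)"
proof -
  define x where "x = axis k 1 - (1 / real CARD('v)) *\<^sub>R (1 :: real^'v)"
  have one: "u \<bullet> 1 = 0" if "u \<in> U" for u
    using span_base[OF that] U(4) by (simp add: inner_commute)
  have one1: "(1 :: real^'v) \<bullet> 1 = real CARD('v)"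
    by (simp add: inner_vec_def)
  have "x \<in> span U"
    by (simp add: U(4) x_def inner_diff_right one1 inner_axis)
  then have "x \<bullet> axis j 1 = (\<Sum>u\<in>U. (u \<bullet> x) * (u \<bullet> axis j 1))"
    using inner_orthonormal_expansion[OF U(1,2)] U(3) by blast
  also have "\<dots> = (\<Sum>u\<in>U. u $ k * u $ j)"
    by (intro sum.cong refl) (simp add: x_def inner_diff_right one inner_axis)
  finally show ?thesis
    by (simp add: x_def inner_diff_left inner_axis) (auto simp: axis_def split: if_splits)
qed

text \<open>Parseval for the disagreement space: because \<open>U\<close> resolves the orthogonal projection off the
  consensus direction, summing over the modes is the same as averaging over all pairs of subsystems. This is
  what transports the incremental sector condition, which is a statement about pairs, to the modes.\<close>

lemma mode_parseval:
  fixes U :: "(real^'v) set" and f :: "'b::real_vector \<Rightarrow> 'c::real_vector \<Rightarrow> real"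
    and a :: "'v \<Rightarrow> 'b" and b :: "'v \<Rightarrow> 'c"
  assumes U: "finite U" "pairwise orthogonal U" "\<And>u. u \<in> U \<Longrightarrow> norm u = 1" "span U = {x. 1 \<bullet> x = 0}"
    and f: "bilinear f"
  shows "(\<Sum>u\<in>U. f (mode u a) (mode u b))
    = (\<Sum>k\<in>UNIV. \<Sum>j\<in>UNIV. f (a k - a j) (b k - b j)) / (2 * real CARD('v))"
proof -
  let ?N = "real CARD('v)"
  have "(\<Sum>u\<in>U. f (mode u a) (mode u b)) = (\<Sum>u\<in>U. \<Sum>k\<in>UNIV. \<Sum>j\<in>UNIV. (u $ k * u $ j) * f (a k) (b j))"
    unfolding mode_def bilinear_sum[OF f] sum.cartesian_product[symmetric]
    by (simp add: bilinear_lmul[OF f] bilinear_rmul[OF f] mult_ac)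
  also have "\<dots> = (\<Sum>k\<in>UNIV. \<Sum>u\<in>U. \<Sum>j\<in>UNIV. (u $ k * u $ j) * f (a k) (b j))"
    by (rule sum.swap)
  also have "\<dots> = (\<Sum>k\<in>UNIV. \<Sum>j\<in>UNIV. (\<Sum>u\<in>U. u $ k * u $ j) * f (a k) (b j))"
    by (intro sum.cong refl) (subst sum.swap, simp add: sum_distrib_right)
  also have "\<dots> = (\<Sum>k\<in>UNIV. f (a k) (b k)) - (\<Sum>k\<in>UNIV. \<Sum>j\<in>UNIV. f (a k) (b j)) / ?N"
    by (simp add: disagreement_basis_completeness[OF U] left_diff_distrib sum_subtractf sum_divide_distrib
        if_distrib[of "\<lambda>c. c * _"] cong: if_cong)
  finally have 1: "(\<Sum>u\<in>U. f (mode u a) (mode u b)) = \<dots>" .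
  have "(\<Sum>k\<in>UNIV. \<Sum>j\<in>UNIV. f (a k - a j) (b k - b j))
      = (\<Sum>k\<in>UNIV. \<Sum>j\<in>(UNIV :: 'v set). f (a k) (b k)) - (\<Sum>k\<in>UNIV. \<Sum>j\<in>UNIV. f (a k) (b j))
        - ((\<Sum>k\<in>UNIV. \<Sum>j\<in>UNIV. f (a j) (b k)) - (\<Sum>k\<in>(UNIV :: 'v set). \<Sum>j\<in>UNIV. f (a j) (b j)))"
    by (simp add: bilinear_lsub[OF f] bilinear_rsub[OF f] sum_subtractf)
  also have "(\<Sum>k\<in>UNIV. \<Sum>j\<in>UNIV. f (a j) (b k)) = (\<Sum>k\<in>UNIV. \<Sum>j\<in>UNIV. f (a k) (b j))"
    by (rule sum.swap)
  finally have "(\<Sum>k\<in>UNIV. \<Sum>j\<in>UNIV. f (a k - a j) (b k - b j))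
      = 2 * ?N * (\<Sum>k\<in>UNIV. f (a k) (b k)) - 2 * (\<Sum>k\<in>UNIV. \<Sum>j\<in>UNIV. f (a k) (b j))"
    by (simp add: sum_distrib_left algebra_simps)
  then show ?thesis
    unfolding 1 by (simp add: diff_divide_distrib)
qed

lemma bilinear_matrix_form: "bilinear (\<lambda>x y. x \<bullet> (Q *v y))"
  for Q :: "real^'b^'a"
  unfolding bilinear_def
  by (auto intro!: linearI simp: inner_add_left inner_add_right matrix_vector_right_distrib matrix_vector_mult_scaleR)

text \<open>Diagonalizing the positive semidefinite form reduces an inequality between Laplacians acting on
  vector-valued node signals to the scalar one.\<close>

lemma quadratic_form_mode_le:
  fixes P :: "real^'n^'n" and z :: "'v::finite \<Rightarrow> real^'n" and f :: "'i \<Rightarrow> real^'v" and g :: "'j \<Rightarrow> real^'v"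
  assumes sym: "transpose P = P" and psd: "\<And>x. x \<bullet> (P *v x) \<ge> 0"
    and le: "\<And>x. (\<Sum>i\<in>I. c i * (f i \<bullet> x)\<^sup>2) \<le> (\<Sum>j\<in>J. d j * (g j \<bullet> x)\<^sup>2)"
  shows "(\<Sum>i\<in>I. c i * (mode (f i) z \<bullet> (P *v mode (f i) z)))
    \<le> (\<Sum>j\<in>J. d j * (mode (g j) z \<bullet> (P *v mode (g j) z)))"
proof -
  obtain W where W: "finite W" "pairwise orthogonal W" "\<And>w. w \<in> W \<Longrightarrow> norm w = 1" "span W = UNIV"
    and eig: "\<And>w. w \<in> W \<Longrightarrow> P *v w = (w \<bullet> (P *v w)) *\<^sub>R w"
    using spectral_theorem_on_subspace[OF sym subspace_UNIV] by auto
  have single: "mode u z \<bullet> (P *v mode u z) = (\<Sum>w\<in>W. (w \<bullet> (P *v w)) * (u \<bullet> (\<chi> k. w \<bullet> z k))\<^sup>2)" for u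
    unfolding inner_mode[symmetric] using W(4)
    by (intro quadratic_form_eigenbasis[OF sym W(1-3) eig]) auto
  have form: "(\<Sum>i\<in>I. c i * (mode (f i) z \<bullet> (P *v mode (f i) z)))
      = (\<Sum>w\<in>W. (w \<bullet> (P *v w)) * (\<Sum>i\<in>I. c i * (f i \<bullet> (\<chi> k. w \<bullet> z k))\<^sup>2))"
    for I :: "'k set" and c and f :: "'k \<Rightarrow> real^'v"
  proof -
    have "(\<Sum>i\<in>I. c i * (mode (f i) z \<bullet> (P *v mode (f i) z)))
        = (\<Sum>i\<in>I. \<Sum>w\<in>W. (w \<bullet> (P *v w)) * (c i * (f i \<bullet> (\<chi> k. w \<bullet> z k))\<^sup>2))"
      unfolding single by (simp add: sum_distrib_left mult_ac)
    then show ?thesis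
      by (subst (asm) sum.swap) (simp add: sum_distrib_left)
  qed
  show ?thesis
    unfolding form by (intro sum_mono mult_left_mono le psd)
qed

section \<open>Contraction of a single mode\<close>

lemma pos_def_matrix_inv:
  fixes S :: "real^'a^'a"
  assumes "pos_def S"
  shows "S *v (matrix_inv S *v x) = x"
    and "0 \<le> x \<bullet> (matrix_inv S *v x)"
proof -
  have "x = 0" if "S *v x = 0" for x
    using assms that unfolding pos_def_def by (metis inner_zero_right less_irrefl)
  then have "invertible S"
    by (simp add: invertible_left_inverse matrix_left_invertible_ker)
  then have "S ** matrix_inv S = mat 1"
    using someI_ex[of "\<lambda>T. S ** T = mat 1 \<and> T ** S = mat 1"] by (simp add: invertible_def matrix_inv_def)
  then show inv: "S *v (matrix_inv S *v x) = x" for x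
    by (simp add: matrix_vector_mul_assoc)
  have "x \<bullet> (matrix_inv S *v x) = (matrix_inv S *v x) \<bullet> (S *v (matrix_inv S *v x))"
    by (simp only: inv inner_commute)
  also have "\<dots> \<ge> 0"
    using assms unfolding pos_def_def by (cases "matrix_inv S *v x = 0") (auto simp: less_imp_le)
  finally show "0 \<le> x \<bullet> (matrix_inv S *v x)" .
qed

lemma inner_transpose: "x \<bullet> (transpose X *v z) = (X *v x) \<bullet> z"
  for X :: "real^'a^'b"
  by (simp add: dot_lmul_matrix[symmetric] transpose_matrix_vector inner_commute)

text \<open>The left-hand side is maximal at \<open>p = - S\<^sup>-\<^sup>1 g\<close>.\<close>

lemma completing_the_square:
  fixes S :: "real^'a^'a"
  assumes "pos_def S"
  shows "- 2 * (p \<bullet> g) - p \<bullet> (S *v p) \<le> g \<bullet> (matrix_inv S *v g)"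
proof -
  let ?h = "matrix_inv S *v g"
  have S: "transpose S = S"
    using assms by (simp add: pos_def_def)
  have "0 \<le> (p + ?h) \<bullet> (S *v (p + ?h))"
    using assms unfolding pos_def_def by (cases "p + ?h = 0") (auto simp: less_imp_le)
  also have "\<dots> = p \<bullet> (S *v p) + 2 * (p \<bullet> g) + g \<bullet> ?h"
    using symmetric_inner[OF S, of ?h p]
    by (simp add: matrix_vector_right_distrib inner_add_left inner_add_right pos_def_matrix_inv(1)[OF assms] inner_commute)
  finally show ?thesis by simp
qed

lemma quadratic_form_convex:
  fixes K :: "real^'a^'a"
  assumes psd: "\<And>x. x \<bullet> (K *v x) \<ge> 0" and \<theta>: "0 \<le> \<theta>" "\<theta> \<le> 1"
  shows "((1 - \<theta>) *\<^sub>R x + \<theta> *\<^sub>R y) \<bullet> (K *v ((1 - \<theta>) *\<^sub>R x + \<theta> *\<^sub>R y))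
    \<le> (1 - \<theta>) * (x \<bullet> (K *v x)) + \<theta> * (y \<bullet> (K *v y))"
proof -
  have "0 \<le> \<theta> * (1 - \<theta>) * ((x - y) \<bullet> (K *v (x - y)))"
    using psd \<theta> by simp
  then show ?thesis
    by (simp add: matrix_vector_right_distrib matrix_vector_mult_diff_distrib matrix_vector_mult_scaleR
        inner_add_left inner_add_right inner_diff_left inner_diff_right algebra_simps)
qed

text \<open>Shifting the nonlinearity's output by \<open>\<Sigma>\<^sub>1\<^sup>-\<^sup>1 C x\<close> absorbs the sector
  multiplier into the drift (this is where \<open>A\<^sub>0\<close> comes from); maximizing over the remaining input by
  completing the square then gives the right-hand side of the Riccati equation. The bound is a convex
  function of \<open>lam\<close>, which is why the equation is needed at the two extreme eigenvalues only.\<close>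

lemma riccati_mode_contraction:
  fixes A :: "real^'n^'n" and B :: "real^'m^'n" and C :: "real^'n^'m" and G :: "real^'m^'n"
    and \<Sigma>\<^sub>1 :: "real^'m^'m" and P :: "real^'n^'n"
  assumes \<Sigma>\<^sub>1: "pos_def \<Sigma>\<^sub>1" and P: "pos_def P" and S: "pos_def (\<Sigma>\<^sub>1 - transpose B ** P ** B)"
    and c: "c \<ge> 0" and lo: "0 \<le> lo"
  defines "A\<^sub>0 \<equiv> A - B ** matrix_inv \<Sigma>\<^sub>1 ** C"
  assumes riccati: "\<forall>lam\<in>{lo, hi}. \<exists>R. pos_def R \<and>
             P = transpose (A\<^sub>0 - lam *\<^sub>R (G ** C)) ** P ** (A\<^sub>0 - lam *\<^sub>R (G ** C))
               + transpose (A\<^sub>0 - lam *\<^sub>R (G ** C)) ** P ** B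
                   ** matrix_inv (\<Sigma>\<^sub>1 - transpose B ** P ** B)
                   ** transpose B ** P ** (A\<^sub>0 - lam *\<^sub>R (G ** C))
               + (c * lam) *\<^sub>R
                   (transpose C ** transpose G ** P ** G ** C
                    + transpose C ** transpose G ** P ** B
                        ** matrix_inv (\<Sigma>\<^sub>1 - transpose B ** P ** B)
                        ** transpose B ** P ** G ** C)
               + transpose C ** matrix_inv \<Sigma>\<^sub>1 ** C + R"
  obtains \<rho> where "0 < \<rho>" "\<rho> < 1"
    "\<And>lam x p. lo \<le> lam \<Longrightarrow> lam \<le> hi \<Longrightarrow>
      (let x' = A *v x - lam *\<^sub>R (G *v (C *v x)) - B *v p; z = G *v (C *v x) in
        x' \<bullet> (P *v x') + c * lam * (z \<bullet> (P *v z)) + (2 * (p \<bullet> (C *v x)) - p \<bullet> (\<Sigma>\<^sub>1 *v p))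
          \<le> \<rho> * (x \<bullet> (P *v x)))"
proof -
  define S' where "S' = \<Sigma>\<^sub>1 - transpose B ** P ** B"
  define K where "K = P + P ** B ** matrix_inv S' ** transpose B ** P"
  define w where "w lam x = (A\<^sub>0 - lam *\<^sub>R (G ** C)) *v x" for lam x
  have Psym: "transpose P = P"
    using P by (simp add: pos_def_def)
  have P0: "x \<bullet> (P *v x) \<ge> 0" for x
    using P unfolding pos_def_def by (cases "x = 0") (auto simp: less_imp_le)
  have S'_pd: "pos_def S'"
    using S by (simp add: S'_def)
  have K_form: "x \<bullet> (K *v x) = x \<bullet> (P *v x)
      + (transpose B *v (P *v x)) \<bullet> (matrix_inv S' *v (transpose B *v (P *v x)))" for x
  proof -
    have "x \<bullet> (P *v (B *v z)) = (transpose B *v (P *v x)) \<bullet> z" for z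
      using symmetric_inner[OF Psym, of x "B *v z"] inner_transpose[of z B "P *v x"]
      by (simp add: inner_commute)
    then show ?thesis
      unfolding K_def
      by (simp add: matrix_vector_mult_add_rdistrib matrix_vector_mul_assoc[symmetric] inner_add_right)
  qed
  have K_P: "x \<bullet> (P *v x) \<le> x \<bullet> (K *v x)" for x
    unfolding K_form using pos_def_matrix_inv(2)[OF S'_pd] by simp
  have K0: "x \<bullet> (K *v x) \<ge> 0" for x
    using K_P[of x] P0[of x] by linarith
  have ric: "\<exists>R. pos_def R \<and> (\<forall>x. x \<bullet> (P *v x) = w lam x \<bullet> (K *v w lam x)
      + c * lam * ((G *v (C *v x)) \<bullet> (K *v (G *v (C *v x))))
      + (C *v x) \<bullet> (matrix_inv \<Sigma>\<^sub>1 *v (C *v x)) + x \<bullet> (R *v x))" if lam: "lam \<in> {lo, hi}" for lam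
  proof -
    obtain R where R: "pos_def R" and eq:
      "P = transpose (A\<^sub>0 - lam *\<^sub>R (G ** C)) ** P ** (A\<^sub>0 - lam *\<^sub>R (G ** C))
               + transpose (A\<^sub>0 - lam *\<^sub>R (G ** C)) ** P ** B
                   ** matrix_inv S'
                   ** transpose B ** P ** (A\<^sub>0 - lam *\<^sub>R (G ** C))
               + (c * lam) *\<^sub>R
                   (transpose C ** transpose G ** P ** G ** C
                    + transpose C ** transpose G ** P ** B
                        ** matrix_inv S'
                        ** transpose B ** P ** G ** C)
               + transpose C ** matrix_inv \<Sigma>\<^sub>1 ** C + R"
      using bspec[OF riccati lam, folded S'_def] by (elim exE conjE) (rule that)
    define Z where "Z = A\<^sub>0 - lam *\<^sub>R (G ** C)"
    have "x \<bullet> (P *v x) = w lam x \<bullet> (K *v w lam x)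
      + c * lam * ((G *v (C *v x)) \<bullet> (K *v (G *v (C *v x))))
      + (C *v x) \<bullet> (matrix_inv \<Sigma>\<^sub>1 *v (C *v x)) + x \<bullet> (R *v x)" for x
      unfolding w_def K_def Z_def[symmetric]
      by (subst eq[folded Z_def]) (simp add: matrix_vector_mult_add_rdistrib matrix_vector_mul_assoc[symmetric]
          scaleR_matrix_vector_assoc[symmetric] inner_add_right inner_transpose[unfolded transpose_matrix_vector])
    then show ?thesis
      using R by blast
  qed
  obtain R\<^sub>l where R\<^sub>l: "pos_def R\<^sub>l" "\<And>x. x \<bullet> (P *v x) = w lo x \<bullet> (K *v w lo x)
      + c * lo * ((G *v (C *v x)) \<bullet> (K *v (G *v (C *v x))))
      + (C *v x) \<bullet> (matrix_inv \<Sigma>\<^sub>1 *v (C *v x)) + x \<bullet> (R\<^sub>l *v x)"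
    using ric[OF insertI1] by (elim exE conjE) (rule that, assumption, erule spec)
  obtain R\<^sub>h where R\<^sub>h: "pos_def R\<^sub>h" "\<And>x. x \<bullet> (P *v x) = w hi x \<bullet> (K *v w hi x)
      + c * hi * ((G *v (C *v x)) \<bullet> (K *v (G *v (C *v x))))
      + (C *v x) \<bullet> (matrix_inv \<Sigma>\<^sub>1 *v (C *v x)) + x \<bullet> (R\<^sub>h *v x)"
    using ric[OF insertI2[OF singletonI]] by (elim exE conjE) (rule that, assumption, erule spec)
  obtain r\<^sub>l where r\<^sub>l: "r\<^sub>l > 0" "\<And>x. r\<^sub>l * (norm x)\<^sup>2 \<le> x \<bullet> (R\<^sub>l *v x)"
    using pos_def_ge[OF R\<^sub>l(1)] by blast
  obtain r\<^sub>h where r\<^sub>h: "r\<^sub>h > 0" "\<And>x. r\<^sub>h * (norm x)\<^sup>2 \<le> x \<bullet> (R\<^sub>h *v x)"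
    using pos_def_ge[OF R\<^sub>h(1)] by blast
  obtain k where k: "k > 0" "\<And>x. x \<bullet> (P *v x) \<le> k * (norm x)\<^sup>2"
    using quadratic_form_le[of P] by blast
  define \<epsilon> where "\<epsilon> = min r\<^sub>l r\<^sub>h / k"
  have \<epsilon>: "\<epsilon> > 0"
    using r\<^sub>l r\<^sub>h k by (simp add: \<epsilon>_def)
  have margin: "\<epsilon> * (x \<bullet> (P *v x)) \<le> min r\<^sub>l r\<^sub>h * (norm x)\<^sup>2" for x
    using mult_left_mono[OF k(2)[of x], of "min r\<^sub>l r\<^sub>h / k"] r\<^sub>l r\<^sub>h k(1) by (simp add: \<epsilon>_def)
  have Rl: "\<epsilon> * (x \<bullet> (P *v x)) \<le> x \<bullet> (R\<^sub>l *v x)" for x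
    using margin[of x] r\<^sub>l(2)[of x] mult_right_mono[of "min r\<^sub>l r\<^sub>h" r\<^sub>l "(norm x)\<^sup>2"] by simp
  have Rh: "\<epsilon> * (x \<bullet> (P *v x)) \<le> x \<bullet> (R\<^sub>h *v x)" for x
    using margin[of x] r\<^sub>h(2)[of x] mult_right_mono[of "min r\<^sub>l r\<^sub>h" r\<^sub>h "(norm x)\<^sup>2"] by simp
  show thesis
  proof (rule that[of "max (1 / 2) (1 - \<epsilon>)"])
    show "0 < max (1 / 2) (1 - \<epsilon>)" "max (1 / 2) (1 - \<epsilon>) < 1"
      using \<epsilon> by auto
    fix lam x p
    assume lam: "lo \<le> lam" "lam \<le> hi"
    then have "lam \<in> closed_segment lo hi"
      by (simp add: closed_segment_eq_real_ivl)
    then obtain \<theta> where \<theta>: "0 \<le> \<theta>" "\<theta> \<le> 1" and lam_eq: "lam = (1 - \<theta>) * lo + \<theta> * hi"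
      by (auto simp: in_segment)
    define y where "y = C *v x"
    define z where "z = G *v y"
    define x' where "x' = A *v x - lam *\<^sub>R z - B *v p"
    define q where "q = p - matrix_inv \<Sigma>\<^sub>1 *v y"
    define g where "g = transpose B *v (P *v w lam x)"
    have p: "p = q + matrix_inv \<Sigma>\<^sub>1 *v y"
      by (simp add: q_def)
    have x': "x' = w lam x - B *v q"
      unfolding x'_def w_def A\<^sub>0_def q_def z_def y_def
      by (simp add: matrix_vector_mult_diff_rdistrib matrix_vector_mult_diff_distrib
          matrix_vector_mul_assoc[symmetric] scaleR_matrix_vector_assoc[symmetric])
    have \<Sigma>sym: "transpose \<Sigma>\<^sub>1 = \<Sigma>\<^sub>1"
      using \<Sigma>\<^sub>1 by (simp add: pos_def_def)
    have sector: "2 * (p \<bullet> y) - p \<bullet> (\<Sigma>\<^sub>1 *v p) = y \<bullet> (matrix_inv \<Sigma>\<^sub>1 *v y) - q \<bullet> (\<Sigma>\<^sub>1 *v q)"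
      using symmetric_inner[OF \<Sigma>sym, of "matrix_inv \<Sigma>\<^sub>1 *v y" q] pos_def_matrix_inv(1)[OF \<Sigma>\<^sub>1, of y]
      unfolding p by (simp add: matrix_vector_right_distrib inner_add_left inner_add_right inner_commute)
    have "x' \<bullet> (P *v x') = w lam x \<bullet> (P *v w lam x) - 2 * (q \<bullet> g) + (B *v q) \<bullet> (P *v (B *v q))"
      using symmetric_inner[OF Psym, of "w lam x" "B *v q"] unfolding x' g_def
      by (simp add: matrix_vector_mult_diff_distrib inner_diff_left inner_diff_right inner_transpose[unfolded transpose_matrix_vector] inner_commute)
    moreover have "q \<bullet> (S' *v q) = q \<bullet> (\<Sigma>\<^sub>1 *v q) - (B *v q) \<bullet> (P *v (B *v q))"
      unfolding S'_def by (simp add: matrix_vector_mult_diff_rdistrib matrix_vector_mul_assoc[symmetric]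
          inner_diff_right inner_transpose[unfolded transpose_matrix_vector])
    ultimately have "x' \<bullet> (P *v x') + (2 * (p \<bullet> y) - p \<bullet> (\<Sigma>\<^sub>1 *v p))
        = w lam x \<bullet> (P *v w lam x) + (- 2 * (q \<bullet> g) - q \<bullet> (S' *v q)) + y \<bullet> (matrix_inv \<Sigma>\<^sub>1 *v y)"
      using sector by simp
    also have "\<dots> \<le> w lam x \<bullet> (K *v w lam x) + y \<bullet> (matrix_inv \<Sigma>\<^sub>1 *v y)"
      using completing_the_square[OF S'_pd, of q g] unfolding K_form[of "w lam x"] g_def by simp
    also have "w lam x \<bullet> (K *v w lam x)
        \<le> (1 - \<theta>) * (w lo x \<bullet> (K *v w lo x)) + \<theta> * (w hi x \<bullet> (K *v w hi x))"
    proof -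
      have "w lam x = (1 - \<theta>) *\<^sub>R w lo x + \<theta> *\<^sub>R w hi x"
        unfolding w_def lam_eq
        by (simp add: matrix_vector_mult_diff_rdistrib scaleR_matrix_vector_assoc[symmetric] algebra_simps)
      then show ?thesis
        using quadratic_form_convex[OF K0 \<theta>] by simp
    qed
    finally have 1: "x' \<bullet> (P *v x') + (2 * (p \<bullet> y) - p \<bullet> (\<Sigma>\<^sub>1 *v p))
        \<le> (1 - \<theta>) * (w lo x \<bullet> (K *v w lo x)) + \<theta> * (w hi x \<bullet> (K *v w hi x)) + y \<bullet> (matrix_inv \<Sigma>\<^sub>1 *v y)"
      by simp
    have 2: "c * lam * (z \<bullet> (P *v z)) \<le> (1 - \<theta>) * (c * lo * (z \<bullet> (K *v z))) + \<theta> * (c * hi * (z \<bullet> (K *v z)))"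
    proof -
      have "c * lam * (z \<bullet> (P *v z)) \<le> c * lam * (z \<bullet> (K *v z))"
        using K_P c lo lam by (intro mult_left_mono) auto
      then show ?thesis
        unfolding lam_eq by (simp add: algebra_simps)
    qed
    have lo_le: "w lo x \<bullet> (K *v w lo x) + c * lo * (z \<bullet> (K *v z)) + y \<bullet> (matrix_inv \<Sigma>\<^sub>1 *v y)
        \<le> (1 - \<epsilon>) * (x \<bullet> (P *v x))" (is "?l \<le> ?r")
      using R\<^sub>l(2)[of x] Rl[of x] unfolding z_def y_def by (simp add: algebra_simps)
    have hi_le: "w hi x \<bullet> (K *v w hi x) + c * hi * (z \<bullet> (K *v z)) + y \<bullet> (matrix_inv \<Sigma>\<^sub>1 *v y)
        \<le> (1 - \<epsilon>) * (x \<bullet> (P *v x))" (is "?h \<le> _")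
      using R\<^sub>h(2)[of x] Rh[of x] unfolding z_def y_def by (simp add: algebra_simps)
    have "x' \<bullet> (P *v x') + c * lam * (z \<bullet> (P *v z)) + (2 * (p \<bullet> y) - p \<bullet> (\<Sigma>\<^sub>1 *v p))
        \<le> (1 - \<theta>) * ?l + \<theta> * ?h"
      using 1 2 by (simp add: algebra_simps)
    also have "\<dots> \<le> (1 - \<theta>) * ?r + \<theta> * ?r"
      using \<theta> by (intro add_mono mult_left_mono lo_le hi_le) auto
    also have "\<dots> = ?r"
      by (simp add: algebra_simps)
    also have "\<dots> \<le> max (1 / 2) (1 - \<epsilon>) * (x \<bullet> (P *v x))"
      using P0 by (intro mult_right_mono) auto
    finally show "let x' = A *v x - lam *\<^sub>R (G *v (C *v x)) - B *v p; z = G *v (C *v x) in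
        x' \<bullet> (P *v x') + c * lam * (z \<bullet> (P *v z)) + (2 * (p \<bullet> (C *v x)) - p \<bullet> (\<Sigma>\<^sub>1 *v p))
          \<le> max (1 / 2) (1 - \<epsilon>) * (x \<bullet> (P *v x))"
      unfolding Let_def x'_def z_def y_def .
  qed
qed

section \<open>Square-integrable random vectors\<close>

text \<open>Measurability is included so that the predicate passes through sums, Lipschitz maps and products with
  independent noise without side conditions.\<close>

definition square_integrable :: "'w measure \<Rightarrow> ('w \<Rightarrow> 'b::euclidean_space) \<Rightarrow> bool" where
  "square_integrable M f \<longleftrightarrow> f \<in> borel_measurable M \<and> integrable M (\<lambda>\<omega>. (norm (f \<omega>))\<^sup>2)"

context prob_space
begin

lemma square_integrable_dominated:
  assumes f: "square_integrable M f" and g: "g \<in> borel_measurable M"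
    and le: "\<And>\<omega>. (norm (g \<omega>))\<^sup>2 \<le> c + k * (norm (f \<omega>))\<^sup>2"
  shows "square_integrable M g"
  unfolding square_integrable_def
proof
  show "integrable M (\<lambda>\<omega>. (norm (g \<omega>))\<^sup>2)"
  proof (rule Bochner_Integration.integrable_bound)
    show "integrable M (\<lambda>\<omega>. c + k * (norm (f \<omega>))\<^sup>2)"
      using f by (simp add: square_integrable_def)
    show "AE \<omega> in M. norm ((norm (g \<omega>))\<^sup>2) \<le> norm (c + k * (norm (f \<omega>))\<^sup>2)"
      using le by (intro AE_I2) (smt (verit) real_norm_def zero_le_power2)
  qed (use g in measurable)
qed (rule g)

lemma square_integrable_const [intro]: "square_integrable M (\<lambda>_. c)"
  by (simp add: square_integrable_def)

lemma square_integrable_linear: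
  assumes T: "linear T" and f: "square_integrable M f"
  shows "square_integrable M (\<lambda>\<omega>. T (f \<omega>))"
proof (rule square_integrable_dominated[OF f, where c = 0 and k = "(onorm T)\<^sup>2"])
  have "T \<in> borel_measurable borel"
    using T by (intro borel_measurable_continuous_onI) (simp add: linear_continuous_on linear_linear)
  then show "(\<lambda>\<omega>. T (f \<omega>)) \<in> borel_measurable M"
    using f by (auto simp: square_integrable_def intro: measurable_compose)
  show "(norm (T (f \<omega>)))\<^sup>2 \<le> 0 + (onorm T)\<^sup>2 * (norm (f \<omega>))\<^sup>2" for \<omega>
    using power_mono[OF onorm[OF linear_conv_bounded_linear[THEN iffD1, OF T], of "f \<omega>"], of 2]
    by (simp add: power_mult_distrib)
qed

lemma square_integrable_add:
  assumes f: "square_integrable M f" and g: "square_integrable M g"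
  shows "square_integrable M (\<lambda>\<omega>. f \<omega> + g \<omega>)"
proof -
  have le: "(norm (f \<omega> + g \<omega>))\<^sup>2 \<le> 2 * (norm (f \<omega>))\<^sup>2 + 2 * (norm (g \<omega>))\<^sup>2" for \<omega>
    using zero_le_power2[of "norm (f \<omega> - g \<omega>)"] unfolding power2_norm_eq_inner
    by (simp add: inner_add_left inner_add_right inner_diff_left inner_diff_right inner_commute)
  have fg: "f \<in> borel_measurable M" "g \<in> borel_measurable M"
    using f g by (auto simp: square_integrable_def)
  show ?thesis
    unfolding square_integrable_def
  proof
    show "integrable M (\<lambda>\<omega>. (norm (f \<omega> + g \<omega>))\<^sup>2)"
    proof (rule Bochner_Integration.integrable_bound)
      show "integrable M (\<lambda>\<omega>. 2 * (norm (f \<omega>))\<^sup>2 + 2 * (norm (g \<omega>))\<^sup>2)"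
        using f g by (simp add: square_integrable_def)
      show "AE \<omega> in M. norm ((norm (f \<omega> + g \<omega>))\<^sup>2) \<le> norm (2 * (norm (f \<omega>))\<^sup>2 + 2 * (norm (g \<omega>))\<^sup>2)"
        using le by (intro AE_I2) simp
    qed (use fg in measurable)
  qed (use fg in measurable)
qed

lemma square_integrable_uminus: "square_integrable M f \<Longrightarrow> square_integrable M (\<lambda>\<omega>. - f \<omega>)"
  by (simp add: square_integrable_def)

lemma square_integrable_diff:
  "square_integrable M f \<Longrightarrow> square_integrable M g \<Longrightarrow> square_integrable M (\<lambda>\<omega>. f \<omega> - g \<omega>)"
  using square_integrable_add[of f "\<lambda>\<omega>. - g \<omega>"] square_integrable_uminus[of g] by simp

lemma square_integrable_sum:
  "(\<And>i. i \<in> I \<Longrightarrow> square_integrable M (f i)) \<Longrightarrow> square_integrable M (\<lambda>\<omega>. \<Sum>i\<in>I. f i \<omega>)"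
  by (induction I rule: infinite_finite_induct) (auto intro: square_integrable_add)

lemma square_integrable_lipschitz:
  fixes h :: "'b::euclidean_space \<Rightarrow> 'c::euclidean_space"
  assumes h: "K-lipschitz_on UNIV h" and f: "square_integrable M f"
  shows "square_integrable M (\<lambda>\<omega>. h (f \<omega>))"
proof -
  have "square_integrable M (\<lambda>\<omega>. h (f \<omega>) - h 0)"
  proof (rule square_integrable_dominated[OF f, where c = 0 and k = "K\<^sup>2"])
    have "h \<in> borel_measurable borel"
      using lipschitz_on_continuous_on[OF h] by (rule borel_measurable_continuous_onI)
    then show "(\<lambda>\<omega>. h (f \<omega>) - h 0) \<in> borel_measurable M"
      using f by (auto simp: square_integrable_def intro: measurable_compose)
    show "(norm (h (f \<omega>) - h 0))\<^sup>2 \<le> 0 + K\<^sup>2 * (norm (f \<omega>))\<^sup>2" for \<omega>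
      using power_mono[OF lipschitz_onD[OF h, of "f \<omega>" 0], of 2]
      by (simp add: dist_norm power_mult_distrib)
  qed
  from square_integrable_add[OF this square_integrable_const[of "h 0"]] show ?thesis by simp
qed

lemma integrable_form:
  fixes P :: "real^'n^'m"
  assumes f: "square_integrable M f" and g: "square_integrable M g"
  shows "integrable M (\<lambda>\<omega>. f \<omega> \<bullet> (P *v g \<omega>))"
proof -
  have Pg: "square_integrable M (\<lambda>\<omega>. P *v g \<omega>)"
    by (rule square_integrable_linear[OF matrix_vector_mul_linear g])
  have fg: "f \<in> borel_measurable M" "(\<lambda>\<omega>. P *v g \<omega>) \<in> borel_measurable M"
    using f Pg by (auto simp: square_integrable_def)
  show ?thesis
  proof (rule Bochner_Integration.integrable_bound)
    show "integrable M (\<lambda>\<omega>. (norm (f \<omega>))\<^sup>2 + (norm (P *v g \<omega>))\<^sup>2)"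
      using f Pg by (simp add: square_integrable_def)
    have "\<bar>f \<omega> \<bullet> (P *v g \<omega>)\<bar> \<le> (norm (f \<omega>))\<^sup>2 + (norm (P *v g \<omega>))\<^sup>2" for \<omega>
    proof -
      have "2 * (norm (f \<omega>) * norm (P *v g \<omega>)) \<le> (norm (f \<omega>))\<^sup>2 + (norm (P *v g \<omega>))\<^sup>2"
        using sum_squares_bound[of "norm (f \<omega>)" "norm (P *v g \<omega>)"] by simp
      moreover have "0 \<le> norm (f \<omega>) * norm (P *v g \<omega>)"
        by simp
      ultimately show ?thesis
        using Cauchy_Schwarz_ineq2[of "f \<omega>" "P *v g \<omega>"] by linarith
    qed
    then show "AE \<omega> in M. norm (f \<omega> \<bullet> (P *v g \<omega>)) \<le> norm ((norm (f \<omega>))\<^sup>2 + (norm (P *v g \<omega>))\<^sup>2)"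
      by (intro AE_I2) simp
  qed (use fg in measurable)
qed

section \<open>Independence of the current link noise\<close>

text \<open>The noise at time \<open>t\<close> is independent of everything that can influence the state at that time. The
  assumptions are two separate facts (independence within the link noise, and of the link noise
  from the additive noise as processes), which are joined on the intersection-stable system of
  rectangles \<open>b \<inter> c\<close> that generates the joint information.\<close>

lemma innovation_independence:
  fixes Y :: "'i \<Rightarrow> nat \<Rightarrow> 'a \<Rightarrow> real" and v :: "nat \<Rightarrow> 'a \<Rightarrow> 'b::topological_space"
  assumes Y: "indep_vars (\<lambda>_. borel) (\<lambda>(e, t). Y e t) (I \<times> UNIV)"
    and Yv: "indep_set
          (sets (vimage_algebra (space M) (\<lambda>\<omega>. \<lambda>(e, t)\<in>I \<times> UNIV. Y e t \<omega>) (Pi\<^sub>M (I \<times> UNIV) (\<lambda>_. borel))))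
          (sets (vimage_algebra (space M) (\<lambda>\<omega> t. v t \<omega>) (Pi\<^sub>M UNIV (\<lambda>_. borel))))"
  obtains N\<^sub>1 N\<^sub>2 where "space N\<^sub>1 = space M" "space N\<^sub>2 = space M" "indep_set (sets N\<^sub>1) (sets N\<^sub>2)"
    "\<And>e. e \<in> I \<Longrightarrow> Y e t \<in> borel_measurable N\<^sub>1"
    "\<And>e s. e \<in> I \<Longrightarrow> s \<noteq> t \<Longrightarrow> Y e s \<in> borel_measurable N\<^sub>2"
    "\<And>s. v s \<in> borel_measurable N\<^sub>2"
proof -
  define Ev where "Ev = (\<lambda>i. {Y (fst i) (snd i) -` A \<inter> space M | A. A \<in> sets borel})"
  define J where "J = (\<lambda>now. I \<times> (if now then {t} else UNIV - {t}))"
  define S where "S now = sigma_sets (space M) (\<Union>i\<in>J now. Ev i)" for now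
  define F where "F = vimage_algebra (space M) (\<lambda>\<omega>. \<lambda>(e, t)\<in>I \<times> UNIV. Y e t \<omega>) (Pi\<^sub>M (I \<times> UNIV) (\<lambda>_. borel))"
  define V where "V = vimage_algebra (space M) (\<lambda>\<omega> t. v t \<omega>) (Pi\<^sub>M UNIV (\<lambda>_. borel))"
  have FV: "indep_set (sets F) (sets V)"
    using Yv by (simp add: F_def V_def)
  have [simp]: "space F = space M" "space V = space M"
    by (simp_all add: F_def V_def)
  have Ev_Pow: "(\<Union>i\<in>J now. Ev i) \<subseteq> Pow (space M)" for now
    by (auto simp: Ev_def)
  interpret S: sigma_algebra "space M" "S now" for now
    unfolding S_def by (rule sigma_algebra_sigma_sets[OF Ev_Pow])
  have "indep_sets Ev (I \<times> UNIV)"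
    using Y by (simp add: indep_vars_def2 Ev_def case_prod_beta)
  then have "indep_sets Ev (\<Union>now\<in>UNIV. J now)"
    by (rule indep_sets_mono_index[rotated]) (auto simp: J_def)
  then have "indep_sets S UNIV"
    unfolding S_def
  proof (rule indep_sets_collect_sigma)
    show "disjoint_family_on J UNIV"
      by (auto simp: disjoint_family_on_def J_def split: if_splits)
    show "Int_stable (Ev i)" for i
    proof (rule Int_stableI)
      fix a b assume "a \<in> Ev i" "b \<in> Ev i"
      then obtain A B where "a = Y (fst i) (snd i) -` A \<inter> space M" "A \<in> sets borel"
          "b = Y (fst i) (snd i) -` B \<inter> space M" "B \<in> sets borel"
        by (auto simp: Ev_def case_prod_beta)
      then show "a \<inter> b \<in> Ev i"
        by (auto simp: Ev_def case_prod_beta intro!: exI[of _ "A \<inter> B"])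
    qed
  qed
  then have S12: "indep_set (S True) (S False)"
    unfolding indep_set_def by (rule indep_sets_mono_sets) (auto split: bool.split)
  have Y_F: "Y e s \<in> borel_measurable F" if "e \<in> I" for e s
  proof -
    have "(\<lambda>\<omega>. (\<lambda>(e, t)\<in>I \<times> UNIV. Y e t \<omega>) (e, s)) \<in> borel_measurable F"
      unfolding F_def using that
      by (intro measurable_compose[OF measurable_vimage_algebra1 measurable_component_singleton])
        (auto simp: space_PiM PiE_def extensional_def split: if_splits)
    then show ?thesis
      using that by simp
  qed
  have S_F: "S now \<subseteq> sets F" for now
  proof -
    have "(\<Union>i\<in>J now. Ev i) \<subseteq> sets F"
      using measurable_sets[OF Y_F] by (auto simp: Ev_def J_def)
    from sets.sigma_sets_subset[OF this] show ?thesis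
      by (simp add: S_def)
  qed
  define R where "R = {b \<inter> c | b c. b \<in> S False \<and> c \<in> sets V}"
  have R_sub: "R \<subseteq> events"
    using S_F[of False] indep_setD_ev1[OF FV] indep_setD_ev2[OF FV] by (auto simp: R_def)
  have indep_R: "indep_set (S True) R"
  proof (rule indep_setI)
    show "S True \<subseteq> events"
      using S_F indep_setD_ev1[OF FV] by blast
    fix a r assume a: "a \<in> S True" and "r \<in> R"
    then obtain b c where b: "b \<in> S False" and c: "c \<in> sets V" and r: "r = b \<inter> c"
      by (auto simp: R_def)
    have ab: "a \<inter> b \<in> sets F"
      using a b S_F by (intro sets.Int) auto
    have "prob (a \<inter> r) = prob ((a \<inter> b) \<inter> c)"
      by (simp add: r Int_assoc)
    also have "\<dots> = prob a * prob b * prob c"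
      using indep_setD[OF FV ab c] indep_setD[OF S12 a b] by simp
    also have "\<dots> = prob a * prob r"
      unfolding r using indep_setD[OF FV _ c, of b] b S_F[of False] by auto
    finally show "prob (a \<inter> r) = prob a * prob r" .
  qed (rule R_sub)
  have "Int_stable R"
  proof (rule Int_stableI)
    fix r r' assume "r \<in> R" "r' \<in> R"
    then obtain b c b' c' where "b \<in> S False" "c \<in> sets V" "r = b \<inter> c" "b' \<in> S False" "c' \<in> sets V" "r' = b' \<inter> c'"
      by (auto simp: R_def)
    then have "r \<inter> r' = (b \<inter> b') \<inter> (c \<inter> c')" "b \<inter> b' \<in> S False" "c \<inter> c' \<in> sets V"
      by auto
    then show "r \<inter> r' \<in> R"
      unfolding R_def by blast
  qed
  moreover have "Int_stable (S True)"
    by (rule Int_stableI) auto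
  ultimately have indep: "indep_set (sigma_sets (space M) (S True)) (sigma_sets (space M) R)"
    using indep_R by (intro indep_set_sigma_sets)
  define N\<^sub>1 where "N\<^sub>1 = sigma (space M) (S True)"
  define N\<^sub>2 where "N\<^sub>2 = sigma (space M) R"
  have R_Pow: "R \<subseteq> Pow (space M)"
    using R_sub sets.sets_into_space by auto
  have S_Pow: "S now \<subseteq> Pow (space M)" for now
    using S.space_closed .
  have N1: "space N\<^sub>1 = space M" "sets N\<^sub>1 = sigma_sets (space M) (S True)"
    by (simp_all only: N\<^sub>1_def space_measure_of[OF S_Pow] sets_measure_of[OF S_Pow])
  have N2: "space N\<^sub>2 = space M" "sets N\<^sub>2 = sigma_sets (space M) R"
    using R_Pow by (auto simp: N\<^sub>2_def)
  show thesis
  proof (rule that[of N\<^sub>1 N\<^sub>2])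
    show "indep_set (sets N\<^sub>1) (sets N\<^sub>2)"
      using indep by (simp only: N1 N2)
    show "Y e t \<in> borel_measurable N\<^sub>1" if "e \<in> I" for e
    proof (rule measurableI)
      fix A :: "real set" assume "A \<in> sets borel"
      then have "Y e t -` A \<inter> space M \<in> (\<Union>i\<in>J True. Ev i)"
        using that by (auto simp: J_def Ev_def)
      then show "Y e t -` A \<inter> space N\<^sub>1 \<in> sets N\<^sub>1"
        unfolding N1 S_def by (intro sigma_sets.Basic) 
    qed simp
    show "Y e s \<in> borel_measurable N\<^sub>2" if "e \<in> I" "s \<noteq> t" for e s
    proof (rule measurableI)
      fix A :: "real set" assume "A \<in> sets borel"
      then have "Y e s -` A \<inter> space M \<in> (\<Union>i\<in>J False. Ev i)"
        using that by (auto simp: J_def Ev_def)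
      then have "Y e s -` A \<inter> space M \<in> S False"
        unfolding S_def by (rule sigma_sets.Basic)
      moreover have "space M \<in> sets V"
        using sets.top[of V] by simp
      ultimately have "Y e s -` A \<inter> space M \<in> R"
        unfolding R_def by blast
      then show "Y e s -` A \<inter> space N\<^sub>2 \<in> sets N\<^sub>2"
        unfolding N2 by (rule sigma_sets.Basic)
    qed simp
    show "v s \<in> borel_measurable N\<^sub>2" for s
    proof (rule measurableI)
      fix A :: "'b set" assume A: "A \<in> sets borel"
      have "v s \<in> borel_measurable V"
        unfolding V_def
        using measurable_compose[OF measurable_vimage_algebra1 measurable_component_singleton[of s UNIV "\<lambda>_. borel"],
            of "\<lambda>\<omega> t. v t \<omega>" "space M"]
        by (auto simp: space_PiM)
      from measurable_sets[OF this A] have "v s -` A \<inter> space M \<in> sets V"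
        by simp
      moreover have "space M \<in> S False"
        by (rule S.top)
      moreover have "v s -` A \<inter> space M = space M \<inter> (v s -` A \<inter> space M)"
        by blast
      ultimately have "v s -` A \<inter> space M \<in> R"
        unfolding R_def by blast
      then show "v s -` A \<inter> space N\<^sub>2 \<in> sets N\<^sub>2"
        unfolding N2 by (rule sigma_sets.Basic)
    qed simp
  qed (simp_all add: N1 N2)
qed

lemma
  fixes f g :: "'a \<Rightarrow> real"
  assumes N: "space N\<^sub>1 = space M" "space N\<^sub>2 = space M" "indep_set (sets N\<^sub>1) (sets N\<^sub>2)"
    and f: "f \<in> borel_measurable N\<^sub>1" "integrable M f" and g: "g \<in> borel_measurable N\<^sub>2" "integrable M g"
  shows indep_set_integrable_mult: "integrable M (\<lambda>\<omega>. f \<omega> * g \<omega>)"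
    and indep_set_integral_mult: "(\<integral>\<omega>. f \<omega> * g \<omega> \<partial>M) = (\<integral>\<omega>. f \<omega> \<partial>M) * (\<integral>\<omega>. g \<omega> \<partial>M)"
proof -
  have sub: "sigma_sets (space M) {h -` A \<inter> space M | A. A \<in> sets borel} \<subseteq> sets N"
    if "h \<in> borel_measurable N" "space N = space M" for h :: "'a \<Rightarrow> real" and N
    using measurable_sets[OF that(1)] that(2)
    by (subst that(2)[symmetric], intro sets.sigma_sets_subset) auto
  have "indep_set (sigma_sets (space M) {f -` A \<inter> space M | A. A \<in> sets borel})
      (sigma_sets (space M) {g -` A \<inter> space M | A. A \<in> sets borel})"
    using N(3) sub[OF f(1) N(1)] sub[OF g(1) N(2)]
    unfolding indep_sets2_eq by blast
  then have "indep_var borel f borel g"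
    using f(2) g(2) by (simp add: indep_var_eq)
  then show "integrable M (\<lambda>\<omega>. f \<omega> * g \<omega>)"
    "(\<integral>\<omega>. f \<omega> * g \<omega> \<partial>M) = (\<integral>\<omega>. f \<omega> \<partial>M) * (\<integral>\<omega>. g \<omega> \<partial>M)"
    using f(2) g(2) by (rule indep_var_integrable, rule indep_var_lebesgue_integral)
qed

lemma square_integrable_noise_mult:
  fixes Z :: "'a \<Rightarrow> real" and b :: "'a \<Rightarrow> 'b::euclidean_space"
  assumes N: "space N\<^sub>1 = space M" "space N\<^sub>2 = space M" "indep_set (sets N\<^sub>1) (sets N\<^sub>2)"
    and Z: "Z \<in> borel_measurable N\<^sub>1" "square_integrable M Z"
    and b: "b \<in> borel_measurable N\<^sub>2" "square_integrable M b"
  shows "square_integrable M (\<lambda>\<omega>. Z \<omega> *\<^sub>R b \<omega>)"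
proof -
  have "integrable M (\<lambda>\<omega>. (Z \<omega>)\<^sup>2 * (norm (b \<omega>))\<^sup>2)"
    using Z b by (intro indep_set_integrable_mult[OF N]) (auto simp: square_integrable_def)
  then show ?thesis
    using Z b by (auto simp: square_integrable_def power_mult_distrib)
qed

text \<open>The noise coefficients are centered, uncorrelated and independent of the vectors that they multiply,
  so all cross terms of the expanded quadratic form vanish.\<close>

lemma expectation_form_noise:
  fixes P :: "real^'n^'n" and a :: "'a \<Rightarrow> real^'n" and b :: "'i \<Rightarrow> 'a \<Rightarrow> real^'n" and Z :: "'i \<Rightarrow> 'a \<Rightarrow> real"
  assumes sym: "transpose P = P" and I: "finite I"
    and N: "space N\<^sub>1 = space M" "space N\<^sub>2 = space M" "indep_set (sets N\<^sub>1) (sets N\<^sub>2)"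
    and Z: "\<And>e. e \<in> I \<Longrightarrow> Z e \<in> borel_measurable N\<^sub>1" "\<And>e. e \<in> I \<Longrightarrow> square_integrable M (Z e)"
    and a: "a \<in> borel_measurable N\<^sub>2" "square_integrable M a"
    and b: "\<And>e. e \<in> I \<Longrightarrow> b e \<in> borel_measurable N\<^sub>2" "\<And>e. e \<in> I \<Longrightarrow> square_integrable M (b e)"
    and mean: "\<And>e. e \<in> I \<Longrightarrow> (\<integral>\<omega>. Z e \<omega> \<partial>M) = 0"
    and cov: "\<And>e f. e \<in> I \<Longrightarrow> f \<in> I \<Longrightarrow> (\<integral>\<omega>. Z e \<omega> * Z f \<omega> \<partial>M) = (if e = f then s e else 0)"
  shows "(\<integral>\<omega>. (a \<omega> - (\<Sum>e\<in>I. Z e \<omega> *\<^sub>R b e \<omega>)) \<bullet> (P *v (a \<omega> - (\<Sum>e\<in>I. Z e \<omega> *\<^sub>R b e \<omega>))) \<partial>M)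
    = (\<integral>\<omega>. a \<omega> \<bullet> (P *v a \<omega>) \<partial>M) + (\<Sum>e\<in>I. s e * (\<integral>\<omega>. b e \<omega> \<bullet> (P *v b e \<omega>) \<partial>M))"
proof -
  have expand: "(a \<omega> - (\<Sum>e\<in>I. Z e \<omega> *\<^sub>R b e \<omega>)) \<bullet> (P *v (a \<omega> - (\<Sum>e\<in>I. Z e \<omega> *\<^sub>R b e \<omega>)))
      = a \<omega> \<bullet> (P *v a \<omega>) - 2 * (\<Sum>e\<in>I. Z e \<omega> * (a \<omega> \<bullet> (P *v b e \<omega>)))
        + (\<Sum>e\<in>I. \<Sum>f\<in>I. (Z e \<omega> * Z f \<omega>) * (b e \<omega> \<bullet> (P *v b f \<omega>)))" for \<omega>
  proof -
    let ?s = "\<Sum>e\<in>I. Z e \<omega> *\<^sub>R b e \<omega>"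
    have Ps: "P *v ?s = (\<Sum>e\<in>I. Z e \<omega> *\<^sub>R (P *v b e \<omega>))"
      by (simp add: linear_sum[OF matrix_vector_mul_linear] matrix_vector_mult_scaleR)
    have 1: "a \<omega> \<bullet> (P *v ?s) = (\<Sum>e\<in>I. Z e \<omega> * (a \<omega> \<bullet> (P *v b e \<omega>)))"
      unfolding Ps by (simp add: inner_sum_right)
    have 2: "?s \<bullet> (P *v a \<omega>) = a \<omega> \<bullet> (P *v ?s)"
      using symmetric_inner[OF sym, of ?s "a \<omega>"] by (simp add: inner_commute)
    have 3: "?s \<bullet> (P *v ?s) = (\<Sum>e\<in>I. \<Sum>f\<in>I. (Z e \<omega> * Z f \<omega>) * (b e \<omega> \<bullet> (P *v b f \<omega>)))"
      unfolding Ps inner_sum_left by (simp add: inner_sum_right sum_distrib_left mult_ac)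
    show ?thesis
      using 1 2 3 by (simp add: matrix_vector_mult_diff_distrib inner_diff_left inner_diff_right)
  qed
  have meas: "(\<lambda>\<omega>. f \<omega> \<bullet> (P *v g \<omega>)) \<in> borel_measurable N\<^sub>2"
    if "f \<in> borel_measurable N\<^sub>2" "g \<in> borel_measurable N\<^sub>2" for f g
  proof -
    have "(*v) P \<in> borel_measurable borel"
      by (intro borel_measurable_continuous_onI matrix_vector_mult_linear_continuous_on)
    then show ?thesis
      using that by (intro borel_measurable_inner) (auto intro: measurable_compose)
  qed
  have intZ: "integrable M (Z e)" if "e \<in> I" for e
    using Z(2)[OF that] by (auto simp: square_integrable_def intro: square_integrable_imp_integrable)
  have intZZ: "integrable M (\<lambda>\<omega>. Z e \<omega> * Z f \<omega>)" if "e \<in> I" "f \<in> I" for e f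
  proof (rule Bochner_Integration.integrable_bound)
    show "integrable M (\<lambda>\<omega>. (norm (Z e \<omega>))\<^sup>2 + (norm (Z f \<omega>))\<^sup>2)"
      using Z(2) that by (simp add: square_integrable_def)
    show "(\<lambda>\<omega>. Z e \<omega> * Z f \<omega>) \<in> borel_measurable M"
      using Z(2)[OF that(1)] Z(2)[OF that(2)] by (auto simp: square_integrable_def)
    have "\<bar>x * y\<bar> \<le> x\<^sup>2 + y\<^sup>2" for x y :: real
      using sum_squares_bound[of "\<bar>x\<bar>" "\<bar>y\<bar>"] unfolding abs_mult power2_abs
      using mult_nonneg_nonneg[of "\<bar>x\<bar>" "\<bar>y\<bar>"] by linarith
    then show "AE \<omega> in M. norm (Z e \<omega> * Z f \<omega>) \<le> norm ((norm (Z e \<omega>))\<^sup>2 + (norm (Z f \<omega>))\<^sup>2)"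
      by (intro AE_I2) simp
  qed
  have cross: "integrable M (\<lambda>\<omega>. Z e \<omega> * (a \<omega> \<bullet> (P *v b e \<omega>)))" "(\<integral>\<omega>. Z e \<omega> * (a \<omega> \<bullet> (P *v b e \<omega>)) \<partial>M) = 0"
    if "e \<in> I" for e
    using indep_set_integrable_mult[OF N Z(1)[OF that] intZ[OF that] meas[OF a(1) b(1)[OF that]] integrable_form[OF a(2) b(2)[OF that]]]
      indep_set_integral_mult[OF N Z(1)[OF that] intZ[OF that] meas[OF a(1) b(1)[OF that]] integrable_form[OF a(2) b(2)[OF that]]]
      mean[OF that] by auto
  have quad: "integrable M (\<lambda>\<omega>. (Z e \<omega> * Z f \<omega>) * (b e \<omega> \<bullet> (P *v b f \<omega>)))"
    "(\<integral>\<omega>. (Z e \<omega> * Z f \<omega>) * (b e \<omega> \<bullet> (P *v b f \<omega>)) \<partial>M)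
      = (if e = f then s e else 0) * (\<integral>\<omega>. b e \<omega> \<bullet> (P *v b f \<omega>) \<partial>M)"
    if "e \<in> I" "f \<in> I" for e f
    using indep_set_integrable_mult[OF N _ intZZ[OF that] meas[OF b(1)[OF that(1)] b(1)[OF that(2)]] integrable_form[OF b(2)[OF that(1)] b(2)[OF that(2)]]]
      indep_set_integral_mult[OF N _ intZZ[OF that] meas[OF b(1)[OF that(1)] b(1)[OF that(2)]] integrable_form[OF b(2)[OF that(1)] b(2)[OF that(2)]]]
      cov[OF that] Z(1)[OF that(1)] Z(1)[OF that(2)] by auto
  have "(\<Sum>f\<in>I. (if e = f then s e else 0) * (\<integral>\<omega>. b e \<omega> \<bullet> (P *v b f \<omega>) \<partial>M)) = s e * (\<integral>\<omega>. b e \<omega> \<bullet> (P *v b e \<omega>) \<partial>M)"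
    if "e \<in> I" for e
    using I that by (simp add: if_distrib[of "\<lambda>c. c * _"] cong: if_cong)
  then show ?thesis
    unfolding expand
    by (simp add: integrable_form[OF a(2) a(2)] cross quad Bochner_Integration.integrable_sum
        Bochner_Integration.integral_add Bochner_Integration.integral_diff Bochner_Integration.integral_sum)
qed

end

section \<open>The disagreement energy\<close>

lemma form_young:
  fixes P :: "real^'n^'n"
  assumes sym: "transpose P = P" and psd: "\<And>x. x \<bullet> (P *v x) \<ge> 0" and \<eta>: "\<eta> > 0"
  shows "(a + b) \<bullet> (P *v (a + b)) \<le> (1 + \<eta>) * (a \<bullet> (P *v a)) + (1 + 1 / \<eta>) * (b \<bullet> (P *v b))"
proof -
  have "0 \<le> (\<eta> *\<^sub>R a - b) \<bullet> (P *v (\<eta> *\<^sub>R a - b))"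
    by (rule psd)
  also have "\<dots> = \<eta>\<^sup>2 * (a \<bullet> (P *v a)) - 2 * \<eta> * (a \<bullet> (P *v b)) + b \<bullet> (P *v b)"
    using symmetric_inner[OF sym, of b a]
    by (simp add: matrix_vector_mult_diff_distrib matrix_vector_mult_scaleR inner_diff_left inner_diff_right
        inner_commute power2_eq_square algebra_simps)
  finally have "2 * (a \<bullet> (P *v b)) \<le> \<eta> * (a \<bullet> (P *v a)) + (b \<bullet> (P *v b)) / \<eta>"
    using \<eta> by (simp add: field_simps power2_eq_square)
  then show ?thesis
    using symmetric_inner[OF sym, of b a]
    by (simp add: matrix_vector_right_distrib inner_add_left inner_add_right inner_commute algebra_simps)
qed

text \<open>The Lyapunov function of the network is the quadratic form \<open>P\<close> summed over the modes orthogonal to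
  consensus. The mode description suits the linear part of the dynamics; the description by pairs of
  subsystems suits the nonlinearity and the final estimate.\<close>

locale disagreement_basis =
  fixes U :: "(real^'v::finite) set" and P :: "real^'n^'n"
  assumes U: "finite U" "pairwise orthogonal U" "\<And>u. u \<in> U \<Longrightarrow> norm u = 1" "span U = {x. 1 \<bullet> x = 0}"
    and P: "pos_def P"
begin

lemma P_sym: "transpose P = P"
  using P by (simp add: pos_def_def)

lemma P_nonneg: "x \<bullet> (P *v x) \<ge> 0"
  using P unfolding pos_def_def by (cases "x = 0") (auto simp: less_imp_le)

definition energy :: "('v \<Rightarrow> real^'n) \<Rightarrow> real" where
  "energy x = (\<Sum>u\<in>U. mode u x \<bullet> (P *v mode u x))"

lemma energy_pairs:
  "energy x = (\<Sum>k\<in>UNIV. \<Sum>j\<in>UNIV. (x k - x j) \<bullet> (P *v (x k - x j))) / (2 * real CARD('v))"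
  unfolding energy_def by (rule mode_parseval[OF U bilinear_matrix_form])

lemma energy_young:
  "\<eta> > 0 \<Longrightarrow> energy (\<lambda>k. x k + y k) \<le> (1 + \<eta>) * energy x + (1 + 1 / \<eta>) * energy y"
  unfolding energy_def sum_distrib_left sum.distrib[symmetric] mode_add
  by (intro sum_mono form_young P_sym P_nonneg)

lemma energy_le:
  assumes k: "\<And>x. x \<bullet> (P *v x) \<le> k * (norm x)\<^sup>2"
  shows "energy x \<le> k / (2 * real CARD('v)) * (\<Sum>i\<in>UNIV. \<Sum>l\<in>UNIV. (norm (x i - x l))\<^sup>2)"
proof -
  have "(\<Sum>i\<in>UNIV. \<Sum>l\<in>UNIV. (x i - x l) \<bullet> (P *v (x i - x l)))
      \<le> k * (\<Sum>i\<in>UNIV. \<Sum>l\<in>UNIV. (norm (x i - x l))\<^sup>2)"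
    unfolding sum_distrib_left by (intro sum_mono k)
  then show ?thesis
    unfolding energy_pairs by (simp add: divide_right_mono)
qed

lemma energy_ge:
  assumes r: "\<And>x. r * (norm x)\<^sup>2 \<le> x \<bullet> (P *v x)"
  shows "r * (norm (x k - x j))\<^sup>2 \<le> 2 * real CARD('v) * energy x"
proof -
  have "r * (norm (x k - x j))\<^sup>2 \<le> (x k - x j) \<bullet> (P *v (x k - x j))"
    by (rule r)
  also have "\<dots> \<le> (\<Sum>j\<in>UNIV. (x k - x j) \<bullet> (P *v (x k - x j)))"
    by (rule member_le_sum) (auto intro: P_nonneg)
  also have "\<dots> \<le> (\<Sum>k\<in>UNIV. \<Sum>j\<in>UNIV. (x k - x j) \<bullet> (P *v (x k - x j)))"
    by (rule member_le_sum[of k UNIV "\<lambda>k. \<Sum>j\<in>UNIV. (x k - x j) \<bullet> (P *v (x k - x j))"])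
      (auto intro!: sum_nonneg P_nonneg)
  also have "\<dots> = 2 * real CARD('v) * energy x"
    unfolding energy_pairs by simp
  finally show ?thesis .
qed

text \<open>The incremental sector condition holds for every pair of subsystems, hence, by Parseval, in the
  sum over the modes. It need not hold for an individual mode, since the nonlinearity mixes them.\<close>

lemma sector_modes:
  fixes C :: "real^'n^'m" and D\<^sub>1 \<Sigma>\<^sub>1 :: "real^'m^'m" and f :: "real^'m \<Rightarrow> real^'m" and x :: "'v \<Rightarrow> real^'n"
  assumes \<Sigma>\<^sub>1: "\<Sigma>\<^sub>1 = D\<^sub>1 + transpose D\<^sub>1"
    and sector: "\<And>y y'. y \<noteq> y' \<Longrightarrow> (f y - f y') \<bullet> ((y - y') - D\<^sub>1 *v (f y - f y')) > 0"
  defines "p \<equiv> \<lambda>k. f (C *v x k)"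
  shows "0 \<le> (\<Sum>u\<in>U. 2 * (mode u p \<bullet> (C *v mode u x)) - mode u p \<bullet> (\<Sigma>\<^sub>1 *v mode u p))"
proof -
  define y where "y k = C *v x k" for k
  have sec: "0 \<le> (p k - p j) \<bullet> (y k - y j) - (p k - p j) \<bullet> (D\<^sub>1 *v (p k - p j))" for k j
    using sector[of "y k" "y j"] unfolding p_def y_def[symmetric]
    by (cases "y k = y j") (auto simp: inner_diff_right less_imp_le)
  have Cx: "C *v mode u x = mode u y" for u
    unfolding y_def by (rule linear_mode[OF matrix_vector_mul_linear])
  have \<Sigma>: "q \<bullet> (\<Sigma>\<^sub>1 *v q) = 2 * (q \<bullet> (D\<^sub>1 *v q))" for q
    unfolding \<Sigma>\<^sub>1 using inner_transpose[of q D\<^sub>1 q]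
    by (simp add: matrix_vector_mult_add_rdistrib inner_add_right inner_commute)
  have bil: "bilinear (\<lambda>q y :: real^'m. q \<bullet> y)"
    using bilinear_conv_bounded_bilinear bounded_bilinear_inner by blast
  have "(\<Sum>u\<in>U. mode u p \<bullet> mode u y) - (\<Sum>u\<in>U. mode u p \<bullet> (D\<^sub>1 *v mode u p))
      = (\<Sum>k\<in>UNIV. \<Sum>j\<in>UNIV. (p k - p j) \<bullet> (y k - y j) - (p k - p j) \<bullet> (D\<^sub>1 *v (p k - p j))) / (2 * real CARD('v))"
    using mode_parseval[OF U bil, of p y] mode_parseval[OF U bilinear_matrix_form, of p D\<^sub>1 p]
    by (simp add: sum_subtractf diff_divide_distrib)
  also have "\<dots> \<ge> 0"
    by (intro divide_nonneg_nonneg sum_nonneg sec) auto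
  finally have "0 \<le> (\<Sum>u\<in>U. mode u p \<bullet> mode u y) - (\<Sum>u\<in>U. mode u p \<bullet> (D\<^sub>1 *v mode u p))" .
  then show ?thesis
    by (simp add: Cx \<Sigma> sum_subtractf sum_distrib_left[symmetric])
qed

lemma integrable_energy:
  assumes "prob_space M" "\<And>k. square_integrable M (\<lambda>\<omega>. x \<omega> k)"
  shows "integrable M (\<lambda>\<omega>. energy (x \<omega>))"
proof -
  interpret prob_space M by (rule assms)
  have "square_integrable M (\<lambda>\<omega>. mode u (x \<omega>))" for u
    unfolding mode_def using assms(2) by (intro square_integrable_sum square_integrable_linear[OF linear_scaleR])
  then show ?thesis
    unfolding energy_def by (intro Bochner_Integration.integrable_sum integrable_form)
qed

text \<open>One step of the network without additive noise, averaged over the current link noise. The noise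
  on a link enters with the factor \<open>ell e \<bullet> ell e = 2\<close>; bounding the variances by \<open>\<gamma> \<mu>\<close> turns the sum
  over the uncertain links into the Laplacian \<open>L_u \<le> \<tau> L\<close>, which is diagonal in the modes. What
  remains is a sum of single-mode bounds.\<close>

lemma network_contraction:
  fixes A :: "real^'n^'n" and B :: "real^'m^'n" and C :: "real^'n^'m" and G :: "real^'m^'n"
    and l :: "real^'v \<Rightarrow> real" and E\<^sub>U :: "('v \<times> 'v) set"
  assumes modes: "\<And>u x p. u \<in> U \<Longrightarrow>
      (let x' = A *v x - l u *\<^sub>R (G *v (C *v x)) - B *v p; z = G *v (C *v x) in
        x' \<bullet> (P *v x') + 2 * \<gamma> * \<tau> * l u * (z \<bullet> (P *v z)) + (2 * (p \<bullet> (C *v x)) - p \<bullet> (\<Sigma>\<^sub>1 *v p))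
          \<le> \<rho> * (x \<bullet> (P *v x)))"
    and \<Sigma>\<^sub>1: "\<Sigma>\<^sub>1 = D\<^sub>1 + transpose D\<^sub>1"
    and sector: "\<And>y y'. y \<noteq> y' \<Longrightarrow> (f y - f y') \<bullet> ((y - y') - D\<^sub>1 *v (f y - f y')) > 0"
    and \<gamma>: "\<gamma> \<ge> 0" "\<And>e. e \<in> E\<^sub>U \<Longrightarrow> s e \<le> \<gamma> * w e"
    and \<tau>: "\<And>x. (\<Sum>e\<in>E\<^sub>U. w e * (ell e \<bullet> x)\<^sup>2) \<le> \<tau> * (\<Sum>u\<in>U. l u * (u \<bullet> x)\<^sup>2)"
  defines "a \<equiv> \<lambda>u x. A *v mode u x - l u *\<^sub>R (G *v (C *v mode u x)) - B *v mode u (\<lambda>k. f (C *v x k))"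
    and "d \<equiv> \<lambda>e x. mode (ell e) (\<lambda>k. G *v (C *v x k))"
  shows "(\<Sum>u\<in>U. a u x \<bullet> (P *v a u x)) + 2 * (\<Sum>e\<in>E\<^sub>U. s e * (d e x \<bullet> (P *v d e x))) \<le> \<rho> * energy x"
proof -
  define z where "z k = G *v (C *v x k)" for k
  define p where "p k = f (C *v x k)" for k
  have z: "mode u z = G *v (C *v mode u x)" for u
    unfolding z_def by (simp add: linear_mode[OF matrix_vector_mul_linear])
  have "(\<Sum>e\<in>E\<^sub>U. s e * (d e x \<bullet> (P *v d e x))) \<le> (\<Sum>e\<in>E\<^sub>U. (\<gamma> * w e) * (d e x \<bullet> (P *v d e x)))"
    by (intro sum_mono mult_right_mono \<gamma> P_nonneg)
  also have "\<dots> = \<gamma> * (\<Sum>e\<in>E\<^sub>U. w e * (d e x \<bullet> (P *v d e x)))"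
    by (simp add: sum_distrib_left mult.assoc)
  also have "(\<Sum>e\<in>E\<^sub>U. w e * (d e x \<bullet> (P *v d e x))) \<le> (\<Sum>u\<in>U. (\<tau> * l u) * (mode u z \<bullet> (P *v mode u z)))"
    unfolding d_def z_def[symmetric]
    using \<tau> by (intro quadratic_form_mode_le P_sym P_nonneg) (simp add: sum_distrib_left mult.assoc)
  finally have "(\<Sum>e\<in>E\<^sub>U. s e * (d e x \<bullet> (P *v d e x)))
      \<le> \<gamma> * (\<Sum>u\<in>U. (\<tau> * l u) * (mode u z \<bullet> (P *v mode u z)))"
    using \<gamma>(1) by (simp add: mult_left_mono)
  moreover have "(\<Sum>u\<in>U. 2 * \<gamma> * \<tau> * l u * (mode u z \<bullet> (P *v mode u z)))
      = 2 * (\<gamma> * (\<Sum>u\<in>U. (\<tau> * l u) * (mode u z \<bullet> (P *v mode u z))))"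
    by (simp add: sum_distrib_left mult.assoc)
  ultimately have noise: "2 * (\<Sum>e\<in>E\<^sub>U. s e * (d e x \<bullet> (P *v d e x)))
      \<le> (\<Sum>u\<in>U. 2 * \<gamma> * \<tau> * l u * (mode u z \<bullet> (P *v mode u z)))"
    by linarith
  have "(\<Sum>u\<in>U. a u x \<bullet> (P *v a u x)) + 2 * (\<Sum>e\<in>E\<^sub>U. s e * (d e x \<bullet> (P *v d e x)))
      \<le> (\<Sum>u\<in>U. a u x \<bullet> (P *v a u x) + 2 * \<gamma> * \<tau> * l u * (mode u z \<bullet> (P *v mode u z))
            + (2 * (mode u p \<bullet> (C *v mode u x)) - mode u p \<bullet> (\<Sigma>\<^sub>1 *v mode u p)))"
    using noise sector_modes[OF \<Sigma>\<^sub>1 sector, of C x] unfolding sum.distrib p_def by linarith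
  also have "\<dots> \<le> (\<Sum>u\<in>U. \<rho> * (mode u x \<bullet> (P *v mode u x)))"
    using modes unfolding a_def p_def z Let_def by (intro sum_mono) simp
  finally show ?thesis
    by (simp add: energy_def sum_distrib_left)
qed

end

section \<open>From an exponential bound to synchronization\<close>

text \<open>Dividing by the initial difference of the pair turns the sum of all initial differences into a
  function \<open>Kbar\<close> of the differences times \<open>rho\<close>; summing the quotients over all pairs makes \<open>Kbar\<close>
  independent of the pair, and the quotients with a vanishing denominator drop out because division
  by zero yields zero.\<close>

lemma mean_square_exp_syncI:
  fixes X :: "real^('v::finite \<times> 'n::finite) \<Rightarrow> nat \<Rightarrow> 'w \<Rightarrow> real^('v \<times> 'n)"
  assumes \<beta>: "0 < \<beta>" "\<beta> < 1" and c: "0 < c" and c': "0 < c'"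
    and integrable: "\<And>x0 k j t. integrable M (\<lambda>\<omega>. (norm (block k (X x0 t \<omega>) - block j (X x0 t \<omega>)))\<^sup>2)"
    and le: "\<And>x0 k j t. (\<integral>\<omega>. (norm (block k (X x0 t \<omega>) - block j (X x0 t \<omega>)))\<^sup>2 \<partial>M)
      \<le> c' * \<beta> ^ t * (\<Sum>i\<in>UNIV. \<Sum>l\<in>UNIV. initial_differences x0 i l) + c * onorm ((*v) Rv)"
  shows "mean_square_exp_sync M X Rv"
proof -
  define Q :: "('v \<Rightarrow> 'v \<Rightarrow> real) \<Rightarrow> 'v \<Rightarrow> 'v \<Rightarrow> real"
    where "Q d k j = (\<Sum>i\<in>UNIV. \<Sum>l\<in>UNIV. \<bar>d i l\<bar> / \<bar>d k j\<bar>)" for d k j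
  define Kbar where "Kbar d = c' * ((real CARD('v))\<^sup>2 + (\<Sum>k\<in>UNIV. \<Sum>j\<in>UNIV. Q d k j))" for d
  have Q0: "Q d k j \<ge> 0" for d k j
    unfolding Q_def by (intro sum_nonneg) auto
  have Kbar_pos: "Kbar d > 0" for d
    unfolding Kbar_def using c' Q0 by (intro mult_pos_pos add_pos_nonneg sum_nonneg) auto
  have key: "c' * (\<Sum>i\<in>UNIV. \<Sum>l\<in>UNIV. initial_differences x0 i l) \<le> Kbar (initial_differences x0) *
      (if block k x0 \<noteq> block j x0 then (norm (block k x0 - block j x0))\<^sup>2
       else Max (range (\<lambda>(i, l). initial_differences x0 i l)))" (is "?l \<le> ?r") for x0 :: "real^('v \<times> 'n)" and k j
  proof (cases "block k x0 = block j x0")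
    case True
    define m where "m = Max (range (\<lambda>(i, l). initial_differences x0 i l))"
    have le_m: "initial_differences x0 i l \<le> m" for i l
      unfolding m_def by (rule Max_ge) (auto intro: image_eqI[of _ _ "(i, l)"])
    have m0: "m \<ge> 0"
      using le_m[of k k] by (simp add: initial_differences_def)
    have "(\<Sum>i\<in>UNIV. \<Sum>l\<in>UNIV. initial_differences x0 i l) \<le> (\<Sum>i\<in>(UNIV :: 'v set). \<Sum>l\<in>(UNIV :: 'v set). m)"
      by (intro sum_mono le_m)
    also have "\<dots> = (real CARD('v))\<^sup>2 * m"
      by (simp add: power2_eq_square)
    finally have "?l \<le> c' * (real CARD('v))\<^sup>2 * m"
      using c' by simp
    also have "\<dots> \<le> Kbar (initial_differences x0) * m"
      unfolding Kbar_def using c' m0 Q0 by (intro mult_right_mono mult_left_mono) (auto intro!: sum_nonneg)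
    finally show ?thesis
      using True by (simp add: m_def)
  next
    case False
    let ?d = "initial_differences x0"
    have dkj: "?d k j = (norm (block k x0 - block j x0))\<^sup>2" "?d k j > 0"
      using False by (simp_all add: initial_differences_def)
    have "?l = c' * Q ?d k j * ?d k j"
      using dkj(2) by (simp add: Q_def sum_divide_distrib[symmetric] initial_differences_def)
    also have "\<dots> \<le> Kbar ?d * ?d k j"
    proof (intro mult_right_mono)
      have "Q ?d k j \<le> (\<Sum>j\<in>UNIV. Q ?d k j)"
        by (rule member_le_sum) (auto intro: Q0)
      also have "\<dots> \<le> (\<Sum>k\<in>UNIV. \<Sum>j\<in>UNIV. Q ?d k j)"
        by (rule member_le_sum[of k UNIV "\<lambda>k. \<Sum>j\<in>UNIV. Q ?d k j"]) (auto intro!: sum_nonneg Q0)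
      also have "\<dots> \<le> (real CARD('v))\<^sup>2 + (\<Sum>k\<in>UNIV. \<Sum>j\<in>UNIV. Q ?d k j)"
        by simp
      finally show "c' * Q ?d k j \<le> Kbar ?d"
        unfolding Kbar_def using c' by (intro mult_left_mono) auto
    qed (use dkj in simp)
    finally show ?thesis
      using False dkj(1) by simp
  qed
  have bound: "(\<integral>\<omega>. (norm (block k (X x0 t \<omega>) - block j (X x0 t \<omega>)))\<^sup>2 \<partial>M)
      \<le> Kbar (initial_differences x0) * \<beta> ^ t *
        (if block k x0 \<noteq> block j x0 then (norm (block k x0 - block j x0))\<^sup>2
         else Max (range (\<lambda>(i, l). initial_differences x0 i l))) + c * onorm ((*v) Rv)" for x0 k j t
  proof -
    define rho where "rho = (if block k x0 \<noteq> block j x0 then (norm (block k x0 - block j x0))\<^sup>2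
         else Max (range (\<lambda>(i, l). initial_differences x0 i l)))"
    have "\<beta> ^ t * (c' * (\<Sum>i\<in>UNIV. \<Sum>l\<in>UNIV. initial_differences x0 i l))
        \<le> \<beta> ^ t * (Kbar (initial_differences x0) * rho)"
      using key[of x0 k j] \<beta>(1) unfolding rho_def by (intro mult_left_mono) auto
    then show ?thesis
      using le[of k x0 t j] unfolding rho_def[symmetric] by (simp add: mult_ac)
  qed
  show ?thesis
    unfolding mean_square_exp_sync_def Let_def
    using \<beta> c Kbar_pos integrable bound
    by (intro exI[of _ \<beta>] exI[of _ c] exI[of _ "Kbar (\<lambda>_ _. 0)"] exI[of _ Kbar]) auto
qed

section \<open>The random network\<close>

lemma block_add: "block k (x + y) = block k x + block k y"
  by (simp add: block_def vec_eq_iff)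

lemma block_diff: "block k (x - y) = block k x - block k y"
  by (simp add: block_def vec_eq_iff)

lemma block_stacked: "block k (stacked f y) = f (block k y)"
  by (simp add: block_def stacked_def vec_eq_iff)

lemma linear_block: "linear (block k)"
  by (rule linearI) (simp_all add: block_def vec_eq_iff)

lemma block_kron: "block k ((Q \<otimes>\<^sub>K H) *v x) = (\<Sum>j\<in>UNIV. Q $ k $ j *\<^sub>R (H *v block j x))"
proof -
  have "(\<Sum>q\<in>UNIV. (Q $ k $ fst q * H $ i $ snd q) * x $ q)
      = (\<Sum>j\<in>UNIV. \<Sum>l\<in>UNIV. (Q $ k $ j * H $ i $ l) * x $ (j, l))" for i
    by (simp add: sum.cartesian_product UNIV_Times_UNIV[symmetric] case_prod_beta del: UNIV_Times_UNIV)
  then show ?thesis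
    by (simp add: vec_eq_iff block_def kron_def matrix_vector_mult_def sum_distrib_left mult.assoc)
qed

lemma block_kron_mat_1: "block (k :: 'a::finite) ((mat 1 \<otimes>\<^sub>K H) *v x) = H *v block k x"
proof -
  have "(\<Sum>j\<in>UNIV. (mat 1 :: real^'a^'a) $ k $ j *\<^sub>R (H *v block j x)) = (\<Sum>j\<in>UNIV. if j = k then H *v block j x else 0)"
    by (intro sum.cong) (auto simp: mat_def)
  then show ?thesis
    by (simp add: block_kron)
qed

lemma sum_norm_block: "(\<Sum>k\<in>UNIV. (norm (block k x))\<^sup>2) = (norm x)\<^sup>2"
proof -
  have "(\<Sum>k\<in>UNIV. (norm (block k x))\<^sup>2) = (\<Sum>k\<in>UNIV. \<Sum>i\<in>UNIV. x $ (k, i) * x $ (k, i))"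
    by (simp add: block_def power2_norm_eq_inner inner_vec_def)
  also have "\<dots> = (norm x)\<^sup>2"
    by (simp add: sum.cartesian_product UNIV_Times_UNIV[symmetric] case_prod_beta power2_norm_eq_inner inner_vec_def
        del: UNIV_Times_UNIV)
  finally show ?thesis .
qed

lemma random_laplacian_sum:
  "(\<Sum>j\<in>UNIV. random_laplacian E E\<^sub>U \<mu> \<zeta> $ k $ j *\<^sub>R z j)
    = (\<Sum>j\<in>UNIV. laplacian E \<mu> $ k $ j *\<^sub>R z j) + (\<Sum>e\<in>E\<^sub>U. \<zeta> e *\<^sub>R (ell e $ k *\<^sub>R mode (ell e) z))"
proof -
  have "(\<Sum>j\<in>UNIV. (\<Sum>e\<in>E\<^sub>U. \<zeta> e * (ell e $ k * ell e $ j)) *\<^sub>R z j)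
      = (\<Sum>e\<in>E\<^sub>U. \<zeta> e *\<^sub>R (ell e $ k *\<^sub>R mode (ell e) z))"
    unfolding scaleR_sum_left by (subst sum.swap) (simp add: mode_def scaleR_sum_right)
  then show ?thesis
    by (simp add: random_laplacian_def scaleR_add_left sum.distrib)
qed

text \<open>The dynamics are studied subsystem by subsystem. Given the state at time \<open>t\<close>, the \<open>drift\<close> is the
  conditional mean of the next state up to the additive noise; \<open>noiseless\<close> includes the link noise.\<close>

locale random_network = prob_space M + E: weighted_graph E \<mu>
  for M :: "'w measure" and E :: "('v::{finite,linorder} \<times> 'v) set" and \<mu> :: "'v \<Rightarrow> 'v \<Rightarrow> real" +
  fixes A :: "real^'n^'n" and B :: "real^'m^'n" and C :: "real^'n^'m" and G :: "real^'m^'n"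
    and \<phi> :: "nat \<Rightarrow> real^'m \<Rightarrow> real^'m"
    and E_U :: "('v \<times> 'v) set" and \<sigma> :: "'v \<times> 'v \<Rightarrow> real"
    and \<xi> :: "'v \<times> 'v \<Rightarrow> nat \<Rightarrow> 'w \<Rightarrow> real"
    and v :: "nat \<Rightarrow> 'w \<Rightarrow> real^('v \<times> 'n)"
    and X :: "real^('v \<times> 'n) \<Rightarrow> nat \<Rightarrow> 'w \<Rightarrow> real^('v \<times> 'n)"
  assumes lipschitz: "\<And>t. \<exists>K. K-lipschitz_on UNIV (\<phi> t)"
    and E_U: "E_U \<subseteq> E"
    and \<xi>_indep: "indep_vars (\<lambda>_. borel) (\<lambda>(e, t). \<xi> e t) (E_U \<times> UNIV)"
    and \<xi>_square_integrable: "\<And>e t. e \<in> E_U \<Longrightarrow> integrable M (\<lambda>\<omega>. (\<xi> e t \<omega>)\<^sup>2)"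
    and \<xi>_mean: "\<And>e t. e \<in> E_U \<Longrightarrow> expectation (\<xi> e t) = 0"
    and \<xi>_variance: "\<And>e t. e \<in> E_U \<Longrightarrow> variance (\<xi> e t) = (\<sigma> e)\<^sup>2"
    and v_measurable: "\<And>t. v t \<in> borel_measurable M"
    and v_square_integrable: "\<And>t. integrable M (\<lambda>\<omega>. (norm (v t \<omega>))\<^sup>2)"
    and \<xi>_v_indep: "indep_set
          (sets (vimage_algebra (space M) (\<lambda>\<omega>. \<lambda>(e, t)\<in>E_U \<times> UNIV. \<xi> e t \<omega>)
             (Pi\<^sub>M (E_U \<times> UNIV) (\<lambda>_. borel))))
          (sets (vimage_algebra (space M) (\<lambda>\<omega> t. v t \<omega>) (Pi\<^sub>M UNIV (\<lambda>_. borel))))"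
    and initial: "\<And>x0 \<omega>. X x0 0 \<omega> = x0"
    and dynamics: "\<And>x0 t \<omega>. X x0 (Suc t) \<omega> =
          (mat 1 \<otimes>\<^sub>K A - random_laplacian E E_U \<mu> (\<lambda>e. \<xi> e t \<omega>) \<otimes>\<^sub>K (G ** C)) *v X x0 t \<omega>
          - (mat 1 \<otimes>\<^sub>K B) *v stacked (\<phi> t) ((mat 1 \<otimes>\<^sub>K C) *v X x0 t \<omega>)
          + v t \<omega>"
begin

abbreviation state :: "real^('v \<times> 'n) \<Rightarrow> nat \<Rightarrow> 'w \<Rightarrow> 'v \<Rightarrow> real^'n" where
  "state x0 t \<omega> k \<equiv> block k (X x0 t \<omega>)"

definition feedback :: "real^('v \<times> 'n) \<Rightarrow> nat \<Rightarrow> 'w \<Rightarrow> 'v \<Rightarrow> real^'n" where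
  "feedback x0 t \<omega> k = G *v (C *v state x0 t \<omega> k)"

definition drift :: "real^('v \<times> 'n) \<Rightarrow> nat \<Rightarrow> 'w \<Rightarrow> 'v \<Rightarrow> real^'n" where
  "drift x0 t \<omega> k = A *v state x0 t \<omega> k - (\<Sum>j\<in>UNIV. laplacian E \<mu> $ k $ j *\<^sub>R feedback x0 t \<omega> j)
     - B *v \<phi> t (C *v state x0 t \<omega> k)"

definition noiseless :: "real^('v \<times> 'n) \<Rightarrow> nat \<Rightarrow> 'w \<Rightarrow> 'v \<Rightarrow> real^'n" where
  "noiseless x0 t \<omega> k = drift x0 t \<omega> k - (\<Sum>e\<in>E_U. \<xi> e t \<omega> *\<^sub>R (ell e $ k *\<^sub>R mode (ell e) (feedback x0 t \<omega>)))"

lemma finite_E_U: "finite E_U"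
  by simp

lemma state_Suc: "state x0 (Suc t) \<omega> k = noiseless x0 t \<omega> k + block k (v t \<omega>)"
proof -
  have z: "(G ** C) *v state x0 t \<omega> j = feedback x0 t \<omega> j" for j
    by (simp add: feedback_def matrix_vector_mul_assoc)
  show ?thesis
    unfolding dynamics noiseless_def drift_def
    by (simp add: block_add block_diff matrix_vector_mult_diff_rdistrib block_kron_mat_1 block_stacked)
      (simp add: block_kron z random_laplacian_sum)
qed

lemma \<phi>_measurable: "\<phi> t \<in> borel_measurable borel"
  using lipschitz[of t] lipschitz_on_continuous_on by (auto intro: borel_measurable_continuous_onI)

lemma matrix_measurable: "f \<in> borel_measurable N \<Longrightarrow> (\<lambda>\<omega>. Q *v f \<omega>) \<in> borel_measurable N"
  for Q :: "real^'a^'b"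
  by (rule measurable_compose[of f N borel "(*v) Q"])
    (auto intro!: borel_measurable_continuous_onI matrix_vector_mult_linear_continuous_on)

lemma feedback_measurable:
  assumes "\<And>k. (\<lambda>\<omega>. state x0 t \<omega> k) \<in> borel_measurable N"
  shows "(\<lambda>\<omega>. feedback x0 t \<omega> k) \<in> borel_measurable N"
  unfolding feedback_def by (intro matrix_measurable assms)

lemma drift_measurable:
  assumes "\<And>k. (\<lambda>\<omega>. state x0 t \<omega> k) \<in> borel_measurable N"
  shows "(\<lambda>\<omega>. drift x0 t \<omega> k) \<in> borel_measurable N"
  unfolding drift_def
  by (intro borel_measurable_diff borel_measurable_sum borel_measurable_scaleR borel_measurable_const
      feedback_measurable matrix_measurable measurable_compose[OF _ \<phi>_measurable] assms)

lemma mode_measurable: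
  fixes f :: "'w \<Rightarrow> 'v \<Rightarrow> real^'n"
  assumes "\<And>k. (\<lambda>\<omega>. f \<omega> k) \<in> borel_measurable N"
  shows "(\<lambda>\<omega>. mode u (f \<omega>)) \<in> borel_measurable N"
  unfolding mode_def by (intro borel_measurable_sum borel_measurable_scaleR borel_measurable_const assms)

text \<open>The state at time \<open>t\<close> is a function of the link noise strictly before \<open>t\<close> and of the additive noise.\<close>

lemma state_measurable:
  assumes \<xi>: "\<And>e s. e \<in> E_U \<Longrightarrow> s < T \<Longrightarrow> \<xi> e s \<in> borel_measurable N"
    and v: "\<And>s. v s \<in> borel_measurable N"
  shows "t \<le> T \<Longrightarrow> (\<lambda>\<omega>. state x0 t \<omega> k) \<in> borel_measurable N"
proof (induction t arbitrary: k)
  case 0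
  then show ?case by (simp add: initial)
next
  case (Suc t)
  have x: "(\<lambda>\<omega>. state x0 t \<omega> k) \<in> borel_measurable N" for k
    using Suc by simp
  have block: "(\<lambda>\<omega>. block k (v t \<omega>)) \<in> borel_measurable N"
    using v by (rule measurable_compose)
      (auto intro!: borel_measurable_continuous_onI linear_continuous_on simp: linear_linear linear_block)
  have "\<And>e. e \<in> E_U \<Longrightarrow> \<xi> e t \<in> borel_measurable N"
    using \<xi> Suc.prems by simp
  then show ?case
    unfolding state_Suc noiseless_def
    by (intro borel_measurable_add borel_measurable_diff borel_measurable_sum borel_measurable_scaleR
        borel_measurable_const drift_measurable mode_measurable feedback_measurable x block)
qed

lemma feedback_square_integrable:
  assumes "\<And>k. square_integrable M (\<lambda>\<omega>. state x0 t \<omega> k)"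
  shows "square_integrable M (\<lambda>\<omega>. feedback x0 t \<omega> k)"
  unfolding feedback_def by (intro square_integrable_linear[OF matrix_vector_mul_linear] assms)

lemma drift_square_integrable:
  assumes x: "\<And>k. square_integrable M (\<lambda>\<omega>. state x0 t \<omega> k)"
  shows "square_integrable M (\<lambda>\<omega>. drift x0 t \<omega> k)"
proof -
  obtain K where "K-lipschitz_on UNIV (\<phi> t)"
    using lipschitz by blast
  then have "square_integrable M (\<lambda>\<omega>. \<phi> t (C *v state x0 t \<omega> k))"
    by (rule square_integrable_lipschitz) (intro square_integrable_linear[OF matrix_vector_mul_linear] x)
  then show ?thesis
    unfolding drift_def
    by (intro square_integrable_diff square_integrable_sum square_integrable_linear[OF matrix_vector_mul_linear]
        square_integrable_linear[OF linear_scaleR] feedback_square_integrable x)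
qed

lemma mode_square_integrable:
  fixes f :: "'w \<Rightarrow> 'v \<Rightarrow> real^'n"
  assumes "\<And>k. square_integrable M (\<lambda>\<omega>. f \<omega> k)"
  shows "square_integrable M (\<lambda>\<omega>. mode u (f \<omega>))"
  unfolding mode_def by (intro square_integrable_sum square_integrable_linear[OF linear_scaleR] assms)

lemma \<xi>_measurable: "e \<in> E_U \<Longrightarrow> \<xi> e t \<in> borel_measurable M"
  using \<xi>_indep by (auto simp: indep_vars_def)

lemma \<xi>_L2: "e \<in> E_U \<Longrightarrow> square_integrable M (\<xi> e t)"
  using \<xi>_measurable \<xi>_square_integrable by (simp add: square_integrable_def)

lemma v_L2: "square_integrable M (\<lambda>\<omega>. block k (v t \<omega>))"
  by (rule square_integrable_linear[OF linear_block]) (simp add: square_integrable_def v_measurable v_square_integrable)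

text \<open>Taking for \<open>N\<^sub>2\<close> the information of the additive noise and of the link noise at all times other than \<open>t\<close>
  suffices, since the state at time \<open>t\<close> uses only the earlier link noise.\<close>

lemma state_independent_of_current_noise:
  obtains N\<^sub>1 N\<^sub>2 where "space N\<^sub>1 = space M" "space N\<^sub>2 = space M" "indep_set (sets N\<^sub>1) (sets N\<^sub>2)"
    "\<And>e. e \<in> E_U \<Longrightarrow> \<xi> e t \<in> borel_measurable N\<^sub>1"
    "\<And>x0 k. (\<lambda>\<omega>. state x0 t \<omega> k) \<in> borel_measurable N\<^sub>2"
proof (rule innovation_independence[OF \<xi>_indep \<xi>_v_indep, of t])
  fix N\<^sub>1 N\<^sub>2
  assume N: "space N\<^sub>1 = space M" "space N\<^sub>2 = space M" "indep_set (sets N\<^sub>1) (sets N\<^sub>2)"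
    "\<And>e. e \<in> E_U \<Longrightarrow> \<xi> e t \<in> borel_measurable N\<^sub>1"
    "\<And>e s. e \<in> E_U \<Longrightarrow> s \<noteq> t \<Longrightarrow> \<xi> e s \<in> borel_measurable N\<^sub>2"
    "\<And>s. v s \<in> borel_measurable N\<^sub>2"
  have x: "(\<lambda>\<omega>. state x0 t \<omega> k) \<in> borel_measurable N\<^sub>2" for x0 k
    by (rule state_measurable[of t]) (use N in auto)
  from that[OF N(1-4) x] show thesis .
qed

text \<open>The link noise multiplies the state, and a product of square-integrable variables is in general not
  square-integrable; here it is, because the two factors are independent.\<close>

lemma state_square_integrable: "square_integrable M (\<lambda>\<omega>. state x0 t \<omega> k)"
  and noiseless_square_integrable: "square_integrable M (\<lambda>\<omega>. noiseless x0 t \<omega> k)"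
proof -
  have step: "square_integrable M (\<lambda>\<omega>. noiseless x0 t \<omega> k)"
    if x: "\<And>k. square_integrable M (\<lambda>\<omega>. state x0 t \<omega> k)" for t k
  proof (rule state_independent_of_current_noise[of t])
    fix N\<^sub>1 N\<^sub>2
    assume N: "space N\<^sub>1 = space M" "space N\<^sub>2 = space M" "indep_set (sets N\<^sub>1) (sets N\<^sub>2)"
      "\<And>e. e \<in> E_U \<Longrightarrow> \<xi> e t \<in> borel_measurable N\<^sub>1"
      "\<And>x0 k. (\<lambda>\<omega>. state x0 t \<omega> k) \<in> borel_measurable N\<^sub>2"
    have "square_integrable M (\<lambda>\<omega>. \<xi> e t \<omega> *\<^sub>R (ell e $ k *\<^sub>R mode (ell e) (feedback x0 t \<omega>)))" if "e \<in> E_U" for e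
      by (rule square_integrable_noise_mult[OF N(1-3) N(4)[OF that] \<xi>_L2[OF that]])
        (intro borel_measurable_scaleR borel_measurable_const mode_measurable feedback_measurable N,
         intro square_integrable_linear[OF linear_scaleR] mode_square_integrable feedback_square_integrable x)
    then show ?thesis
      unfolding noiseless_def by (intro square_integrable_diff square_integrable_sum drift_square_integrable x)
  qed
  have x: "square_integrable M (\<lambda>\<omega>. state x0 t \<omega> k)" for t k
  proof (induction t arbitrary: k)
    case 0
    then show ?case by (simp add: initial square_integrable_const)
  next
    case (Suc t)
    then show ?case
      unfolding state_Suc by (intro square_integrable_add step v_L2)
  qed
  then show "square_integrable M (\<lambda>\<omega>. state x0 t \<omega> k)" .
  show "square_integrable M (\<lambda>\<omega>. noiseless x0 t \<omega> k)"
    by (rule step[OF x])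
qed

lemma \<xi>_covariance:
  assumes "e \<in> E_U" "f \<in> E_U"
  shows "(\<integral>\<omega>. \<xi> e t \<omega> * \<xi> f t \<omega> \<partial>M) = (if e = f then (\<sigma> e)\<^sup>2 else 0)"
proof (cases "e = f")
  case True
  then show ?thesis
    using \<xi>_variance[OF assms(1), of t] \<xi>_mean[OF assms(1), of t] by (simp add: power2_eq_square)
next
  case False
  have int: "integrable M (\<xi> e t)" if "e \<in> E_U" for e
    by (rule square_integrable_imp_integrable[OF \<xi>_measurable[OF that] \<xi>_square_integrable[OF that]])
  have "indep_vars (\<lambda>_. borel) (\<lambda>(e, t). \<xi> e t) {(e, t), (f, t)}"
    using assms by (intro indep_vars_subset[OF \<xi>_indep]) auto
  then have "(\<integral>\<omega>. (\<Prod>i\<in>{(e, t), (f, t)}. (\<lambda>(e, t). \<xi> e t) i \<omega>) \<partial>M)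
      = (\<Prod>i\<in>{(e, t), (f, t)}. \<integral>\<omega>. (\<lambda>(e, t). \<xi> e t) i \<omega> \<partial>M)"
  proof (rule indep_vars_lebesgue_integral[rotated])
    fix i assume "i \<in> {(e, t), (f, t)}"
    then have "i = (e, t) \<or> i = (f, t)"
      by simp
    then show "integrable M ((\<lambda>(e, t). \<xi> e t) i)"
      using int[OF assms(1)] int[OF assms(2)] by (elim disjE) simp_all
  qed simp
  moreover have "(e, t) \<noteq> (f, t)"
    using False by simp
  ultimately have "(\<integral>\<omega>. \<xi> e t \<omega> * \<xi> f t \<omega> \<partial>M) = (\<integral>\<omega>. \<xi> e t \<omega> \<partial>M) * (\<integral>\<omega>. \<xi> f t \<omega> \<partial>M)"
    by (simp only: prod.insert finite.intros empty_iff insert_iff prod.empty mult_1_right case_prod_conv simp_thms)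
  also have "\<dots> = 0"
    using \<xi>_mean[OF assms(1)] by simp
  finally show ?thesis
    using False by simp
qed

end

section \<open>Mean square contraction\<close>

text \<open>The hypothesis \<open>contraction\<close> is the one-step decrease of the energy after the link noise has been averaged
  out; it is a statement about deterministic node signals.\<close>

locale contracting_network =
  random_network M E \<mu> A B C G \<phi> E_U \<sigma> \<xi> v X + disagreement_basis U P
  for M :: "'w measure" and E \<mu> and A :: "real^'n^'n" and B :: "real^'m^'n" and C G \<phi> E_U \<sigma> \<xi> v
    and X :: "real^('v::{finite,linorder} \<times> 'n) \<Rightarrow> nat \<Rightarrow> 'w \<Rightarrow> real^('v \<times> 'n)"
    and U :: "(real^('v::{finite,linorder})) set" and P :: "real^'n^'n" +
  fixes \<rho> :: real
  assumes \<rho>: "0 < \<rho>" "\<rho> < 1"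
    and eig: "\<And>u. u \<in> U \<Longrightarrow> laplacian E \<mu> *v u = (u \<bullet> (laplacian E \<mu> *v u)) *\<^sub>R u"
    and contraction: "\<And>t x. (\<Sum>u\<in>U.
          (A *v mode u x - (u \<bullet> (laplacian E \<mu> *v u)) *\<^sub>R (G *v (C *v mode u x)) - B *v mode u (\<lambda>k. \<phi> t (C *v x k)))
          \<bullet> (P *v (A *v mode u x - (u \<bullet> (laplacian E \<mu> *v u)) *\<^sub>R (G *v (C *v mode u x))
                  - B *v mode u (\<lambda>k. \<phi> t (C *v x k)))))
        + 2 * (\<Sum>e\<in>E_U. (\<sigma> e)\<^sup>2 * (mode (ell e) (\<lambda>k. G *v (C *v x k)) \<bullet> (P *v mode (ell e) (\<lambda>k. G *v (C *v x k)))))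
        \<le> \<rho> * energy x"
begin

lemma mode_drift:
  assumes "u \<in> U"
  shows "mode u (drift x0 t \<omega>) = A *v mode u (state x0 t \<omega>)
    - (u \<bullet> (laplacian E \<mu> *v u)) *\<^sub>R (G *v (C *v mode u (state x0 t \<omega>))) - B *v mode u (\<lambda>k. \<phi> t (C *v state x0 t \<omega> k))"
proof -
  have "mode u (\<lambda>k. \<Sum>j\<in>UNIV. laplacian E \<mu> $ k $ j *\<^sub>R feedback x0 t \<omega> j) = mode (laplacian E \<mu> *v u) (feedback x0 t \<omega>)"
    unfolding mode_matrix E.laplacian_sym ..
  also have "\<dots> = (u \<bullet> (laplacian E \<mu> *v u)) *\<^sub>R mode u (feedback x0 t \<omega>)"
    by (subst eig[OF assms]) (rule mode_scaleR_left)
  also have "mode u (feedback x0 t \<omega>) = G *v (C *v mode u (state x0 t \<omega>))"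
    unfolding feedback_def[abs_def] by (simp add: linear_mode[OF matrix_vector_mul_linear])
  finally have "mode u (\<lambda>k. \<Sum>j\<in>UNIV. laplacian E \<mu> $ k $ j *\<^sub>R feedback x0 t \<omega> j)
      = (u \<bullet> (laplacian E \<mu> *v u)) *\<^sub>R (G *v (C *v mode u (state x0 t \<omega>)))" .
  then show ?thesis
    unfolding drift_def[abs_def] mode_diff by (simp only: linear_mode[OF matrix_vector_mul_linear])
qed

lemma mode_noiseless:
  "mode u (noiseless x0 t \<omega>)
    = mode u (drift x0 t \<omega>) - (\<Sum>e\<in>E_U. \<xi> e t \<omega> *\<^sub>R ((ell e \<bullet> u) *\<^sub>R mode (ell e) (feedback x0 t \<omega>)))"
  unfolding noiseless_def[abs_def] mode_diff mode_sum
  by (simp only: linear_mode[OF linear_scaleR, symmetric] mode_const)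

lemma sum_ell_inner_basis: "e \<in> E_U \<Longrightarrow> (\<Sum>u\<in>U. (ell e \<bullet> u)\<^sup>2) = 2"
proof -
  assume "e \<in> E_U"
  then have e: "e \<in> E"
    using E_U by auto
  have "ell e \<in> span U"
    using E.ell_orthogonal_one[OF e] by (simp add: U(4))
  then have "ell e \<bullet> ell e = (\<Sum>u\<in>U. (u \<bullet> ell e) * (u \<bullet> ell e))"
    using inner_orthonormal_expansion[OF U(1,2)] U(3) by blast
  then show ?thesis
    using E.norm_ell[OF e] by (simp add: power2_eq_square inner_commute)
qed

text \<open>Averaging first over the current link noise, which is independent of the state, leaves the drift
  energy plus the variance terms of \<open>contraction\<close>; the factor \<open>2\<close> arises by summing \<open>(ell e \<bullet> u)\<^sup>2\<close> over the modes.\<close>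

lemma expected_energy_noiseless_le:
  "(\<integral>\<omega>. energy (noiseless x0 t \<omega>) \<partial>M) \<le> \<rho> * (\<integral>\<omega>. energy (state x0 t \<omega>) \<partial>M)"
proof (rule state_independent_of_current_noise[of t])
  fix N\<^sub>1 N\<^sub>2
  assume N: "space N\<^sub>1 = space M" "space N\<^sub>2 = space M" "indep_set (sets N\<^sub>1) (sets N\<^sub>2)"
    "\<And>e. e \<in> E_U \<Longrightarrow> \<xi> e t \<in> borel_measurable N\<^sub>1"
    "\<And>x0 k. (\<lambda>\<omega>. state x0 t \<omega> k) \<in> borel_measurable N\<^sub>2"
  define a where "a u \<omega> = mode u (drift x0 t \<omega>)" for u \<omega>
  define d where "d e \<omega> = mode (ell e) (feedback x0 t \<omega>)" for e \<omega>
  have a: "a u \<in> borel_measurable N\<^sub>2" "square_integrable M (a u)" for u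
    unfolding a_def by (intro mode_measurable drift_measurable N(5))
      (intro mode_square_integrable drift_square_integrable state_square_integrable)
  have d: "d e \<in> borel_measurable N\<^sub>2" "square_integrable M (d e)" for e
    unfolding d_def by (intro mode_measurable feedback_measurable N(5))
      (intro mode_square_integrable feedback_square_integrable state_square_integrable)
  have single: "(\<integral>\<omega>. mode u (noiseless x0 t \<omega>) \<bullet> (P *v mode u (noiseless x0 t \<omega>)) \<partial>M)
      = (\<integral>\<omega>. a u \<omega> \<bullet> (P *v a u \<omega>) \<partial>M)
        + (\<Sum>e\<in>E_U. (\<sigma> e)\<^sup>2 * ((ell e \<bullet> u)\<^sup>2 * (\<integral>\<omega>. d e \<omega> \<bullet> (P *v d e \<omega>) \<partial>M)))" for u
  proof -
    have "(\<integral>\<omega>. mode u (noiseless x0 t \<omega>) \<bullet> (P *v mode u (noiseless x0 t \<omega>)) \<partial>M)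
      = (\<integral>\<omega>. a u \<omega> \<bullet> (P *v a u \<omega>) \<partial>M)
        + (\<Sum>e\<in>E_U. (\<sigma> e)\<^sup>2 * (\<integral>\<omega>. ((ell e \<bullet> u) *\<^sub>R d e \<omega>) \<bullet> (P *v ((ell e \<bullet> u) *\<^sub>R d e \<omega>)) \<partial>M))"
      unfolding mode_noiseless a_def[symmetric] d_def[symmetric]
      by (rule expectation_form_noise[OF P_sym finite_E_U N(1-3)])
        (auto intro: N(4) \<xi>_L2 a d(1) \<xi>_mean borel_measurable_scaleR square_integrable_linear[OF linear_scaleR d(2)]
          simp: \<xi>_covariance simp del: split_paired_All)
    then show ?thesis
      by (simp add: matrix_vector_mult_scaleR power2_eq_square mult.assoc)
  qed
  have int: "integrable M (\<lambda>\<omega>. mode u (noiseless x0 t \<omega>) \<bullet> (P *v mode u (noiseless x0 t \<omega>)))" for u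
    by (intro integrable_form mode_square_integrable noiseless_square_integrable)
  have "(\<integral>\<omega>. energy (noiseless x0 t \<omega>) \<partial>M)
      = (\<Sum>u\<in>U. \<integral>\<omega>. a u \<omega> \<bullet> (P *v a u \<omega>) \<partial>M)
        + (\<Sum>u\<in>U. \<Sum>e\<in>E_U. (\<sigma> e)\<^sup>2 * ((ell e \<bullet> u)\<^sup>2 * (\<integral>\<omega>. d e \<omega> \<bullet> (P *v d e \<omega>) \<partial>M)))"
    unfolding energy_def by (simp add: int single sum.distrib)
  also have "(\<Sum>u\<in>U. \<Sum>e\<in>E_U. (\<sigma> e)\<^sup>2 * ((ell e \<bullet> u)\<^sup>2 * (\<integral>\<omega>. d e \<omega> \<bullet> (P *v d e \<omega>) \<partial>M)))
      = (\<Sum>e\<in>E_U. (\<sigma> e)\<^sup>2 * ((\<Sum>u\<in>U. (ell e \<bullet> u)\<^sup>2) * (\<integral>\<omega>. d e \<omega> \<bullet> (P *v d e \<omega>) \<partial>M)))"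
    by (subst sum.swap) (simp add: sum_distrib_left sum_distrib_right)
  also have "\<dots> = 2 * (\<Sum>e\<in>E_U. (\<sigma> e)\<^sup>2 * (\<integral>\<omega>. d e \<omega> \<bullet> (P *v d e \<omega>) \<partial>M))"
    unfolding sum_distrib_left by (intro sum.cong refl) (simp only: sum_ell_inner_basis mult.left_commute)
  also have "(\<Sum>u\<in>U. \<integral>\<omega>. a u \<omega> \<bullet> (P *v a u \<omega>) \<partial>M) + \<dots>
      = (\<integral>\<omega>. (\<Sum>u\<in>U. a u \<omega> \<bullet> (P *v a u \<omega>)) + 2 * (\<Sum>e\<in>E_U. (\<sigma> e)\<^sup>2 * (d e \<omega> \<bullet> (P *v d e \<omega>))) \<partial>M)"
    by (simp add: integrable_form[OF a(2) a(2)] integrable_form[OF d(2) d(2)])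
  also have "\<dots> \<le> (\<integral>\<omega>. \<rho> * energy (state x0 t \<omega>) \<partial>M)"
  proof (rule integral_mono)
    show "integrable M (\<lambda>\<omega>. \<rho> * energy (state x0 t \<omega>))"
      by (intro integrable_mult_right integrable_energy prob_space_axioms state_square_integrable)
    show "integrable M (\<lambda>\<omega>. (\<Sum>u\<in>U. a u \<omega> \<bullet> (P *v a u \<omega>)) + 2 * (\<Sum>e\<in>E_U. (\<sigma> e)\<^sup>2 * (d e \<omega> \<bullet> (P *v d e \<omega>))))"
      by (simp add: integrable_form[OF a(2) a(2)] integrable_form[OF d(2) d(2)])
    fix \<omega>
    have "(\<Sum>u\<in>U. a u \<omega> \<bullet> (P *v a u \<omega>)) = (\<Sum>u\<in>U.
        (A *v mode u (state x0 t \<omega>) - (u \<bullet> (laplacian E \<mu> *v u)) *\<^sub>R (G *v (C *v mode u (state x0 t \<omega>)))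
            - B *v mode u (\<lambda>k. \<phi> t (C *v state x0 t \<omega> k)))
          \<bullet> (P *v (A *v mode u (state x0 t \<omega>) - (u \<bullet> (laplacian E \<mu> *v u)) *\<^sub>R (G *v (C *v mode u (state x0 t \<omega>)))
                  - B *v mode u (\<lambda>k. \<phi> t (C *v state x0 t \<omega> k)))))"
      by (intro sum.cong refl) (simp only: a_def mode_drift)
    then show "(\<Sum>u\<in>U. a u \<omega> \<bullet> (P *v a u \<omega>)) + 2 * (\<Sum>e\<in>E_U. (\<sigma> e)\<^sup>2 * (d e \<omega> \<bullet> (P *v d e \<omega>)))
        \<le> \<rho> * energy (state x0 t \<omega>)"
      using contraction[of "state x0 t \<omega>" t] by (simp only: d_def feedback_def[abs_def])
  qed
  finally show ?thesis
    by simp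
qed

text \<open>The additive noise may be correlated in time, and so with the state; Young's inequality
  trades this for an arbitrarily small loss in the contraction rate.\<close>

lemma expected_energy_Suc_le:
  assumes "\<eta> > 0"
  shows "(\<integral>\<omega>. energy (state x0 (Suc t) \<omega>) \<partial>M)
    \<le> (1 + \<eta>) * \<rho> * (\<integral>\<omega>. energy (state x0 t \<omega>) \<partial>M)
      + (1 + 1 / \<eta>) * (\<integral>\<omega>. energy (\<lambda>k. block k (v t \<omega>)) \<partial>M)"
proof -
  have n: "integrable M (\<lambda>\<omega>. energy (noiseless x0 t \<omega>))"
    by (intro integrable_energy prob_space_axioms noiseless_square_integrable)
  have w: "integrable M (\<lambda>\<omega>. energy (\<lambda>k. block k (v t \<omega>)))"
    by (intro integrable_energy prob_space_axioms v_L2)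
  have "(\<integral>\<omega>. energy (state x0 (Suc t) \<omega>) \<partial>M)
      \<le> (\<integral>\<omega>. (1 + \<eta>) * energy (noiseless x0 t \<omega>) + (1 + 1 / \<eta>) * energy (\<lambda>k. block k (v t \<omega>)) \<partial>M)"
  proof (rule integral_mono)
    show "integrable M (\<lambda>\<omega>. energy (state x0 (Suc t) \<omega>))"
      by (intro integrable_energy prob_space_axioms state_square_integrable)
    show "integrable M (\<lambda>\<omega>. (1 + \<eta>) * energy (noiseless x0 t \<omega>) + (1 + 1 / \<eta>) * energy (\<lambda>k. block k (v t \<omega>)))"
      using n w by (intro Bochner_Integration.integrable_add integrable_mult_right)
    show "energy (state x0 (Suc t) \<omega>)
        \<le> (1 + \<eta>) * energy (noiseless x0 t \<omega>) + (1 + 1 / \<eta>) * energy (\<lambda>k. block k (v t \<omega>))" for \<omega>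
      unfolding state_Suc by (rule energy_young[OF assms])
  qed
  also have "\<dots> = (1 + \<eta>) * (\<integral>\<omega>. energy (noiseless x0 t \<omega>) \<partial>M)
      + (1 + 1 / \<eta>) * (\<integral>\<omega>. energy (\<lambda>k. block k (v t \<omega>)) \<partial>M)"
    using n w by (subst Bochner_Integration.integral_add) (simp_all del: distrib_right_numeral)
  also have "\<dots> \<le> (1 + \<eta>) * (\<rho> * (\<integral>\<omega>. energy (state x0 t \<omega>) \<partial>M))
      + (1 + 1 / \<eta>) * (\<integral>\<omega>. energy (\<lambda>k. block k (v t \<omega>)) \<partial>M)"
    using assms by (intro add_right_mono mult_left_mono expected_energy_noiseless_le) auto
  finally show ?thesis
    by (simp only: mult.assoc)
qed

lemma energy_le_norm:
  assumes k: "\<And>x. x \<bullet> (P *v x) \<le> \<kappa> * (norm x)\<^sup>2" and \<kappa>: "\<kappa> \<ge> 0"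
  shows "energy x \<le> 2 * \<kappa> * (\<Sum>i\<in>UNIV. (norm (x i))\<^sup>2)"
proof -
  have sq: "(norm (a - b))\<^sup>2 \<le> 2 * (norm a)\<^sup>2 + 2 * (norm b)\<^sup>2" for a b :: "real^'n"
    using zero_le_power2[of "norm (a + b)"] unfolding power2_norm_eq_inner
    by (simp add: inner_add_left inner_add_right inner_diff_left inner_diff_right inner_commute)
  have "(\<Sum>i\<in>UNIV. \<Sum>l\<in>UNIV. (norm (x i - x l))\<^sup>2) \<le> (\<Sum>i\<in>(UNIV :: 'v set). \<Sum>l\<in>(UNIV :: 'v set). 2 * (norm (x i))\<^sup>2 + 2 * (norm (x l))\<^sup>2)"
    by (intro sum_mono sq)
  also have "\<dots> = 4 * real CARD('v) * (\<Sum>i\<in>UNIV. (norm (x i))\<^sup>2)"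
    by (simp add: sum.distrib sum_distrib_left[symmetric])
  finally have "(\<Sum>i\<in>UNIV. \<Sum>l\<in>UNIV. (norm (x i - x l))\<^sup>2) \<le> 4 * real CARD('v) * (\<Sum>i\<in>UNIV. (norm (x i))\<^sup>2)" .
  then have "\<kappa> / (2 * real CARD('v)) * (\<Sum>i\<in>UNIV. \<Sum>l\<in>UNIV. (norm (x i - x l))\<^sup>2)
      \<le> \<kappa> / (2 * real CARD('v)) * (4 * real CARD('v) * (\<Sum>i\<in>UNIV. (norm (x i))\<^sup>2))"
    using \<kappa> by (intro mult_left_mono) auto
  then show ?thesis
    using energy_le[OF k, of x] by simp
qed

lemma expected_norm_noise_le:
  assumes cov: "\<And>a. (\<integral>\<omega>. v t \<omega> $ a * v t \<omega> $ a \<partial>M) = R $ a $ a"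
  shows "(\<integral>\<omega>. (norm (v t \<omega>))\<^sup>2 \<partial>M) \<le> real CARD('v \<times> 'n) * onorm ((*v) R)"
proof -
  have int: "integrable M (\<lambda>\<omega>. v t \<omega> $ a * v t \<omega> $ a)" for a
  proof -
    have "square_integrable M (\<lambda>\<omega>. v t \<omega> $ a)"
      by (rule square_integrable_linear[OF bounded_linear.linear[OF bounded_linear_vec_nth]])
        (simp add: square_integrable_def v_measurable v_square_integrable)
    then show ?thesis
      by (simp add: square_integrable_def power2_eq_square)
  qed
  have "(\<integral>\<omega>. (norm (v t \<omega>))\<^sup>2 \<partial>M) = (\<Sum>a\<in>UNIV. R $ a $ a)"
    by (simp add: power2_norm_eq_inner inner_vec_def int cov)
  also have "\<dots> \<le> (\<Sum>a\<in>(UNIV :: ('v \<times> 'n) set). onorm ((*v) R))"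
    by (intro sum_mono order_trans[OF abs_ge_self matrix_component_le_onorm])
  finally show ?thesis
    by simp
qed

text \<open>Iterating the one-step bound is a geometric series: the initial energy decays like \<open>\<beta> ^ t\<close>, and the noise
  contributes at most a multiple of its second moment. The energy is comparable with the sum of
  the squared differences of all pairs.\<close>

lemma exponential_synchronization:
  assumes cov: "\<And>t a. (\<integral>\<omega>. v t \<omega> $ a * v t \<omega> $ a \<partial>M) = R $ a $ a"
  shows "mean_square_exp_sync M X R"
proof -
  define N where "N = real CARD('v)"
  have N: "N > 0"
    by (simp add: N_def)
  obtain r where r: "r > 0" "\<And>x. r * (norm x)\<^sup>2 \<le> x \<bullet> (P *v x)"
    using pos_def_ge[OF P] by blast
  obtain \<kappa> where \<kappa>: "\<kappa> > 0" "\<And>x. x \<bullet> (P *v x) \<le> \<kappa> * (norm x)\<^sup>2"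
    using quadratic_form_le[of P] by blast
  \<comment> \<open>half of the contraction margin is spent on the additive noise\<close>
  define \<eta> where "\<eta> = (1 - \<rho>) / 2"
  define \<beta> where "\<beta> = (1 + \<eta>) * \<rho>"
  define h where "h = (1 + 1 / \<eta>) * (2 * \<kappa> * (real CARD('v \<times> 'n) * onorm ((*v) R)))"
  have \<eta>: "\<eta> > 0"
    using \<rho> by (simp add: \<eta>_def)
  have \<beta>: "0 < \<beta>" "\<beta> < 1"
  proof -
    show "0 < \<beta>"
      using \<eta> \<rho> by (simp add: \<beta>_def)
    have "0 < (1 - \<rho>) * (2 - \<rho>)"
      using \<rho> by (intro mult_pos_pos) auto
    then show "\<beta> < 1"
      by (simp add: \<beta>_def \<eta>_def field_simps)
  qed
  have onorm: "onorm ((*v) R) \<ge> 0"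
    by (intro onorm_pos_le matrix_vector_mul_bounded_linear)
  have h: "h \<ge> 0"
    unfolding h_def using \<eta> \<kappa>(1) onorm by (intro mult_nonneg_nonneg) auto
  define m where "m x0 t = (\<integral>\<omega>. energy (state x0 t \<omega>) \<partial>M)" for x0 t
  have noise: "(1 + 1 / \<eta>) * (\<integral>\<omega>. energy (\<lambda>k. block k (v t \<omega>)) \<partial>M) \<le> h" for t
  proof -
    have "(\<integral>\<omega>. energy (\<lambda>k. block k (v t \<omega>)) \<partial>M) \<le> (\<integral>\<omega>. 2 * \<kappa> * (norm (v t \<omega>))\<^sup>2 \<partial>M)"
    proof (rule integral_mono)
      show "integrable M (\<lambda>\<omega>. energy (\<lambda>k. block k (v t \<omega>)))"
        by (intro integrable_energy prob_space_axioms v_L2)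
      show "integrable M (\<lambda>\<omega>. 2 * \<kappa> * (norm (v t \<omega>))\<^sup>2)"
        by (intro integrable_mult_right v_square_integrable)
      show "energy (\<lambda>k. block k (v t \<omega>)) \<le> 2 * \<kappa> * (norm (v t \<omega>))\<^sup>2" for \<omega>
        using energy_le_norm[OF \<kappa>(2), of "\<lambda>k. block k (v t \<omega>)"] \<kappa>(1) by (simp add: sum_norm_block)
    qed
    also have "\<dots> = 2 * \<kappa> * (\<integral>\<omega>. (norm (v t \<omega>))\<^sup>2 \<partial>M)"
      by simp
    also have "\<dots> \<le> 2 * \<kappa> * (real CARD('v \<times> 'n) * onorm ((*v) R))"
      using \<kappa>(1) by (intro mult_left_mono expected_norm_noise_le cov) auto
    finally show ?thesis
      unfolding h_def using \<eta> by (intro mult_left_mono) auto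
  qed
  have m_le: "m x0 t \<le> \<beta> ^ t * m x0 0 + h / (1 - \<beta>)" for x0 t
  proof (induction t)
    case 0
    then show ?case using h \<beta> by simp
  next
    case (Suc t)
    have "m x0 (Suc t) \<le> \<beta> * m x0 t + h"
      using expected_energy_Suc_le[OF \<eta>, of x0 t] noise[of t] by (simp add: m_def \<beta>_def)
    also have "\<dots> \<le> \<beta> * (\<beta> ^ t * m x0 0 + h / (1 - \<beta>)) + h"
      using Suc \<beta>(1) by (simp add: mult_left_mono)
    also have "\<dots> = \<beta> ^ Suc t * m x0 0 + h / (1 - \<beta>)"
      using \<beta>(2) by (simp add: field_simps)
    finally show ?case .
  qed
  have m_0: "m x0 0 \<le> \<kappa> / (2 * N) * (\<Sum>i\<in>UNIV. \<Sum>l\<in>UNIV. initial_differences x0 i l)" for x0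
    using energy_le[OF \<kappa>(2), of "\<lambda>k. block k x0"] by (simp add: m_def initial prob_space initial_differences_def N_def)
  define c where "c = 2 * N / r * ((1 + 1 / \<eta>) * (2 * \<kappa> * real CARD('v \<times> 'n)) / (1 - \<beta>)) + 1"
  have c: "c > 0"
    unfolding c_def using N r(1) \<eta> \<kappa>(1) \<beta>(2) by (intro add_nonneg_pos mult_nonneg_nonneg divide_nonneg_nonneg) auto
  have c_onorm: "2 * N / r * (h / (1 - \<beta>)) \<le> c * onorm ((*v) R)"
    unfolding c_def h_def using onorm by (simp add: algebra_simps)
  have int: "integrable M (\<lambda>\<omega>. (norm (block k (X x0 t \<omega>) - block j (X x0 t \<omega>)))\<^sup>2)" for x0 k j t
  proof -
    have "square_integrable M (\<lambda>\<omega>. block k (X x0 t \<omega>) - block j (X x0 t \<omega>))"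
      by (intro square_integrable_diff state_square_integrable)
    then show ?thesis
      by (simp add: square_integrable_def)
  qed
  show ?thesis
  proof (rule mean_square_exp_syncI[OF \<beta> c])
    show "0 < \<kappa> / r"
      using \<kappa>(1) r(1) by simp
    show "integrable M (\<lambda>\<omega>. (norm (block k (X x0 t \<omega>) - block j (X x0 t \<omega>)))\<^sup>2)" for x0 k j t
      by (rule int)
    show "(\<integral>\<omega>. (norm (block k (X x0 t \<omega>) - block j (X x0 t \<omega>)))\<^sup>2 \<partial>M)
        \<le> \<kappa> / r * \<beta> ^ t * (\<Sum>i\<in>UNIV. \<Sum>l\<in>UNIV. initial_differences x0 i l) + c * onorm ((*v) R)" for x0 k j t
    proof -
      have "(\<integral>\<omega>. (norm (block k (X x0 t \<omega>) - block j (X x0 t \<omega>)))\<^sup>2 \<partial>M)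
          \<le> (\<integral>\<omega>. 2 * N / r * energy (state x0 t \<omega>) \<partial>M)"
      proof (rule integral_mono[OF int])
        show "integrable M (\<lambda>\<omega>. 2 * N / r * energy (state x0 t \<omega>))"
          by (intro integrable_mult_right integrable_energy prob_space_axioms state_square_integrable)
        show "(norm (block k (X x0 t \<omega>) - block j (X x0 t \<omega>)))\<^sup>2 \<le> 2 * N / r * energy (state x0 t \<omega>)" for \<omega>
          using energy_ge[OF r(2), of "state x0 t \<omega>" k j] r(1) by (simp add: N_def field_simps)
      qed
      also have "\<dots> = 2 * N / r * m x0 t"
        by (simp add: m_def)
      also have "\<dots> \<le> 2 * N / r * (\<beta> ^ t * (\<kappa> / (2 * N) * (\<Sum>i\<in>UNIV. \<Sum>l\<in>UNIV. initial_differences x0 i l)) + h / (1 - \<beta>))"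
      proof (rule mult_left_mono)
        have "\<beta> ^ t * m x0 0 \<le> \<beta> ^ t * (\<kappa> / (2 * N) * (\<Sum>i\<in>UNIV. \<Sum>l\<in>UNIV. initial_differences x0 i l))"
          using \<beta>(1) by (intro mult_left_mono m_0) auto
        then show "m x0 t \<le> \<beta> ^ t * (\<kappa> / (2 * N) * (\<Sum>i\<in>UNIV. \<Sum>l\<in>UNIV. initial_differences x0 i l)) + h / (1 - \<beta>)"
          using m_le[of x0 t] by linarith
      qed (use N r(1) in simp)
      also have "\<dots> = \<kappa> / r * \<beta> ^ t * (\<Sum>i\<in>UNIV. \<Sum>l\<in>UNIV. initial_differences x0 i l) + 2 * N / r * (h / (1 - \<beta>))"
        using N by (simp add: distrib_left)
      finally show ?thesis
        using c_onorm by linarith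
    qed
  qed
qed

end

section \<open>Synchronization from the Riccati equations\<close>

theorem theorem19:
  fixes M :: "'w measure"
    and A :: "real^'n^'n" and B :: "real^'m^'n" and C :: "real^'n^'m" and G :: "real^'m^'n"
    and \<phi> :: "nat \<Rightarrow> real^'m \<Rightarrow> real^'m"
    and D D\<^sub>1 \<Sigma>\<^sub>1 :: "real^'m^'m"
    and E E_U :: "('v::{finite,linorder} \<times> 'v) set"
    and \<mu> :: "'v \<Rightarrow> 'v \<Rightarrow> real" and \<sigma> :: "'v \<times> 'v \<Rightarrow> real"
    and \<xi> :: "'v \<times> 'v \<Rightarrow> nat \<Rightarrow> 'w \<Rightarrow> real"
    and v :: "nat \<Rightarrow> 'w \<Rightarrow> real^('v \<times> 'n)" and R\<^sub>v :: "real^('v \<times> 'n)^('v \<times> 'n)"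
    and X :: "real^('v \<times> 'n) \<Rightarrow> nat \<Rightarrow> 'w \<Rightarrow> real^('v \<times> 'n)"
  defines "L \<equiv> laplacian E \<mu>"
    and "L_d \<equiv> laplacian (E - E_U) \<mu>"
    and "L_u \<equiv> laplacian E_U \<mu>"
  defines "lam2 \<equiv> ordered_eigenvalue 2 L"
    and "lamN \<equiv> ordered_eigenvalue CARD('v) L"
    and "lamN_u \<equiv> ordered_eigenvalue CARD('v) L_u"
    and "lam2_d \<equiv> ordered_eigenvalue 2 L_d"
  defines "\<tau> \<equiv> lamN_u / (lamN_u + lam2_d)"
    and "\<gamma> \<equiv> Max ((\<lambda>(i, j). (\<sigma> (i, j))\<^sup>2 / \<mu> i j) ` E_U)"
    and "A\<^sub>0 \<equiv> A - B ** matrix_inv \<Sigma>\<^sub>1 ** C"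
  assumes lipschitz: "\<And>t. \<exists>K. K-lipschitz_on UNIV (\<phi> t)"
    and C1: "\<And>t. \<exists>J :: real^'m \<Rightarrow> real^'m^'m. continuous_on UNIV J \<and>
               (\<forall>y. (\<phi> t has_derivative (\<lambda>h. J y *v h)) (at y))"
    and monotone: "\<And>t y y'. (\<phi> t y - \<phi> t y') \<bullet> (y - y') \<ge> 0"
    and sector: "\<And>t y. y \<noteq> 0 \<Longrightarrow> \<phi> t y \<bullet> (y - D *v \<phi> t y) > 0"
    and sector_0: "\<And>t. \<phi> t 0 \<bullet> (0 - D *v \<phi> t 0) \<ge> 0"
    and Sigma1: "\<Sigma>\<^sub>1 = D\<^sub>1 + transpose D\<^sub>1" "pos_def \<Sigma>\<^sub>1"
    and incremental_sector: "\<And>t y y'. y \<noteq> y' \<Longrightarrow>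
          (\<phi> t y - \<phi> t y') \<bullet> ((y - y') - D\<^sub>1 *v (\<phi> t y - \<phi> t y')) > 0"
    and edges: "\<And>i j. (i, j) \<in> E \<Longrightarrow> i > j" "E_U \<subseteq> E" "E_U \<noteq> {}"
    and weights: "\<And>i j. \<mu> i j = \<mu> j i" "\<And>i j. (i, j) \<in> E \<Longrightarrow> \<mu> i j > 0"
    and connected: "0 < lam2"
    and prob_space: "prob_space M"
    and \<xi>_indep: "prob_space.indep_vars M (\<lambda>_. borel) (\<lambda>(e, t). \<xi> e t) (E_U \<times> UNIV)"
    and \<xi>_identical: "\<And>e s t. e \<in> E_U \<Longrightarrow> distr M borel (\<xi> e s) = distr M borel (\<xi> e t)"
    and \<xi>_square_integrable: "\<And>e t. e \<in> E_U \<Longrightarrow> integrable M (\<lambda>\<omega>. (\<xi> e t \<omega>)\<^sup>2)"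
    and \<xi>_mean: "\<And>e t. e \<in> E_U \<Longrightarrow> prob_space.expectation M (\<xi> e t) = 0"
    and \<xi>_variance: "\<And>e t. e \<in> E_U \<Longrightarrow> prob_space.variance M (\<xi> e t) = (\<sigma> e)\<^sup>2"
    and v_measurable: "\<And>t. v t \<in> borel_measurable M"
    and v_square_integrable: "\<And>t. integrable M (\<lambda>\<omega>. (norm (v t \<omega>))\<^sup>2)"
    and v_mean: "\<And>t. prob_space.expectation M (v t) = 0"
    and v_covariance: "\<And>t a b. prob_space.expectation M (\<lambda>\<omega>. v t \<omega> $ a * v t \<omega> $ b) = R\<^sub>v $ a $ b"
    and \<xi>_v_indep: "prob_space.indep_set M
          (sets (vimage_algebra (space M) (\<lambda>\<omega>. \<lambda>(e, t)\<in>E_U \<times> UNIV. \<xi> e t \<omega>)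
             (Pi\<^sub>M (E_U \<times> UNIV) (\<lambda>_. borel))))
          (sets (vimage_algebra (space M) (\<lambda>\<omega> t. v t \<omega>) (Pi\<^sub>M UNIV (\<lambda>_. borel))))"
    and initial: "\<And>x0 \<omega>. X x0 0 \<omega> = x0"
    and dynamics: "\<And>x0 t \<omega>. X x0 (Suc t) \<omega> =
          (mat 1 \<otimes>\<^sub>K A - random_laplacian E E_U \<mu> (\<lambda>e. \<xi> e t \<omega>) \<otimes>\<^sub>K (G ** C)) *v X x0 t \<omega>
          - (mat 1 \<otimes>\<^sub>K B) *v stacked (\<phi> t) ((mat 1 \<otimes>\<^sub>K C) *v X x0 t \<omega>)
          + v t \<omega>"
    and riccati: "\<exists>P. pos_def P \<and> pos_def (\<Sigma>\<^sub>1 - transpose B ** P ** B) \<and>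
          (\<forall>lam\<in>{lam2, lamN}. \<exists>R. pos_def R \<and>
             P = transpose (A\<^sub>0 - lam *\<^sub>R (G ** C)) ** P ** (A\<^sub>0 - lam *\<^sub>R (G ** C))
               + transpose (A\<^sub>0 - lam *\<^sub>R (G ** C)) ** P ** B
                   ** matrix_inv (\<Sigma>\<^sub>1 - transpose B ** P ** B)
                   ** transpose B ** P ** (A\<^sub>0 - lam *\<^sub>R (G ** C))
               + (2 * \<gamma> * \<tau> * lam) *\<^sub>R
                   (transpose C ** transpose G ** P ** G ** C
                    + transpose C ** transpose G ** P ** B
                        ** matrix_inv (\<Sigma>\<^sub>1 - transpose B ** P ** B)
                        ** transpose B ** P ** G ** C)
               + transpose C ** matrix_inv \<Sigma>\<^sub>1 ** C + R)"
  shows "mean_square_exp_sync M X R\<^sub>v"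
proof -
  interpret prob_space M by (rule prob_space)
  interpret E: weighted_graph E \<mu>
    by unfold_locales (fact edges weights)+
  obtain P where P: "pos_def P" "pos_def (\<Sigma>\<^sub>1 - transpose B ** P ** B)"
    and ric: "\<forall>lam\<in>{lam2, lamN}. \<exists>R. pos_def R \<and>
             P = transpose (A\<^sub>0 - lam *\<^sub>R (G ** C)) ** P ** (A\<^sub>0 - lam *\<^sub>R (G ** C))
               + transpose (A\<^sub>0 - lam *\<^sub>R (G ** C)) ** P ** B
                   ** matrix_inv (\<Sigma>\<^sub>1 - transpose B ** P ** B)
                   ** transpose B ** P ** (A\<^sub>0 - lam *\<^sub>R (G ** C))
               + (2 * \<gamma> * \<tau> * lam) *\<^sub>R
                   (transpose C ** transpose G ** P ** G ** C
                    + transpose C ** transpose G ** P ** B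
                        ** matrix_inv (\<Sigma>\<^sub>1 - transpose B ** P ** B)
                        ** transpose B ** P ** G ** C)
               + transpose C ** matrix_inv \<Sigma>\<^sub>1 ** C + R"
    using riccati by (elim exE conjE) (rule that)
  \<comment> \<open>the maximum defining \<open>\<gamma>\<close> ranges over a nonempty set because there is an uncertain link\<close>
  have \<gamma>: "0 \<le> \<gamma>" "\<And>e. e \<in> E_U \<Longrightarrow> (\<sigma> e)\<^sup>2 \<le> \<gamma> * \<mu> (fst e) (snd e)"
  proof -
    have le: "(\<sigma> e)\<^sup>2 / \<mu> (fst e) (snd e) \<le> \<gamma>" if "e \<in> E_U" for e
      unfolding \<gamma>_def using that
      by (intro Max_ge finite_imageI) (auto simp: case_prod_beta intro: rev_image_eqI)
    have pos: "\<mu> (fst e) (snd e) > 0" if "e \<in> E_U" for e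
      using E.edge_weight_pos edges(2) that by blast
    show "(\<sigma> e)\<^sup>2 \<le> \<gamma> * \<mu> (fst e) (snd e)" if "e \<in> E_U" for e
      using le[OF that] pos[OF that] by (simp add: pos_divide_le_eq)
    obtain e where "e \<in> E_U"
      using edges(3) by auto
    then show "0 \<le> \<gamma>"
      using order_trans[OF divide_nonneg_pos[OF zero_le_power2 pos] le] by blast
  qed
  interpret E_U: weighted_graph E_U \<mu>
    using edges(2) E.oriented E.weight_sym E.weight_pos by unfold_locales auto
  have \<tau>: "0 \<le> \<tau>" "\<And>x. x \<bullet> (L_u *v x) \<le> \<tau> * (x \<bullet> (L *v x))"
    unfolding \<tau>_def lamN_u_def lam2_d_def L_d_def L_u_def L_def
    by (rule uncertain_laplacian_le[OF E.weighted_graph_axioms edges(2,3)])+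
  have c: "0 \<le> 2 * \<gamma> * \<tau>"
    using \<gamma>(1) \<tau>(1) by simp
  have lo: "0 \<le> lam2"
    using connected by simp
  obtain \<rho> where \<rho>: "0 < \<rho>" "\<rho> < 1"
    and mode_contraction: "\<And>lam x p. lam2 \<le> lam \<Longrightarrow> lam \<le> lamN \<Longrightarrow>
      (let x' = A *v x - lam *\<^sub>R (G *v (C *v x)) - B *v p; z = G *v (C *v x) in
        x' \<bullet> (P *v x') + 2 * \<gamma> * \<tau> * lam * (z \<bullet> (P *v z)) + (2 * (p \<bullet> (C *v x)) - p \<bullet> (\<Sigma>\<^sub>1 *v p))
          \<le> \<rho> * (x \<bullet> (P *v x)))"
  proof (rule riccati_mode_contraction[OF Sigma1(2) P c lo ric[unfolded A\<^sub>0_def]])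
    fix r
    assume "0 < r" "r < 1"
      and "\<And>lam x p. lam2 \<le> lam \<Longrightarrow> lam \<le> lamN \<Longrightarrow>
      (let x' = A *v x - lam *\<^sub>R (G *v (C *v x)) - B *v p; z = G *v (C *v x) in
        x' \<bullet> (P *v x') + 2 * \<gamma> * \<tau> * lam * (z \<bullet> (P *v z)) + (2 * (p \<bullet> (C *v x)) - p \<bullet> (\<Sigma>\<^sub>1 *v p))
          \<le> r * (x \<bullet> (P *v x)))"
    from that[OF this] show thesis .
  qed
  obtain U where U: "finite U" "pairwise orthogonal U" "\<And>u. u \<in> U \<Longrightarrow> norm u = 1"
    "span U = {x. 1 \<bullet> x = 0}"
    and eig: "\<And>u. u \<in> U \<Longrightarrow> laplacian E \<mu> *v u = (u \<bullet> (laplacian E \<mu> *v u)) *\<^sub>R u"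
    and ge: "\<And>u. u \<in> U \<Longrightarrow> ordered_eigenvalue 2 (laplacian E \<mu>) \<le> u \<bullet> (laplacian E \<mu> *v u)"
    and le: "\<And>u. u \<in> U \<Longrightarrow> u \<bullet> (laplacian E \<mu> *v u) \<le> ordered_eigenvalue CARD('v) (laplacian E \<mu>)"
    using E.disagreement_eigenbasis by blast
  have lam2: "lam2 \<le> u \<bullet> (L *v u)" and lamN: "u \<bullet> (L *v u) \<le> lamN" if "u \<in> U" for u
    unfolding lam2_def lamN_def L_def using that by (rule ge, rule le)
  interpret disagreement_basis U P
    using U P(1) by unfold_locales
  have L_u_le: "(\<Sum>e\<in>E_U. \<mu> (fst e) (snd e) * (ell e \<bullet> x)\<^sup>2) \<le> \<tau> * (\<Sum>u\<in>U. (u \<bullet> (L *v u)) * (u \<bullet> x)\<^sup>2)" for x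
    using \<tau>(2)[of x] E.laplacian_form_eigenbasis[OF U eig, of x]
    unfolding L_u_def E_U.laplacian_form L_def by simp
  interpret contracting_network M E \<mu> A B C G \<phi> E_U \<sigma> \<xi> v X U P \<rho>
  proof
    fix t and x :: "'v \<Rightarrow> real^'n"
    show "(\<Sum>u\<in>U.
          (A *v mode u x - (u \<bullet> (laplacian E \<mu> *v u)) *\<^sub>R (G *v (C *v mode u x)) - B *v mode u (\<lambda>k. \<phi> t (C *v x k)))
          \<bullet> (P *v (A *v mode u x - (u \<bullet> (laplacian E \<mu> *v u)) *\<^sub>R (G *v (C *v mode u x))
                  - B *v mode u (\<lambda>k. \<phi> t (C *v x k)))))
        + 2 * (\<Sum>e\<in>E_U. (\<sigma> e)\<^sup>2 * (mode (ell e) (\<lambda>k. G *v (C *v x k)) \<bullet> (P *v mode (ell e) (\<lambda>k. G *v (C *v x k)))))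
        \<le> \<rho> * energy x"
      unfolding L_def[symmetric]
      by (rule network_contraction[OF mode_contraction[OF lam2 lamN] Sigma1(1) incremental_sector \<gamma> L_u_le])
  qed (fact lipschitz edges \<xi>_indep \<xi>_square_integrable \<xi>_mean \<xi>_variance v_measurable v_square_integrable
      \<xi>_v_indep initial dynamics \<rho> eig)+
  show ?thesis
    by (rule exponential_synchronization) (rule v_covariance)
qed

end
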